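(* Let $\mathbb{N}$ be a real antisymmetric $n\times n$ matrix of corank $d$, $n=2k+d$, and write it, in a suitable orthonormal basis of $\mathbb{R}^n$, as $\mathbb{N}=\begin{bmatrix}\bar{\mathbb{N}} & 0 \\ 0 & 0\end{bmatrix}$ with $\bar{\mathbb{N}}$ an invertible antisymmetric $2k\times 2k$ matrix. Then the Bloch--Iserles system $\dot X(t)=[X(t)^2,\mathbb{N}]$ on the space of real symmetric $n\times n$ matrices describes geodesic motion on the generalized Jacobi group $\operatorname{Jac}(\mathbb{R}^{2k},-\bar{\mathbb{N}}^{-1};\mathbb{R}^d)$ relative to the left invariant Riemannian metric given at the identity by the Lagrangian (kinetic energy) $$\ell(\mathcal{S},\mathcal{A},\mathcal{B})=\tfrac12\operatorname{Tr}\big(\mathcal{S}^T(-\bar{\mathbb{N}}^{-2})\mathcal{S}\big)+\operatorname{Tr}\big(\mathcal{A}^T(-\bar{\mathbb{N}}^{-2})\mathcal{A}\big)+2\operatorname{Tr}(\mathcal{B}^2).$$ That is, a curve $\gamma(t)$ in $\operatorname{Jac}(\mathbb{R}^{2k},-\bar{\mathbb{N}}^{-1};\mathbb{R}^d)$ is a geodesic of this metric if and only if, writing $\gamma^{-1}\dot\gamma=(\mathcal{S},\mathcal{A},\mathcal{B})$ for its left logarithmic derivative, the curve of symmetric matrices $$X(t)=\begin{bmatrix} S & A^T \\ {A} & 2B \end{bmatrix},\qquad S=\bar{\mathbb{N}}^{-1}\mathcal{S},\quad A^T=\bar{\mathbb{N}}^{-1}\mathcal{A},\quad B=\mathcal{B},$$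 satisfies $\dot X=[X^2,\mathbb{N}]$.
   Context: $[\cdot,\cdot]$ is the matrix commutator; $M^{\rm sym}=\frac12(M+M^T)$; $\mathcal{M}_{p\times q}$ is the space of real $p\times q$ matrices; $\operatorname{Sym}(\mathbb{R}^d)$ the space of symmetric $d\times d$ matrices. For an invertible antisymmetric $2k\times2k$ matrix $\mathbb{J}$, $\operatorname{Sp}(\mathbb{R}^{2k},\mathbb{J})=\{g: g^T\mathbb{J}g=\mathbb{J}\}$, and the generalized Jacobi group is $\operatorname{Jac}(\mathbb{R}^{2k},\mathbb{J};\mathbb{R}^d)=\operatorname{Sp}(\mathbb{R}^{2k},\mathbb{J})\times\mathcal{M}_{2k\times d}\times\operatorname{Sym}(\mathbb{R}^d)$ with multiplication $$(g,\mathcal{A},\mathcal{B})(g',\mathcal{A}',\mathcal{B}')=\big(gg',\,\mathcal{A}+g\mathcal{A}',\,\mathcal{B}+\mathcal{B}'+\tfrac12(\mathcal{A}^T\mathbb{J}g\mathcal{A}')^{\rm sym}\big).$$ Its Lie algebra $\mathfrak{jac}(\mathbb{R}^{2k},\mathbb{J};\mathbb{R}^d)=\mathfrak{sp}(\mathbb{R}^{2k},\mathbb{J})\times\mathcal{M}_{2k\times d}\times\operatorname{Sym}(\mathbb{R}^d)\ni(\mathcal{S},\mathcal{A},\mathcal{B})$ has bracket $[(\mathcal{S},\mathcal{A},\mathcal{B}),(\mathcal{S}',\mathcal{A}',\mathcal{B}')]=([\mathcal{S},\mathcal{S}'],\mathcal{S}\mathcal{A}'-\mathcal{S}'\mathcal{A},(\mathcal{A}^T\mathbb{J}\mathcal{A}')^{\rm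 sym})$. Here $\mathbb{J}=-\bar{\mathbb{N}}^{-1}$. The metric "given at the identity by $\ell$" is the left invariant metric $\langle\!\langle\cdot,\cdot\rangle\!\rangle$ with $\ell(\xi)=\frac12\langle\!\langle\xi,\xi\rangle\!\rangle$ at the identity. *)

theory Defs
  imports "HOL-Analysis.Analysis" "HOL-Algebra.Group" "Jordan_Normal_Form.Matrix_Kernel"
begin

section \<open>Matrices\<close>

text \<open>
  Matrices are those of Jordan_Normal_Form, so that the sizes \<open>2 * k\<close> and \<open>d\<close> are
  natural numbers and the degenerate cases \<open>k = 0\<close> and \<open>d = 0\<close> are covered.
\<close>

definition mat_trace :: "real mat \<Rightarrow> real" where
  "mat_trace M = (\<Sum>i<dim_row M. M $$ (i, i))"

definition sym_part :: "real mat \<Rightarrow> real mat" where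
  "sym_part M = (1 / 2) \<cdot>\<^sub>m (M + transpose_mat M)"

definition commutator :: "real mat \<Rightarrow> real mat \<Rightarrow> real mat" where
  "commutator A B = A * B - B * A"

definition mat_inv :: "real mat \<Rightarrow> real mat" where
  "mat_inv M = the (mat_inverse M)"

text \<open>The columns of \<open>Q\<close> are the orthonormal basis in which \<open>N\<close> is written.\<close>

definition normal_form :: "nat \<Rightarrow> nat \<Rightarrow> real mat \<Rightarrow> real mat \<Rightarrow> real mat \<Rightarrow> bool" where
  "normal_form k d N Q Nb \<longleftrightarrow>
     Q \<in> carrier_mat (2 * k + d) (2 * k + d) \<and>
     transpose_mat Q * Q = 1\<^sub>m (2 * k + d) \<and>
     Nb \<in> carrier_mat (2 * k) (2 * k) \<and> transpose_mat Nb = - Nb \<and> invertible_mat Nb \<and>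
     N = Q * four_block_mat Nb (0\<^sub>m (2 * k) d) (0\<^sub>m d (2 * k)) (0\<^sub>m d d) * transpose_mat Q"

section \<open>Triples of matrices\<close>

text \<open>
  \<open>Jac\<close> is a submanifold of the vector space of triples of matrices of sizes
  \<open>m \<times> m\<close>, \<open>m \<times> d\<close>, \<open>d \<times> d\<close>; its tangent vectors are represented by such triples.
\<close>

type_synonym triple = "real mat \<times> real mat \<times> real mat"

fun tri_add :: "triple \<Rightarrow> triple \<Rightarrow> triple" where
  "tri_add (S, A, B) (S', A', B') = (S + S', A + A', B + B')"

fun tri_smult :: "real \<Rightarrow> triple \<Rightarrow> triple" where
  "tri_smult r (S, A, B) = (r \<cdot>\<^sub>m S, r \<cdot>\<^sub>m A, r \<cdot>\<^sub>m B)"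

definition tri_zero :: "nat \<Rightarrow> nat \<Rightarrow> triple" where
  "tri_zero m d = (0\<^sub>m m m, 0\<^sub>m m d, 0\<^sub>m d d)"

definition mat_deriv :: "(real \<Rightarrow> real mat) \<Rightarrow> real \<Rightarrow> real mat" where
  "mat_deriv M t =
     mat (dim_row (M t)) (dim_col (M t)) (\<lambda>(i, j). deriv (\<lambda>\<tau>. M \<tau> $$ (i, j)) t)"

definition velocity :: "(real \<Rightarrow> triple) \<Rightarrow> real \<Rightarrow> triple" where
  "velocity c t =
     (mat_deriv (\<lambda>\<tau>. fst (c \<tau>)) t,
      mat_deriv (\<lambda>\<tau>. fst (snd (c \<tau>))) t,
      mat_deriv (\<lambda>\<tau>. snd (snd (c \<tau>))) t)"

definition inner_product_on ::
  "nat \<Rightarrow> nat \<Rightarrow> triple set \<Rightarrow> (triple \<Rightarrow> triple \<Rightarrow> real) \<Rightarrow> bool" where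
  "inner_product_on m d V ip \<longleftrightarrow>
     (\<forall>u\<in>V. \<forall>v\<in>V. ip u v = ip v u) \<and>
     (\<forall>u\<in>V. \<forall>v\<in>V. \<forall>w\<in>V. ip (tri_add u v) w = ip u w + ip v w) \<and>
     (\<forall>r. \<forall>u\<in>V. \<forall>v\<in>V. ip (tri_smult r u) v = r * ip u v) \<and>
     (\<forall>u\<in>V. u \<noteq> tri_zero m d \<longrightarrow> ip u u > 0)"

section \<open>Smoothness\<close>

text \<open>\<open>C\<close>-infinity on an open set: all iterated directional derivatives exist and are continuous.\<close>

primrec Ck_on ::
  "nat \<Rightarrow> 'a::real_normed_vector set \<Rightarrow> ('a \<Rightarrow> 'b::real_normed_vector) \<Rightarrow> bool" where
  "Ck_on 0 U f \<longleftrightarrow> continuous_on U f"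
| "Ck_on (Suc n) U f \<longleftrightarrow>
     (\<forall>x\<in>U. f differentiable (at x)) \<and>
     (\<forall>v. Ck_on n U (\<lambda>x. frechet_derivative f (at x) v))"

definition smooth_on :: "'a::real_normed_vector set \<Rightarrow> ('a \<Rightarrow> 'b::real_normed_vector) \<Rightarrow> bool" where
  "smooth_on U f \<longleftrightarrow> (\<forall>n. Ck_on n U f)"

definition smooth_triple_on ::
  "nat \<Rightarrow> nat \<Rightarrow> 'a::real_normed_vector set \<Rightarrow> ('a \<Rightarrow> triple) \<Rightarrow> bool" where
  "smooth_triple_on m d U f \<longleftrightarrow>
     (\<forall>i<m. \<forall>j<m. smooth_on U (\<lambda>x. fst (f x) $$ (i, j))) \<and>
     (\<forall>i<m. \<forall>j<d. smooth_on U (\<lambda>x. fst (snd (f x)) $$ (i, j))) \<and>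
     (\<forall>i<d. \<forall>j<d. smooth_on U (\<lambda>x. snd (snd (f x)) $$ (i, j)))"

section \<open>Geodesics\<close>

text \<open>
  Here \<open>M\<close> is a submanifold of the space of triples and \<open>met p u v\<close> is a Riemannian metric
  on it, evaluated at \<open>p\<close> on the tangent vectors \<open>u\<close>, \<open>v\<close>. Geodesics are the smooth curves
  that are critical points of the kinetic energy on every compact subinterval,
  for smooth variations inside \<open>M\<close> with fixed endpoints. A variation is smooth on the
  strip \<open>(-\<epsilon>, \<epsilon>) \<times> [a, b]\<close> in the usual sense of having a smooth extension to a
  neighbourhood; the values of \<open>\<Gamma>\<close> off the strip need not lie in \<open>M\<close>.
\<close>

definition energy ::
  "(triple \<Rightarrow> triple \<Rightarrow> triple \<Rightarrow> real) \<Rightarrow> real \<Rightarrow> real \<Rightarrow> (real \<Rightarrow> triple) \<Rightarrow> real" where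
  "energy met a b c =
     integral {a..b} (\<lambda>t. (1 / 2) * met (c t) (velocity c t) (velocity c t))"

definition proper_variation ::
  "nat \<Rightarrow> nat \<Rightarrow> triple set \<Rightarrow> (real \<Rightarrow> triple) \<Rightarrow> real \<Rightarrow> real \<Rightarrow> real \<Rightarrow>
   (real \<Rightarrow> real \<Rightarrow> triple) \<Rightarrow> bool" where
  "proper_variation m d M c a b \<epsilon> \<Gamma> \<longleftrightarrow>
     0 < \<epsilon> \<and>
     (\<exists>U. open U \<and> {-\<epsilon><..<\<epsilon>} \<times> {a..b} \<subseteq> U \<and>
        smooth_triple_on m d U (\<lambda>(s, t). \<Gamma> s t)) \<and>
     (\<forall>s\<in>{-\<epsilon><..<\<epsilon>}. \<forall>t\<in>{a..b}. \<Gamma> s t \<in> M) \<and>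
     (\<forall>s\<in>{-\<epsilon><..<\<epsilon>}. \<Gamma> s a = c a \<and> \<Gamma> s b = c b) \<and>
     (\<forall>t\<in>{a..b}. \<Gamma> 0 t = c t)"

definition geodesic_on ::
  "nat \<Rightarrow> nat \<Rightarrow> triple set \<Rightarrow> (triple \<Rightarrow> triple \<Rightarrow> triple \<Rightarrow> real) \<Rightarrow>
   real set \<Rightarrow> (real \<Rightarrow> triple) \<Rightarrow> bool" where
  "geodesic_on m d M met I c \<longleftrightarrow>
     smooth_triple_on m d I c \<and> (\<forall>t\<in>I. c t \<in> M) \<and>
     (\<forall>a b \<epsilon> \<Gamma>. a < b \<and> {a..b} \<subseteq> I \<and> proper_variation m d M c a b \<epsilon> \<Gamma> \<longrightarrow>
        ((\<lambda>s. energy met a b (\<Gamma> s)) has_real_derivative 0) (at 0))"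

section \<open>The generalized Jacobi group\<close>

definition Sp :: "nat \<Rightarrow> real mat \<Rightarrow> real mat set" where
  "Sp m J = {g \<in> carrier_mat m m. transpose_mat g * J * g = J}"

definition Sym :: "nat \<Rightarrow> real mat set" where
  "Sym d = {B \<in> carrier_mat d d. transpose_mat B = B}"

fun jac_mult :: "real mat \<Rightarrow> triple \<Rightarrow> triple \<Rightarrow> triple" where
  "jac_mult J (g, A, B) (g', A', B') =
     (g * g', A + g * A', B + B' + (1 / 2) \<cdot>\<^sub>m sym_part (transpose_mat A * J * g * A'))"

definition Jac :: "nat \<Rightarrow> real mat \<Rightarrow> nat \<Rightarrow> triple monoid" where
  "Jac m J d =
     \<lparr>carrier = Sp m J \<times> carrier_mat m d \<times> Sym d,
      mult = jac_mult J,
      one = (1\<^sub>m m, 0\<^sub>m m d, 0\<^sub>m d d)\<rparr>"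

definition sp_algebra :: "nat \<Rightarrow> real mat \<Rightarrow> real mat set" where
  "sp_algebra m J = {S \<in> carrier_mat m m. transpose_mat S * J + J * S = 0\<^sub>m m m}"

definition jac_algebra :: "nat \<Rightarrow> real mat \<Rightarrow> nat \<Rightarrow> triple set" where
  "jac_algebra m J d = sp_algebra m J \<times> carrier_mat m d \<times> Sym d"

text \<open>
  The differential at \<open>p\<close> of left translation by the inverse of \<open>p\<close>, taking the tangent
  vector \<open>u\<close> at \<open>p\<close> to one at the identity. It is computed along the straight line
  \<open>p + s u\<close> in the ambient space, to which the formula for the product extends polynomially.
\<close>

definition to_identity :: "triple monoid \<Rightarrow> triple \<Rightarrow> triple \<Rightarrow> triple" where
  "to_identity G p u =
     velocity (\<lambda>s. inv\<^bsub>G\<^esub> p \<otimes>\<^bsub>G\<^esub> tri_add p (tri_smult s u)) 0"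

definition left_invariant_metric ::
  "triple monoid \<Rightarrow> (triple \<Rightarrow> triple \<Rightarrow> real) \<Rightarrow> triple \<Rightarrow> triple \<Rightarrow> triple \<Rightarrow> real" where
  "left_invariant_metric G ip p u v = ip (to_identity G p u) (to_identity G p v)"

definition left_log_deriv :: "triple monoid \<Rightarrow> (real \<Rightarrow> triple) \<Rightarrow> real \<Rightarrow> triple" where
  "left_log_deriv G c t = to_identity G (c t) (velocity c t)"

section \<open>The Lagrangian and the Bloch--Iserles system\<close>

fun lagrangian :: "real mat \<Rightarrow> triple \<Rightarrow> real" where
  "lagrangian Nb (S, A, B) =
     (let P = - (mat_inv Nb * mat_inv Nb)
      in (1 / 2) * mat_trace (transpose_mat S * P * S)
         + mat_trace (transpose_mat A * P * A) + 2 * mat_trace (B * B))"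

text \<open>
  Polarization: since the Lagrangian is a quadratic form, this is the symmetric bilinear
  form \<open>ip\<close> with \<open>lagrangian Nb \<xi> = (1 / 2) * ip \<xi> \<xi>\<close>.
\<close>

definition lagrangian_form :: "real mat \<Rightarrow> triple \<Rightarrow> triple \<Rightarrow> real" where
  "lagrangian_form Nb \<xi> \<eta> =
     lagrangian Nb (tri_add \<xi> \<eta>) - lagrangian Nb \<xi> - lagrangian Nb \<eta>"

text \<open>
  The block matrix is the matrix of the operator in the orthonormal basis given by the
  columns of \<open>Q\<close>; conjugation by \<open>Q\<close> expresses it in the standard basis, in which \<open>N\<close> is given.
\<close>

fun bi_matrix :: "real mat \<Rightarrow> real mat \<Rightarrow> triple \<Rightarrow> real mat" where
  "bi_matrix Q Nb (S, A, B) =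
     Q * four_block_mat (mat_inv Nb * S) (mat_inv Nb * A)
           (transpose_mat (mat_inv Nb * A)) (2 \<cdot>\<^sub>m B) * transpose_mat Q"

definition bloch_iserles_on ::
  "nat \<Rightarrow> real mat \<Rightarrow> real set \<Rightarrow> (real \<Rightarrow> real mat) \<Rightarrow> bool" where
  "bloch_iserles_on n N I X \<longleftrightarrow>
     (\<forall>t\<in>I. X t \<in> Sym n \<and>
        (\<forall>i<n. \<forall>j<n.
           ((\<lambda>\<tau>. X \<tau> $$ (i, j)) has_real_derivative commutator (X t * X t) N $$ (i, j)) (at t)))"

end

theory Submission
  imports Defs
begin

text \<open>
  The linear isomorphism \<open>(\<S>, \<A>, \<B>) \<mapsto> X\<close> from the Lie algebra to the symmetric matrices turns the
  inner product into \<open>Tr (X Y)\<close> and the bracket into \<open>X N Y - Y N X\<close>. For a variation of a curve let \<open>X\<close>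
  and \<open>H\<close> belong to the logarithmic derivatives in the time direction and in the variation
  direction. Equality of mixed partial derivatives gives \<open>\<partial>\<^sub>s X = \<partial>\<^sub>t H + (X N H - H N X)\<close>, so that
  integration by parts yields the first variation \<open>- \<integral> Tr ((X' - [X\<^sup>2, N]) H) dt\<close>. This vanishes for
  solutions of the Bloch--Iserles system. Conversely it is tested with \<open>H = (t - a) (b - t) V\<close> on
  arbitrarily small intervals \<open>[a, b]\<close>, where the upper left block of \<open>V\<close> is zero or of the form
  \<open>v v\<^sup>T\<close>: then \<open>1 + u Nb v v\<^sup>T\<close> is a symplectic transvection, and the variation is affine in its
  parameter. The normal form of \<open>N\<close> is obtained by splitting off one kernel vector at a time with
  a Householder reflection.
\<close>

section \<open>Smooth functions\<close>

text \<open>Left translation would bring the inverse of \<open>g\<close> into every formula. Since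
  \<open>X\<close> contains \<open>L\<close> times the logarithmic derivative, with \<open>L\<close>
  the inverse of \<open>Nb\<close>, and \<open>L g^-1 = g\<^sup>T L\<close> for symplectic
  \<open>g\<close>, only polynomials in the entries remain, and sums and products suffice for all
  smoothness arguments. With \<open>D = 2 B\<close> the Lagrangian is \<open>Tr (X X) / 2\<close>,
  which explains its weights 1/2, 1 and 2. The obstacle is the extension of a variation: it is
  smooth near the strip but lies in the group only on the strip, may have wrong sizes elsewhere, and
  at the end times its time derivative looks outside. So matrices are cut to a fixed size, group
  identities are differentiated only along segments inside the strip, and the two end times are
  discarded as a null set. In the converse, the admissible upper left blocks do not form a linear
  space. But the first variation is linear in \<open>H\<close> and the matrices
  \<open>v v\<^sup>T\<close> span the symmetric ones, so testing against them suffices.\<close>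

lemma Ck_on_cong:
  assumes "open U" "\<And>x. x \<in> U \<Longrightarrow> f x = g x" "Ck_on n U f"
  shows "Ck_on n U g"
  using assms(2,3)
proof (induction n arbitrary: f g)
  case 0
  then show ?case using continuous_on_eq by auto
next
  case (Suc n)
  have d: "f differentiable (at x)" if "x \<in> U" for x using Suc.prems that by simp
  have fd: "(f has_derivative frechet_derivative f (at x)) (at x)" if "x \<in> U" for x
    using d[OF that] frechet_derivative_works by blast
  \<comment> \<open>Openness of \<open>U\<close> turns agreement on \<open>U\<close> into agreement
    near \<open>x\<close>, which is what the derivative depends on.\<close>
  have gd: "(g has_derivative frechet_derivative f (at x)) (at x)" if "x \<in> U" for x
    by (rule has_derivative_transform_within_open[OF fd[OF that] assms(1) that]) (simp add: Suc.prems(1))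
  have eq: "frechet_derivative g (at x) = frechet_derivative f (at x)" if "x \<in> U" for x
    using frechet_derivative_at[OF gd[OF that]] by simp
  have "g differentiable (at x)" if "x \<in> U" for x
    using gd[OF that] by (rule differentiableI)
  moreover have "Ck_on n U (\<lambda>x. frechet_derivative g (at x) v)" for v
  proof (rule Suc.IH)
    show "Ck_on n U (\<lambda>x. frechet_derivative f (at x) v)" using Suc.prems(2) by simp
  qed (simp add: eq)
  ultimately show ?case by simp
qed

lemma Ck_on_Suc_imp: "Ck_on (Suc n) U f \<Longrightarrow> Ck_on n U f"
proof (induction n arbitrary: f)
  case 0
  then show ?case
    by (auto intro!: continuous_at_imp_continuous_on differentiable_imp_continuous_within)
next
  case (Suc n)
  have "Ck_on (Suc n) U (\<lambda>x. frechet_derivative f (at x) v)" for v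
    using Suc.prems by simp
  then have "Ck_on n U (\<lambda>x. frechet_derivative f (at x) v)" for v
    using Suc.IH by blast
  then show ?case using Suc.prems by simp
qed

lemma Ck_on_const: "Ck_on n U (\<lambda>x. c)"
  by (induction n arbitrary: c) (simp_all add: frechet_derivative_const)

lemma frechet_derivative_add:
  assumes "f differentiable (at x)" "g differentiable (at x)"
  shows "frechet_derivative (\<lambda>x. f x + g x) (at x) v =
    frechet_derivative f (at x) v + frechet_derivative g (at x) v"
  using fun_cong[OF frechet_derivative_at[OF has_derivative_add[OF assms[unfolded frechet_derivative_works]]], of v]
  by simp

lemma Ck_on_add:
  assumes "open U" "Ck_on n U f" "Ck_on n U g"
  shows "Ck_on n U (\<lambda>x. f x + g x)"
  using assms(2,3)
proof (induction n arbitrary: f g)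
  case 0
  then show ?case by (simp add: continuous_on_add)
next
  case (Suc n)
  have "Ck_on n U (\<lambda>x. frechet_derivative (\<lambda>x. f x + g x) (at x) v)" for v
  proof (rule Ck_on_cong[OF assms(1)])
    show "Ck_on n U (\<lambda>x. frechet_derivative f (at x) v + frechet_derivative g (at x) v)"
      using Suc by simp
  qed (use Suc.prems in \<open>simp add: frechet_derivative_add\<close>)
  then show ?case using Suc.prems by (simp add: differentiable_add)
qed

lemma frechet_derivative_mult:
  fixes f g :: "'a::real_normed_vector \<Rightarrow> real"
  assumes "f differentiable (at x)" "g differentiable (at x)"
  shows "frechet_derivative (\<lambda>x. f x * g x) (at x) v =
    f x * frechet_derivative g (at x) v + frechet_derivative f (at x) v * g x"
  using fun_cong[OF frechet_derivative_at[OF has_derivative_mult[OF assms[unfolded frechet_derivative_works]]], of v]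
  by simp

text \<open>The Leibniz rule leaves undifferentiated factors, which are one order smoother than the
  induction hypothesis wants; \<open>Ck_on_Suc_imp\<close> lowers them.\<close>

lemma Ck_on_mult:
  fixes f g :: "'a::real_normed_vector \<Rightarrow> real"
  assumes "open U" "Ck_on n U f" "Ck_on n U g"
  shows "Ck_on n U (\<lambda>x. f x * g x)"
  using assms(2,3)
proof (induction n arbitrary: f g)
  case 0
  then show ?case by (simp add: continuous_on_mult)
next
  case (Suc n)
  have "Ck_on n U (\<lambda>x. frechet_derivative (\<lambda>x. f x * g x) (at x) v)" for v
  proof (rule Ck_on_cong[OF assms(1)])
    show "Ck_on n U (\<lambda>x. f x * frechet_derivative g (at x) v + frechet_derivative f (at x) v * g x)"
      using Suc.prems Ck_on_Suc_imp[OF Suc.prems(1)] Ck_on_Suc_imp[OF Suc.prems(2)]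
      by (intro Ck_on_add assms(1) Suc.IH) simp_all
  qed (use Suc.prems in \<open>simp add: frechet_derivative_mult\<close>)
  then show ?case using Suc.prems by (simp add: differentiable_mult)
qed

lemma Ck_on_bounded_linear:
  assumes "bounded_linear f"
  shows "Ck_on n U f"
proof (cases n)
  case 0
  then show ?thesis using assms by (simp add: linear_continuous_on)
next
  case (Suc k)
  have "frechet_derivative f (at x) = f" for x
    using frechet_derivative_at[OF bounded_linear_imp_has_derivative[OF assms]] by simp
  then show ?thesis
    using Suc bounded_linear_imp_differentiable[OF assms] by (simp add: Ck_on_const)
qed

text \<open>Lets a curve count as a two-parameter family independent of its first parameter. The
  derivative in direction \<open>v\<close> is again a function of \<open>snd x\<close>, namely the
  derivative of \<open>f\<close> in direction \<open>snd v\<close>, so the induction closes.\<close>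

lemma Ck_on_compose_snd:
  fixes f :: "real \<Rightarrow> real"
  assumes "open I" "Ck_on n I f"
  shows "Ck_on n (UNIV \<times> I) (\<lambda>x::real \<times> real. f (snd x))"
  using assms(2)
proof (induction n arbitrary: f)
  case 0
  then have "continuous_on I f" by simp
  from continuous_on_compose2[OF this continuous_on_snd[OF continuous_on_id], of "UNIV \<times> I"]
  show ?case by auto
next
  case (Suc n)
  have o: "open (UNIV \<times> I :: (real \<times> real) set)" using assms(1) by (simp add: open_Times)
  have hd: "((\<lambda>x::real \<times> real. f (snd x)) has_derivative
    (\<lambda>v. frechet_derivative f (at (snd x)) (snd v))) (at x)" if "x \<in> UNIV \<times> I" for x
  proof -
    have "(f has_derivative frechet_derivative f (at (snd x))) (at (snd x))"
      using Suc.prems that frechet_derivative_works by (auto simp: mem_Times_iff)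
    from has_derivative_compose[OF has_derivative_snd[OF has_derivative_ident] this]
    show ?thesis by simp
  qed
  then have eq: "frechet_derivative (\<lambda>x::real \<times> real. f (snd x)) (at x) v =
    frechet_derivative f (at (snd x)) (snd v)" if "x \<in> UNIV \<times> I" for x v
    using frechet_derivative_at[OF hd[OF that]] by metis
  have "Ck_on n (UNIV \<times> I) (\<lambda>x. frechet_derivative (\<lambda>x::real \<times> real. f (snd x)) (at x) v)" for v
  proof (rule Ck_on_cong[OF o])
    show "Ck_on n (UNIV \<times> I) (\<lambda>x::real \<times> real. frechet_derivative f (at (snd x)) (snd v))"
      using Suc.IH[of "\<lambda>y. frechet_derivative f (at y) (snd v)"] Suc.prems by simp
  qed (simp add: eq)
  moreover have "\<forall>x\<in>UNIV \<times> I. (\<lambda>x::real \<times> real. f (snd x)) differentiable (at x)"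
    using hd differentiableI by blast
  ultimately show ?case by simp
qed

lemma smooth_on_const [simp]: "smooth_on U (\<lambda>x. c)"
  by (simp add: smooth_on_def Ck_on_const)

lemma smooth_on_add: "open U \<Longrightarrow> smooth_on U f \<Longrightarrow> smooth_on U g \<Longrightarrow> smooth_on U (\<lambda>x. f x + g x)"
  by (simp add: smooth_on_def Ck_on_add)

lemma smooth_on_mult:
  fixes f g :: "'a::real_normed_vector \<Rightarrow> real"
  shows "open U \<Longrightarrow> smooth_on U f \<Longrightarrow> smooth_on U g \<Longrightarrow> smooth_on U (\<lambda>x. f x * g x)"
  by (simp add: smooth_on_def Ck_on_mult)

lemma smooth_on_sum:
  "open U \<Longrightarrow> (\<And>i. i \<in> A \<Longrightarrow> smooth_on U (f i)) \<Longrightarrow> smooth_on U (\<lambda>x. \<Sum>i\<in>A. f i x)"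
  by (induction A rule: infinite_finite_induct) (simp_all add: smooth_on_add)

lemma smooth_on_bounded_linear: "bounded_linear f \<Longrightarrow> smooth_on U f"
  by (simp add: smooth_on_def Ck_on_bounded_linear)

lemma smooth_on_compose_snd:
  fixes f :: "real \<Rightarrow> real"
  shows "open I \<Longrightarrow> smooth_on I f \<Longrightarrow> smooth_on (UNIV \<times> I) (\<lambda>x::real \<times> real. f (snd x))"
  by (simp add: smooth_on_def Ck_on_compose_snd)

lemma smooth_on_frechet_derivative:
  "smooth_on U f \<Longrightarrow> smooth_on U (\<lambda>x. frechet_derivative f (at x) v)"
  unfolding smooth_on_def by (metis Ck_on.simps(2))

lemma smooth_on_imp_differentiable: "smooth_on U f \<Longrightarrow> x \<in> U \<Longrightarrow> f differentiable (at x)"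
  unfolding smooth_on_def by (metis Ck_on.simps(2))

lemma smooth_on_imp_has_derivative:
  "smooth_on U f \<Longrightarrow> x \<in> U \<Longrightarrow> (f has_derivative frechet_derivative f (at x)) (at x)"
  using smooth_on_imp_differentiable frechet_derivative_works by blast

lemma smooth_on_imp_continuous_on: "smooth_on U f \<Longrightarrow> continuous_on U f"
  unfolding smooth_on_def by (metis Ck_on.simps(1))

lemma smooth_on_imp_has_real_derivative:
  fixes f :: "real \<Rightarrow> real"
  assumes "smooth_on U f" "t \<in> U"
  shows "(f has_real_derivative frechet_derivative f (at t) 1) (at t)"
proof -
  have d: "(f has_derivative frechet_derivative f (at t)) (at t)"
    by (rule smooth_on_imp_has_derivative[OF assms])
  have "frechet_derivative f (at t) h = frechet_derivative f (at t) 1 * h" for h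
    using linear_cmul[OF has_derivative_linear[OF d], of h 1] by (simp add: mult.commute)
  then have "frechet_derivative f (at t) = (*) (frechet_derivative f (at t) 1)" by (rule ext)
  then show ?thesis unfolding has_field_derivative_def by (rule has_derivative_eq_rhs[OF d])
qed

section \<open>Partial derivatives and differentiation under the integral sign\<close>

lemma partial_fst:
  fixes f :: "real \<times> real \<Rightarrow> real"
  assumes "smooth_on U f" "(s, t) \<in> U"
  shows "((\<lambda>\<sigma>. f (\<sigma>, t)) has_real_derivative frechet_derivative f (at (s, t)) (1, 0)) (at s)"
proof -
  have d: "(f has_derivative frechet_derivative f (at (s, t))) (at (s, t))"
    by (rule smooth_on_imp_has_derivative[OF assms])
  have "((\<lambda>\<sigma>. (\<sigma>, t)) has_derivative (\<lambda>h. (h, 0))) (at s)"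
    by (auto intro!: derivative_eq_intros)
  from has_derivative_compose[OF this d]
  have *: "((\<lambda>\<sigma>. f (\<sigma>, t)) has_derivative (\<lambda>h. frechet_derivative f (at (s, t)) (h, 0))) (at s)" .
  have "frechet_derivative f (at (s, t)) (h, 0) = frechet_derivative f (at (s, t)) (1, 0) * h" for h
    using linear_cmul[OF has_derivative_linear[OF d], of h "(1, 0)"] by (simp add: mult.commute)
  then have "(\<lambda>h. frechet_derivative f (at (s, t)) (h, 0)) = (*) (frechet_derivative f (at (s, t)) (1, 0))"
    by (rule ext)
  then show ?thesis unfolding has_field_derivative_def by (rule has_derivative_eq_rhs[OF *])
qed

lemma partial_snd:
  fixes f :: "real \<times> real \<Rightarrow> real"
  assumes "smooth_on U f" "(s, t) \<in> U"
  shows "((\<lambda>\<tau>. f (s, \<tau>)) has_real_derivative frechet_derivative f (at (s, t)) (0, 1)) (at t)"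
proof -
  have d: "(f has_derivative frechet_derivative f (at (s, t))) (at (s, t))"
    by (rule smooth_on_imp_has_derivative[OF assms])
  have "((\<lambda>\<tau>. (s, \<tau>)) has_derivative (\<lambda>h. (0, h))) (at t)"
    by (auto intro!: derivative_eq_intros)
  from has_derivative_compose[OF this d]
  have *: "((\<lambda>\<tau>. f (s, \<tau>)) has_derivative (\<lambda>h. frechet_derivative f (at (s, t)) (0, h))) (at t)" .
  have "frechet_derivative f (at (s, t)) (0, h) = frechet_derivative f (at (s, t)) (0, 1) * h" for h
    using linear_cmul[OF has_derivative_linear[OF d], of h "(0, 1)"] by (simp add: mult.commute)
  then have "(\<lambda>h. frechet_derivative f (at (s, t)) (0, h)) = (*) (frechet_derivative f (at (s, t)) (0, 1))"
    by (rule ext)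
  then show ?thesis unfolding has_field_derivative_def by (rule has_derivative_eq_rhs[OF *])
qed

lemma leibniz_rule_smooth:
  fixes f :: "real \<times> real \<Rightarrow> real"
  assumes "smooth_on U f" "{c<..<d} \<times> {a..b} \<subseteq> U" "s \<in> {c<..<d}"
  shows "((\<lambda>\<sigma>. integral {a..b} (\<lambda>t. f (\<sigma>, t))) has_real_derivative
    integral {a..b} (\<lambda>t. frechet_derivative f (at (s, t)) (1, 0))) (at s)"
proof -
  have cont: "continuous_on ({c<..<d} \<times> {a..b}) f"
    using smooth_on_imp_continuous_on[OF assms(1)] assms(2) continuous_on_subset by blast
  have cont': "continuous_on ({c<..<d} \<times> {a..b}) (\<lambda>x. frechet_derivative f (at x) (1, 0))"
    using smooth_on_imp_continuous_on[OF smooth_on_frechet_derivative[OF assms(1)]] assms(2)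
      continuous_on_subset by blast
  have "((\<lambda>\<sigma>. integral (cbox a b) (\<lambda>t. f (\<sigma>, t))) has_real_derivative
    integral (cbox a b) (\<lambda>t. frechet_derivative f (at (s, t)) (1, 0))) (at s within {c<..<d})"
  proof (rule leibniz_rule_field_derivative)
    show "((\<lambda>x. f (x, t)) has_real_derivative frechet_derivative f (at (x, t)) (1, 0))
        (at x within {c<..<d})" if "x \<in> {c<..<d}" "t \<in> cbox a b" for x t
      by (rule has_field_derivative_at_within[OF partial_fst[OF assms(1)]]) (use that assms(2) in auto)
    show "(\<lambda>t. f (x, t)) integrable_on cbox a b" if "x \<in> {c<..<d}" for x
      using that by (auto intro!: integrable_continuous_interval continuous_on_compose2[OF cont] continuous_intros)
    show "continuous_on ({c<..<d} \<times> cbox a b) (\<lambda>(x, t). frechet_derivative f (at (x, t)) (1, 0))"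
      using cont' by (simp add: case_prod_unfold)
  qed (use assms(3) in \<open>auto simp: convex_real_interval\<close>)
  then show ?thesis using assms(3) by (simp add: at_within_open[OF _ open_greaterThanLessThan])
qed

text \<open>The fundamental theorem of calculus is used twice: \<open>f\<close> is an integral of
  its \<open>t\<close>-derivative, differentiation under the integral represents the
  \<open>s\<close>-derivative as an integral of the mixed derivative, and the
  \<open>t\<close>-derivative of that integral is its integrand.\<close>

lemma mixed_partials_commute:
  fixes f :: "real \<times> real \<Rightarrow> real"
  assumes "open U" and f: "smooth_on U f" and "x \<in> U"
  shows "frechet_derivative (\<lambda>y. frechet_derivative f (at y) (0, 1)) (at x) (1, 0) =
    frechet_derivative (\<lambda>y. frechet_derivative f (at y) (1, 0)) (at x) (0, 1)"
proof -
  obtain s t where x: "x = (s, t)" by (cases x)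
  define ft where "ft = (\<lambda>y. frechet_derivative f (at y) (0, 1))"
  define fs where "fs = (\<lambda>y. frechet_derivative f (at y) (1, 0))"
  define fts where "fts = (\<lambda>y. frechet_derivative ft (at y) (1, 0))"
  have ft: "smooth_on U ft" and fs: "smooth_on U fs"
    unfolding ft_def fs_def by (auto intro: smooth_on_frechet_derivative f)
  have fts: "smooth_on U fts" unfolding fts_def by (rule smooth_on_frechet_derivative[OF ft])
  obtain A B where AB: "open A" "open B" "s \<in> A" "t \<in> B" "A \<times> B \<subseteq> U"
    using open_prod_elim[OF assms(1), of "(s, t)"] assms(3) x by (metis mem_Sigma_iff)
  \<comment> \<open>An open interval in \<open>s\<close> for differentiating, a closed one in
    \<open>t\<close> for integrating, with \<open>t\<close> in its interior.\<close>
  obtain e1 where e1: "e1 > 0" "ball s e1 \<subseteq> A" using AB open_contains_ball by metis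
  obtain e2 where e2: "e2 > 0" "cball t e2 \<subseteq> B" using AB open_contains_cball by metis
  define a where "a = t - e2"
  define b where "b = t + e2"
  have sub: "{s - e1<..<s + e1} \<times> {a..b} \<subseteq> U"
    using e1 e2 AB(5) unfolding a_def b_def ball_eq_greaterThanLessThan cball_eq_atLeastAtMost by blast
  have st: "s \<in> {s - e1<..<s + e1}" "t \<in> {a<..<b}" using e1 e2 by (auto simp: a_def b_def)
  have ftc: "f (\<sigma>, \<tau>) = f (\<sigma>, a) + integral {a..\<tau>} (\<lambda>r. ft (\<sigma>, r))"
    if "\<sigma> \<in> {s - e1<..<s + e1}" "\<tau> \<in> {a..b}" for \<sigma> \<tau>
  proof -
    have "((\<lambda>r. ft (\<sigma>, r)) has_integral f (\<sigma>, \<tau>) - f (\<sigma>, a)) {a..\<tau>}"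
    proof (rule fundamental_theorem_of_calculus)
      fix r assume "r \<in> {a..\<tau>}"
      then have "(\<sigma>, r) \<in> U" using that sub by auto
      then show "((\<lambda>r. f (\<sigma>, r)) has_vector_derivative ft (\<sigma>, r)) (at r within {a..\<tau>})"
        using partial_snd[OF f] unfolding ft_def
        by (meson has_real_derivative_iff_has_vector_derivative has_vector_derivative_at_within)
    qed (use that in auto)
    then show ?thesis by (simp add: integral_unique)
  qed
  have key: "fs (s, \<tau>) = fs (s, a) + integral {a..\<tau>} (\<lambda>r. fts (s, r))" if "\<tau> \<in> {a..b}" for \<tau>
  proof -
    have sub': "{s - e1<..<s + e1} \<times> {a..\<tau>} \<subseteq> U" using sub that by fastforce
    have 1: "((\<lambda>\<sigma>. f (\<sigma>, \<tau>)) has_real_derivative fs (s, \<tau>)) (at s)"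
      unfolding fs_def using sub st that by (intro partial_fst[OF f]) auto
    have "((\<lambda>\<sigma>. f (\<sigma>, a)) has_real_derivative fs (s, a)) (at s)"
      unfolding fs_def using sub st that by (intro partial_fst[OF f]) auto
    from DERIV_add[OF this leibniz_rule_smooth[OF ft sub' st(1)]]
    have 2: "((\<lambda>\<sigma>. f (\<sigma>, a) + integral {a..\<tau>} (\<lambda>r. ft (\<sigma>, r))) has_real_derivative
      fs (s, a) + integral {a..\<tau>} (\<lambda>r. fts (s, r))) (at s)" unfolding fts_def .
    have "((\<lambda>\<sigma>. f (\<sigma>, \<tau>)) has_real_derivative
      fs (s, a) + integral {a..\<tau>} (\<lambda>r. fts (s, r))) (at s)"
      by (rule has_field_derivative_transform_within_open[OF 2 open_greaterThanLessThan st(1)])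
        (rule ftc[OF _ that, symmetric])
    then show ?thesis using 1 DERIV_unique by blast
  qed
  have "continuous_on {a..b} (\<lambda>r. fts (s, r))"
    using sub st
    by (intro continuous_on_compose2[OF smooth_on_imp_continuous_on[OF fts]] continuous_intros) auto
  then have "((\<lambda>\<tau>. integral {a..\<tau>} (\<lambda>r. fts (s, r))) has_real_derivative fts (s, t)) (at t within {a..b})"
    by (rule integral_has_real_derivative) (use st in auto)
  then have "((\<lambda>\<tau>. fs (s, a) + integral {a..\<tau>} (\<lambda>r. fts (s, r))) has_real_derivative fts (s, t)) (at t)"
    using DERIV_add[OF DERIV_const] st(2) by (fastforce simp: at_within_Icc_at)
  then have "((\<lambda>\<tau>. fs (s, \<tau>)) has_real_derivative fts (s, t)) (at t)"
    by (rule has_field_derivative_transform_within_open[OF _ open_greaterThanLessThan st(2)])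
      (rule key[symmetric], simp)
  moreover have "((\<lambda>\<tau>. fs (s, \<tau>)) has_real_derivative frechet_derivative fs (at (s, t)) (0, 1)) (at t)"
    using assms(3) x by (intro partial_snd[OF fs]) auto
  ultimately have "fts (s, t) = frechet_derivative fs (at (s, t)) (0, 1)" using DERIV_unique by blast
  then show ?thesis unfolding fts_def ft_def fs_def x .
qed

section \<open>Matrices and the Frobenius inner product\<close>

text \<open>The explicit sum, instead of the scalar product of a row and a column, permits
  exchanging summations. In entrywise arguments further on, \<open>index_mult_mat(1)\<close> is
  deleted from the simplifier to keep products as atoms.\<close>

lemma index_mult_mat_sum:
  fixes A B :: "'a::semiring_0 mat"
  assumes "i < dim_row A" "j < dim_col B" "dim_col A = dim_row B"
  shows "(A * B) $$ (i, j) = (\<Sum>k<dim_row B. A $$ (i, k) * B $$ (k, j))"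
  using assms by (simp add: scalar_prod_def lessThan_atLeast0)

lemma mat_mult_assoc_dim:
  fixes A B C :: "'a::semiring_0 mat"
  shows "dim_col A = dim_row B \<Longrightarrow> dim_col B = dim_row C \<Longrightarrow> A * B * C = A * (B * C)"
  by (rule assoc_mult_mat) auto

lemma mat_mult_add_distrib_dim:
  fixes A B C :: "'a::semiring_0 mat"
  shows "dim_row B = dim_row C \<Longrightarrow> dim_col B = dim_col C \<Longrightarrow> dim_col A = dim_row C \<Longrightarrow>
    A * (B + C) = A * B + A * C"
  by (rule mult_add_distrib_mat) auto

lemma mat_add_mult_distrib_dim:
  fixes A B C :: "'a::semiring_0 mat"
  shows "dim_row A = dim_row B \<Longrightarrow> dim_col A = dim_col B \<Longrightarrow> dim_col B = dim_row C \<Longrightarrow>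
    (A + B) * C = A * C + B * C"
  by (rule add_mult_distrib_mat) auto

lemma mat_mult_minus_distrib_dim:
  fixes A B C :: "'a::ring mat"
  shows "dim_row B = dim_row C \<Longrightarrow> dim_col B = dim_col C \<Longrightarrow> dim_col A = dim_row C \<Longrightarrow>
    A * (B - C) = A * B - A * C"
  by (rule mult_minus_distrib_mat) auto

lemma mat_minus_mult_distrib_dim:
  fixes A B C :: "'a::ring mat"
  shows "dim_row A = dim_row B \<Longrightarrow> dim_col A = dim_col B \<Longrightarrow> dim_col B = dim_row C \<Longrightarrow>
    (A - B) * C = A * C - B * C"
  by (rule minus_mult_distrib_mat) auto

lemma mat_smult_mult_dim:
  fixes A B :: "'a::comm_semiring_0 mat"
  shows "dim_col A = dim_row B \<Longrightarrow> (c \<cdot>\<^sub>m A) * B = c \<cdot>\<^sub>m (A * B)"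
  by (rule mult_smult_assoc_mat) auto

lemma mat_mult_smult_dim:
  fixes A B :: "'a::comm_semiring_0 mat"
  shows "dim_col A = dim_row B \<Longrightarrow> A * (c \<cdot>\<^sub>m B) = c \<cdot>\<^sub>m (A * B)"
  by (rule mult_smult_distrib) auto

lemma mat_mult_left_zero_dim:
  fixes A :: "'a::semiring_0 mat"
  shows "nc = dim_row A \<Longrightarrow> 0\<^sub>m nr nc * A = 0\<^sub>m nr (dim_col A)"
  by (rule left_mult_zero_mat) auto

lemma mat_mult_right_zero_dim:
  fixes A :: "'a::semiring_0 mat"
  shows "nr = dim_col A \<Longrightarrow> A * 0\<^sub>m nr nc = 0\<^sub>m (dim_row A) nc"
  by (rule right_mult_zero_mat) auto

lemma mat_transpose_mult_dim:
  fixes A B :: "'a::comm_semiring_0 mat"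
  shows "dim_col A = dim_row B \<Longrightarrow> (A * B)\<^sup>T = B\<^sup>T * A\<^sup>T"
  by (rule transpose_mult) auto

lemma mat_transpose_add_dim:
  "dim_row A = dim_row B \<Longrightarrow> dim_col A = dim_col B \<Longrightarrow> (A + B)\<^sup>T = A\<^sup>T + B\<^sup>T"
  by (rule transpose_add) auto

lemma mat_transpose_minus_dim:
  "dim_row A = dim_row B \<Longrightarrow> dim_col A = dim_col B \<Longrightarrow> (A - B)\<^sup>T = A\<^sup>T - B\<^sup>T"
  by (rule transpose_minus) auto

lemma mat_transpose_smult: "(c \<cdot>\<^sub>m A)\<^sup>T = c \<cdot>\<^sub>m A\<^sup>T"
  by (rule eq_matI) auto

lemma mat_uminus_mult_dim:
  fixes A B :: "'a::ring mat"
  shows "dim_col A = dim_row B \<Longrightarrow> (- A) * B = - (A * B)" "dim_col A = dim_row B \<Longrightarrow> A * (- B) = - (A * B)"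
  by simp_all

text \<open>
  The multiplicative identities of \<^theory>\<open>Jordan_Normal_Form.Matrix\<close> have dimension variables
  in their premises that do not occur in the conclusion; these variants can be used for rewriting.
\<close>

lemmas mat_expand =
  mat_mult_assoc_dim mat_mult_add_distrib_dim mat_add_mult_distrib_dim
  mat_mult_minus_distrib_dim mat_minus_mult_distrib_dim mat_smult_mult_dim mat_mult_smult_dim
  mat_transpose_mult_dim mat_transpose_add_dim mat_transpose_minus_dim mat_transpose_smult
  mat_uminus_mult_dim transpose_uminus mat_mult_left_zero_dim mat_mult_right_zero_dim

text \<open>The Frobenius product \<open>Tr (A\<^sup>T B)\<close>. Sizes are read off the first
  argument, hence the different premises of the left and right rules.\<close>

definition frob :: "real mat \<Rightarrow> real mat \<Rightarrow> real" where
  "frob A B = (\<Sum>i<dim_row A. \<Sum>j<dim_col A. A $$ (i, j) * B $$ (i, j))"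

lemma frob_commute:
  "dim_row A = dim_row B \<Longrightarrow> dim_col A = dim_col B \<Longrightarrow> frob A B = frob B A"
  by (simp add: frob_def mult.commute)

lemma frob_add_left:
  "dim_row A = dim_row B \<Longrightarrow> dim_col A = dim_col B \<Longrightarrow> frob (A + B) C = frob A C + frob B C"
  by (simp add: frob_def distrib_right sum.distrib)

lemma frob_minus_left:
  "dim_row A = dim_row B \<Longrightarrow> dim_col A = dim_col B \<Longrightarrow> frob (A - B) C = frob A C - frob B C"
  by (simp add: frob_def left_diff_distrib sum_subtractf)

lemma frob_uminus_left: "frob (- A) C = - frob A C"
  by (simp add: frob_def sum_negf)

lemma frob_smult_left: "frob (c \<cdot>\<^sub>m A) C = c * frob A C"
  by (simp add: frob_def sum_distrib_left mult.assoc)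

lemma frob_add_right:
  "dim_row C = dim_row A \<Longrightarrow> dim_col C = dim_col A \<Longrightarrow> dim_row C = dim_row B \<Longrightarrow> dim_col C = dim_col B \<Longrightarrow>
    frob C (A + B) = frob C A + frob C B"
  by (simp add: frob_def distrib_left sum.distrib)

lemma frob_minus_right:
  "dim_row C = dim_row A \<Longrightarrow> dim_col C = dim_col A \<Longrightarrow> dim_row C = dim_row B \<Longrightarrow> dim_col C = dim_col B \<Longrightarrow>
    frob C (A - B) = frob C A - frob C B"
  by (simp add: frob_def right_diff_distrib sum_subtractf)

lemma frob_uminus_right:
  "dim_row C = dim_row A \<Longrightarrow> dim_col C = dim_col A \<Longrightarrow> frob C (- A) = - frob C A"
  by (simp add: frob_def sum_negf)

lemma frob_smult_right:
  "dim_row C = dim_row A \<Longrightarrow> dim_col C = dim_col A \<Longrightarrow> frob C (c \<cdot>\<^sub>m A) = c * frob C A"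
  by (simp add: frob_def sum_distrib_left mult.left_commute)

lemma frob_zero_right: "dim_row C = nr \<Longrightarrow> dim_col C = nc \<Longrightarrow> frob C (0\<^sub>m nr nc) = 0"
  by (simp add: frob_def)

lemma frob_zero_left: "frob (0\<^sub>m nr nc) C = 0"
  by (simp add: frob_def)

lemmas frob_simps = frob_add_left frob_add_right frob_minus_left frob_minus_right
  frob_smult_left frob_smult_right frob_uminus_left frob_uminus_right frob_zero_left frob_zero_right

lemma frob_transpose:
  "dim_row A = dim_row B \<Longrightarrow> dim_col A = dim_col B \<Longrightarrow> frob (A\<^sup>T) (B\<^sup>T) = frob A B"
  unfolding frob_def by (subst sum.swap) simp

text \<open>The adjoint of left multiplication by \<open>B\<close> is left multiplication by its
  transpose; on entries this reorders a triple sum.\<close>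

lemma frob_mult_left:
  assumes "dim_row A = dim_row B" "dim_col A = dim_col C" "dim_col B = dim_row C"
  shows "frob A (B * C) = frob (B\<^sup>T * A) C"
proof -
  have "frob A (B * C) = (\<Sum>i<dim_row A. \<Sum>j<dim_col A. \<Sum>k<dim_row C. A $$ (i, j) * (B $$ (i, k) * C $$ (k, j)))"
    unfolding frob_def using assms by (simp del: index_mult_mat(1) add: index_mult_mat_sum sum_distrib_left)
  also have "\<dots> = (\<Sum>i<dim_row A. \<Sum>k<dim_row C. \<Sum>j<dim_col A. A $$ (i, j) * (B $$ (i, k) * C $$ (k, j)))"
    by (intro sum.cong refl sum.swap)
  also have "\<dots> = (\<Sum>k<dim_row C. \<Sum>i<dim_row A. \<Sum>j<dim_col A. A $$ (i, j) * (B $$ (i, k) * C $$ (k, j)))"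
    by (rule sum.swap)
  also have "\<dots> = (\<Sum>k<dim_row C. \<Sum>j<dim_col A. \<Sum>i<dim_row A. A $$ (i, j) * (B $$ (i, k) * C $$ (k, j)))"
    by (intro sum.cong refl sum.swap)
  also have "\<dots> = frob (B\<^sup>T * A) C"
    unfolding frob_def using assms
    by (simp del: index_mult_mat(1) add: index_mult_mat_sum sum_distrib_left ac_simps)
  finally show ?thesis .
qed

text \<open>Transposition turns right multiplication into left multiplication.\<close>

lemma frob_mult_right:
  assumes "dim_row A = dim_row B" "dim_col A = dim_col C" "dim_col B = dim_row C"
  shows "frob A (B * C) = frob (A * C\<^sup>T) B"
proof -
  have "frob A (B * C) = frob (A\<^sup>T) (C\<^sup>T * B\<^sup>T)"
    using frob_transpose[of A "B * C"] assms by (simp add: mat_expand)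
  also have "\<dots> = frob ((A * C\<^sup>T)\<^sup>T) (B\<^sup>T)"
    using frob_mult_left[of "A\<^sup>T" "C\<^sup>T" "B\<^sup>T"] assms by (simp add: mat_expand)
  also have "\<dots> = frob (A * C\<^sup>T) B"
    using assms by (intro frob_transpose) auto
  finally show ?thesis .
qed

lemma frob_self_nonneg: "frob A A \<ge> 0"
  by (simp add: frob_def sum_nonneg)

lemma frob_self_eq_0: "frob A A = 0 \<longleftrightarrow> A = 0\<^sub>m (dim_row A) (dim_col A)"
proof
  assume "frob A A = 0"
  then have "A $$ (i, j) = 0" if "i < dim_row A" "j < dim_col A" for i j
    using that by (simp add: frob_def sum_nonneg_eq_0_iff sum_nonneg)
  then show "A = 0\<^sub>m (dim_row A) (dim_col A)" by (intro eq_matI) auto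
next
  assume "A = 0\<^sub>m (dim_row A) (dim_col A)"
  then show "frob A A = 0" by (metis frob_zero_left)
qed

lemma mat_trace_mult:
  assumes "dim_col A = dim_row B" "dim_row A = dim_col B"
  shows "mat_trace (A * B) = frob (A\<^sup>T) B"
  unfolding mat_trace_def frob_def using assms
  by (subst sum.swap) (simp del: index_mult_mat(1) add: index_mult_mat_sum)

text \<open>The adjoint of \<open>Y \<mapsto> X N Y - Y N X\<close> at \<open>X\<close> is \<open>[X\<^sup>2, N]\<close>, written in blocks.\<close>

lemma frob_bracket:
  assumes dims: "K \<in> carrier_mat m m" "S \<in> carrier_mat m m" "S' \<in> carrier_mat m m"
      "T \<in> carrier_mat m d" "T' \<in> carrier_mat m d" "D \<in> carrier_mat d d"
    and K: "K\<^sup>T = - K" and sym: "S\<^sup>T = S" "S'\<^sup>T = S'" "D\<^sup>T = D"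
  shows "frob S (S * K * S' - S' * K * S) + 2 * frob T (S * K * T' - S' * K * T)
      + frob D (T\<^sup>T * K * T' - T'\<^sup>T * K * T)
    = frob ((S * S + T * T\<^sup>T) * K - K * (S * S + T * T\<^sup>T)) S' + 2 * frob (- (K * (S * T + T * D))) T'"
proof -
  note d = dims[THEN carrier_matD(1)] dims[THEN carrier_matD(2)]
  have 1: "frob S (S * K * S') = frob (- (K * (S * S))) S'"
    by (subst frob_mult_left) (simp_all add: d mat_expand K sym)
  have 2: "frob S (S' * K * S) = frob (- (S * S * K)) S'"
    using frob_mult_right[of S S' "K * S"] by (simp add: d mat_expand K sym)
  have 3: "frob T (S * K * T') = frob (- (K * (S * T))) T'"
    by (subst frob_mult_left) (simp_all add: d mat_expand K sym)
  have 4: "frob T (S' * K * T) = frob (- (T * T\<^sup>T * K)) S'"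
    using frob_mult_right[of T S' "K * T"] by (simp add: d mat_expand K sym)
  \<comment> \<open>The off-diagonal block has weight 2 but produces only
    \<open>T * T\<^sup>T * K\<close>. As \<open>S'\<close> is symmetric,
    \<open>K * (T * T\<^sup>T)\<close> pairs with it to the negative value, so the doubled term
    splits into the two halves of a commutator.\<close>
  have 5: "frob (K * (T * T\<^sup>T)) S' = - frob (T * T\<^sup>T * K) S'"
    using frob_transpose[of "K * (T * T\<^sup>T)" S'] by (simp add: d mat_expand K sym frob_uminus_left)
  have 6: "frob D (T\<^sup>T * K * T') = frob (- (K * (T * D))) T'"
    by (subst frob_mult_left) (simp_all add: d mat_expand K sym)
  have 7: "frob D (T'\<^sup>T * K * T) = - frob (- (K * (T * D))) T'"
  proof -
    have "frob D (T'\<^sup>T * K * T) = frob (D\<^sup>T) ((T'\<^sup>T * K * T)\<^sup>T)"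
      by (rule frob_transpose[symmetric]) (simp_all add: d)
    also have "(T'\<^sup>T * K * T)\<^sup>T = - (T\<^sup>T * K * T')" by (simp add: d mat_expand K)
    finally show ?thesis using 6 by (simp add: d sym frob_uminus_right)
  qed
  show ?thesis
    using 1 2 3 4 5 6 7 by (simp add: d mat_expand frob_simps)
qed

section \<open>Smooth matrix-valued functions\<close>

text \<open>The size is prescribed at every point and not only on \<open>U\<close>, so that
  dimensions simplify without membership premises.\<close>

definition smooth_mat ::
  "nat \<Rightarrow> nat \<Rightarrow> 'a::real_normed_vector set \<Rightarrow> ('a \<Rightarrow> real mat) \<Rightarrow> bool" where
  "smooth_mat r c U F \<longleftrightarrow> (\<forall>x. F x \<in> carrier_mat r c) \<and>
     (\<forall>i<r. \<forall>j<c. smooth_on U (\<lambda>x. F x $$ (i, j)))"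

text \<open>The direction precedes the point so that \<open>dmat F v\<close> is again a
  matrix-valued function and can be differentiated once more.\<close>

definition dmat :: "('a::real_normed_vector \<Rightarrow> real mat) \<Rightarrow> 'a \<Rightarrow> 'a \<Rightarrow> real mat" where
  "dmat F v x =
     mat (dim_row (F x)) (dim_col (F x)) (\<lambda>(i, j). frechet_derivative (\<lambda>y. F y $$ (i, j)) (at x) v)"

lemma smooth_matD:
  assumes "smooth_mat r c U F"
  shows "F x \<in> carrier_mat r c" "dim_row (F x) = r" "dim_col (F x) = c"
    "i < r \<Longrightarrow> j < c \<Longrightarrow> smooth_on U (\<lambda>x. F x $$ (i, j))"
  using assms unfolding smooth_mat_def by (auto intro: carrier_matD)

lemma dim_dmat [simp]: "dim_row (dmat F v x) = dim_row (F x)" "dim_col (dmat F v x) = dim_col (F x)"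
  by (simp_all add: dmat_def)

lemma dmat_carrier: "smooth_mat r c U F \<Longrightarrow> dmat F v x \<in> carrier_mat r c"
  by (rule carrier_matI) (simp_all add: smooth_matD)

lemma index_dmat:
  "i < dim_row (F x) \<Longrightarrow> j < dim_col (F x) \<Longrightarrow>
    dmat F v x $$ (i, j) = frechet_derivative (\<lambda>y. F y $$ (i, j)) (at x) v"
  by (simp add: dmat_def)

lemma frechet_derivative_eqI:
  "(f has_derivative f') (at x) \<Longrightarrow> frechet_derivative f (at x) v = f' v"
  using frechet_derivative_at by metis

lemma has_derivative_index_dmat:
  assumes "smooth_mat r c U F" "x \<in> U" "i < r" "j < c"
  shows "((\<lambda>y. F y $$ (i, j)) has_derivative (\<lambda>v. dmat F v x $$ (i, j))) (at x)"
  using smooth_on_imp_has_derivative[OF smooth_matD(4)[OF assms(1,3,4)] assms(2)] assms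
  by (simp add: index_dmat smooth_matD[OF assms(1)])

lemma dmatI:
  assumes "\<And>i j. i < dim_row (F x) \<Longrightarrow> j < dim_col (F x) \<Longrightarrow>
      ((\<lambda>y. F y $$ (i, j)) has_derivative (\<lambda>v. M v $$ (i, j))) (at x)"
    and "dim_row (M v) = dim_row (F x)" "dim_col (M v) = dim_col (F x)"
  shows "dmat F v x = M v"
  using assms by (intro eq_matI) (auto simp: index_dmat intro!: frechet_derivative_eqI)

lemma smooth_mat_const: "A \<in> carrier_mat r c \<Longrightarrow> smooth_mat r c U (\<lambda>x. A)"
  by (simp add: smooth_mat_def)

lemma smooth_mat_add:
  "open U \<Longrightarrow> smooth_mat r c U F \<Longrightarrow> smooth_mat r c U G \<Longrightarrow> smooth_mat r c U (\<lambda>x. F x + G x)"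
  by (auto simp: smooth_mat_def smooth_on_add carrier_matD[where nr = r and nc = c])

lemma smooth_mat_smult_fun:
  "open U \<Longrightarrow> smooth_on U f \<Longrightarrow> smooth_mat r c U F \<Longrightarrow> smooth_mat r c U (\<lambda>x. f x \<cdot>\<^sub>m F x)"
  by (auto simp: smooth_mat_def smooth_on_mult carrier_matD[where nr = r and nc = c])

lemma smooth_mat_smult:
  "open U \<Longrightarrow> smooth_mat r c U F \<Longrightarrow> smooth_mat r c U (\<lambda>x. k \<cdot>\<^sub>m F x)"
  by (rule smooth_mat_smult_fun) auto

lemma smooth_mat_transpose:
  "smooth_mat r c U F \<Longrightarrow> smooth_mat c r U (\<lambda>x. (F x)\<^sup>T)"
  by (auto simp: smooth_mat_def carrier_matD[where nr = r and nc = c])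

lemma smooth_mat_mult:
  assumes U: "open U" and F: "smooth_mat r c U F" and G: "smooth_mat c e U G"
  shows "smooth_mat r e U (\<lambda>x. F x * G x)"
  unfolding smooth_mat_def
proof (intro conjI allI impI)
  show "F x * G x \<in> carrier_mat r e" for x
    using smooth_matD(1)[OF F] smooth_matD(1)[OF G] by (rule mult_carrier_mat)
  show "smooth_on U (\<lambda>x. (F x * G x) $$ (i, j))" if "i < r" "j < e" for i j
  proof -
    have "smooth_on U (\<lambda>x. \<Sum>k<c. F x $$ (i, k) * G x $$ (k, j))"
      using that by (intro smooth_on_sum smooth_on_mult U smooth_matD(4)[OF F] smooth_matD(4)[OF G]) auto
    then show ?thesis
      using that
      by (simp del: index_mult_mat(1) add: index_mult_mat_sum smooth_matD[OF F] smooth_matD[OF G])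
  qed
qed

lemma smooth_mat_dmat: "smooth_mat r c U F \<Longrightarrow> smooth_mat r c U (dmat F v)"
  unfolding smooth_mat_def
  by (auto simp: index_dmat carrier_matD[where nr = r and nc = c] intro: smooth_on_frechet_derivative)

lemma smooth_mat_sym_part:
  assumes "open U" "smooth_mat r r U F"
  shows "smooth_mat r r U (\<lambda>x. sym_part (F x))"
  unfolding sym_part_def
  by (intro smooth_mat_smult smooth_mat_add smooth_mat_transpose assms)

lemma smooth_on_frob:
  assumes U: "open U" and F: "smooth_mat r c U F" and G: "smooth_mat r c U G"
  shows "smooth_on U (\<lambda>x. frob (F x) (G x))"
  unfolding frob_def smooth_matD(2)[OF F] smooth_matD(3)[OF F]
  by (intro smooth_on_sum smooth_on_mult U smooth_matD(4)[OF F] smooth_matD(4)[OF G]) auto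

lemma dmat_const: "dmat (\<lambda>x. A) v x = 0\<^sub>m (dim_row A) (dim_col A)"
  by (rule eq_matI) (simp_all add: index_dmat)

lemma dmat_add:
  assumes F: "smooth_mat r c U F" and G: "smooth_mat r c U G" and x: "x \<in> U"
  shows "dmat (\<lambda>y. F y + G y) v x = dmat F v x + dmat G v x"
  using x
  by (intro dmatI[where M = "\<lambda>v. dmat F v x + dmat G v x"])
    (simp_all add: smooth_matD[OF F] smooth_matD[OF G] has_derivative_add
      has_derivative_index_dmat[OF F] has_derivative_index_dmat[OF G])

lemma dmat_smult:
  assumes F: "smooth_mat r c U F" and x: "x \<in> U"
  shows "dmat (\<lambda>y. k \<cdot>\<^sub>m F y) v x = k \<cdot>\<^sub>m dmat F v x"
  using x
  by (intro dmatI[where M = "\<lambda>v. k \<cdot>\<^sub>m dmat F v x"])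
    (simp_all add: smooth_matD[OF F] has_derivative_mult_right has_derivative_index_dmat[OF F])

lemma dmat_transpose:
  assumes F: "smooth_mat r c U F" and x: "x \<in> U"
  shows "dmat (\<lambda>y. (F y)\<^sup>T) v x = (dmat F v x)\<^sup>T"
  using x
  by (intro dmatI[where M = "\<lambda>v. (dmat F v x)\<^sup>T"])
    (simp_all add: smooth_matD[OF F] has_derivative_index_dmat[OF F])

lemma dmat_mult:
  assumes F: "smooth_mat r c U F" and G: "smooth_mat c e U G" and x: "x \<in> U"
  shows "dmat (\<lambda>y. F y * G y) v x = dmat F v x * G x + F x * dmat G v x"
proof (rule dmatI[where M = "\<lambda>v. dmat F v x * G x + F x * dmat G v x"])
  fix i j assume "i < dim_row (F x * G x)" "j < dim_col (F x * G x)"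
  then have ij: "i < r" "j < e" by (simp_all add: smooth_matD[OF F] smooth_matD[OF G])
  have "((\<lambda>y. \<Sum>k<c. F y $$ (i, k) * G y $$ (k, j)) has_derivative
    (\<lambda>v. \<Sum>k<c. F x $$ (i, k) * dmat G v x $$ (k, j) + dmat F v x $$ (i, k) * G x $$ (k, j))) (at x)"
    using ij
    by (intro has_derivative_sum has_derivative_mult has_derivative_index_dmat[OF F x]
      has_derivative_index_dmat[OF G x]) auto
  then show "((\<lambda>y. (F y * G y) $$ (i, j)) has_derivative
    (\<lambda>v. (dmat F v x * G x + F x * dmat G v x) $$ (i, j))) (at x)"
    using ij
    by (simp del: index_mult_mat(1)
      add: index_mult_mat_sum smooth_matD[OF F] smooth_matD[OF G] sum.distrib add.commute)
qed (simp_all add: smooth_matD[OF F] smooth_matD[OF G])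

lemma dmat_sym_part:
  assumes "open U" and F: "smooth_mat r r U F" and x: "x \<in> U"
  shows "dmat (\<lambda>y. sym_part (F y)) v x = sym_part (dmat F v x)"
  unfolding sym_part_def
  using dmat_smult[OF smooth_mat_add[OF assms(1) F smooth_mat_transpose[OF F]] x]
    dmat_add[OF F smooth_mat_transpose[OF F] x] dmat_transpose[OF F x]
  by simp

lemma frechet_derivative_frob:
  assumes F: "smooth_mat r c U F" and G: "smooth_mat r c U G" and x: "x \<in> U"
  shows "frechet_derivative (\<lambda>y. frob (F y) (G y)) (at x) v =
    frob (dmat F v x) (G x) + frob (F x) (dmat G v x)"
proof -
  have "((\<lambda>y. \<Sum>i<r. \<Sum>j<c. F y $$ (i, j) * G y $$ (i, j)) has_derivative
    (\<lambda>v. \<Sum>i<r. \<Sum>j<c. F x $$ (i, j) * dmat G v x $$ (i, j) + dmat F v x $$ (i, j) * G x $$ (i, j))) (at x)"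
    by (intro has_derivative_sum has_derivative_mult has_derivative_index_dmat[OF F x]
      has_derivative_index_dmat[OF G x]) auto
  from frechet_derivative_eqI[OF this] show ?thesis
    by (simp add: frob_def smooth_matD[OF F] sum.distrib add.commute)
qed

lemma dmat_cong:
  assumes "open V" "x \<in> V" "\<And>y. y \<in> V \<Longrightarrow> F y = G y" "smooth_mat r c U F" "x \<in> U"
  shows "dmat G v x = dmat F v x"
proof (rule dmatI[where M = "\<lambda>v. dmat F v x"])
  fix i j assume "i < dim_row (G x)" "j < dim_col (G x)"
  then have "i < r" "j < c" using assms(2,3) smooth_matD[OF assms(4)] by metis+
  from has_derivative_index_dmat[OF assms(4,5) this]
  show "((\<lambda>y. G y $$ (i, j)) has_derivative (\<lambda>v. dmat F v x $$ (i, j))) (at x)"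
    by (rule has_derivative_transform_within_open[OF _ assms(1,2)]) (simp add: assms(3))
qed (use assms(2,3) in simp_all)

lemma dmat_mixed_commute:
  fixes F :: "real \<times> real \<Rightarrow> real mat"
  assumes U: "open U" and F: "smooth_mat r c U F" and x: "x \<in> U"
  shows "dmat (dmat F (0, 1)) (1, 0) x = dmat (dmat F (1, 0)) (0, 1) x"
  by (rule eq_matI)
    (simp_all add: index_dmat smooth_matD[OF F] mixed_partials_commute[OF U smooth_matD(4)[OF F] x])

lemma dmat_slice_snd:
  fixes F :: "real \<times> real \<Rightarrow> real mat"
  assumes F: "smooth_mat r c U F" and x: "(s, t) \<in> U"
  shows "mat_deriv (\<lambda>\<tau>. F (s, \<tau>)) t = dmat F (0, 1) (s, t)"
  unfolding mat_deriv_def dmat_def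
  by (intro cong_mat refl)
    (simp add: DERIV_imp_deriv[OF partial_snd[OF smooth_matD(4)[OF F] x]] smooth_matD[OF F])

lemma mat_deriv_eq_dmat:
  assumes F: "smooth_mat r c U F" and x: "t \<in> U"
  shows "mat_deriv F t = dmat F 1 t"
  unfolding mat_deriv_def dmat_def
  by (intro cong_mat refl)
    (simp add: DERIV_imp_deriv[OF smooth_on_imp_has_real_derivative[OF smooth_matD(4)[OF F] x]] smooth_matD[OF F])

lemma smooth_mat_compose_snd:
  fixes F :: "real \<Rightarrow> real mat"
  assumes "open I" "smooth_mat r c I F"
  shows "smooth_mat r c (UNIV \<times> I) (\<lambda>x::real \<times> real. F (snd x))"
  using assms by (auto simp: smooth_mat_def intro!: smooth_on_compose_snd)

section \<open>The first variation of the energy\<close>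

text \<open>
  For \<open>L = Nb\<^sup>-\<^sup>1\<close> and symplectic \<open>g\<close> one has \<open>Nb\<^sup>-\<^sup>1 g\<^sup>-\<^sup>1 = g\<^sup>T L\<close>. The blocks of the matrix \<open>X\<close> belonging
  to a tangent vector \<open>(u, u', w)\<close> at \<open>(g, A, B)\<close> are therefore \<open>bform L g u\<close>, \<open>bform L g u'\<close> and
  \<open>dform L A u' w\<close>, all polynomial in the entries.
\<close>

definition bform :: "real mat \<Rightarrow> real mat \<Rightarrow> real mat \<Rightarrow> real mat" where
  "bform L g u = g\<^sup>T * L * u"

definition dform :: "real mat \<Rightarrow> real mat \<Rightarrow> real mat \<Rightarrow> real mat \<Rightarrow> real mat" where
  "dform L A u w = 2 \<cdot>\<^sub>m w + sym_part (A\<^sup>T * L * u)"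

lemma dim_sym_part [simp]: "dim_row (sym_part M) = dim_row M" "dim_col (sym_part M) = dim_col M"
  if "dim_row M = dim_col M"
  using that by (simp_all add: sym_part_def)

lemma transpose_sym_part: "dim_row M = dim_col M \<Longrightarrow> (sym_part M)\<^sup>T = sym_part M"
  by (rule eq_matI) (auto simp: sym_part_def)

lemma dmat_bform:
  assumes U: "open U" and L: "L \<in> carrier_mat m m"
    and g: "smooth_mat m e U g" and F: "smooth_mat m c U F" and x: "x \<in> U"
  shows "dmat (\<lambda>y. bform L (g y) (F y)) v x = bform L (dmat g v x) (F x) + bform L (g x) (dmat F v x)"
proof -
  note L' = smooth_mat_const[OF L, of U]
  note gT = smooth_mat_transpose[OF g]
  have "dmat (\<lambda>y. (g y)\<^sup>T * L) v x = (dmat g v x)\<^sup>T * L"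
    using dmat_mult[OF gT L' x] dmat_transpose[OF g x] L
    by (simp add: dmat_const smooth_matD[OF g] mat_expand right_mult_zero_mat[where nr = m and n = m])
      (rule right_add_zero_mat, auto simp: smooth_matD[OF g])
  then show ?thesis
    unfolding bform_def using dmat_mult[OF smooth_mat_mult[OF U gT L'] F x] by simp
qed

lemma smooth_mat_bform:
  assumes U: "open U" and L: "L \<in> carrier_mat m m"
    and g: "smooth_mat m e U g" and F: "smooth_mat m c U F"
  shows "smooth_mat e c U (\<lambda>y. bform L (g y) (F y))"
  unfolding bform_def
  by (rule smooth_mat_mult[OF U smooth_mat_mult[OF U smooth_mat_transpose[OF g] smooth_mat_const[OF L]] F])

lemma smooth_mat_dform:
  assumes U: "open U" and L: "L \<in> carrier_mat m m"
    and A: "smooth_mat m d U A" and F: "smooth_mat m d U F" and B: "smooth_mat d d U B"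
  shows "smooth_mat d d U (\<lambda>y. dform L (A y) (F y) (B y))"
  unfolding dform_def bform_def[symmetric]
  by (intro smooth_mat_add smooth_mat_smult smooth_mat_sym_part smooth_mat_bform[OF U L] assms)

lemma dmat_dform:
  assumes U: "open U" and L: "L \<in> carrier_mat m m"
    and A: "smooth_mat m d U A" and F: "smooth_mat m d U F" and B: "smooth_mat d d U B" and x: "x \<in> U"
  shows "dmat (\<lambda>y. dform L (A y) (F y) (B y)) v x =
    2 \<cdot>\<^sub>m dmat B v x + sym_part (bform L (dmat A v x) (F x) + bform L (A x) (dmat F v x))"
proof -
  note AF = smooth_mat_bform[OF U L A F]
  have "dmat (\<lambda>y. 2 \<cdot>\<^sub>m B y + sym_part (bform L (A y) (F y))) v x =
      dmat (\<lambda>y. 2 \<cdot>\<^sub>m B y) v x + dmat (\<lambda>y. sym_part (bform L (A y) (F y))) v x"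
    by (rule dmat_add[OF smooth_mat_smult[OF U B] smooth_mat_sym_part[OF U AF] x])
  then show ?thesis
    unfolding dform_def bform_def[symmetric]
    using dmat_smult[OF B x] dmat_sym_part[OF U AF x] dmat_bform[OF U L A F x] by simp
qed

text \<open>Since \<open>(g\<^sup>T L u)\<^sup>T = - u\<^sup>T L g\<close>, the right-hand side is
  \<open>u\<^sup>T L (g K g\<^sup>T) L w\<close>, and \<open>g K g\<^sup>T = K\<close> collapses it.
  This expresses a product of two derivatives through their translates to the identity.\<close>

lemma bform_via_group:
  assumes c: "g \<in> carrier_mat m m" "K \<in> carrier_mat m m" "L \<in> carrier_mat m m"
      "u \<in> carrier_mat m c" "w \<in> carrier_mat m e"
    and g: "g * (K * g\<^sup>T) = K" and LK: "L * K = 1\<^sub>m m" and L: "L\<^sup>T = - L"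
  shows "bform L u w = - ((bform L g u)\<^sup>T * K * bform L g w)"
proof -
  note d = c[THEN carrier_matD(1)] c[THEN carrier_matD(2)]
  have "(bform L g u)\<^sup>T * K * bform L g w = - (u\<^sup>T * L * (g * (K * g\<^sup>T)) * L * w)"
    by (simp add: bform_def d mat_expand L)
  also have "u\<^sup>T * L * (g * (K * g\<^sup>T)) * L * w = u\<^sup>T * ((L * K) * (L * w))"
    unfolding g by (simp add: d mat_expand)
  also have "\<dots> = bform L u w"
    unfolding LK using c by (simp add: bform_def d mat_expand)
  finally show ?thesis by simp
qed

lemma smooth_mat_minus:
  assumes "open U" "smooth_mat r c U F" "smooth_mat r c U G"
  shows "smooth_mat r c U (\<lambda>x. F x - G x)"
proof -
  have "F x - G x = F x + (-1) \<cdot>\<^sub>m G x" for x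
    using assms(2,3) by (intro eq_matI) (simp_all add: smooth_matD)
  then show ?thesis using smooth_mat_add[OF assms(1,2) smooth_mat_smult[OF assms(1,3), of "-1"]] by simp
qed

text \<open>\<open>K\<close> stands for \<open>Nb\<close>, \<open>L\<close> for its inverse, and the
  form of the group is \<open>- L\<close>. Having \<open>L\<close> as a parameter keeps
  \<open>mat_inv\<close> out of the algebra.\<close>

locale jacobi =
  fixes m d :: nat and K L :: "real mat"
  assumes K: "K \<in> carrier_mat m m" and L: "L \<in> carrier_mat m m"
    and KL: "K * L = 1\<^sub>m m" and LK: "L * K = 1\<^sub>m m"
    and K_antisym: "K\<^sup>T = - K" and L_antisym: "L\<^sup>T = - L"

text \<open>
  Along a two-parameter family \<open>(g, A, B)\<close> the blocks \<open>S, T, D\<close> belong to the logarithmic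
  derivative in the time direction \<open>(0, 1)\<close>, and \<open>S', T', D'\<close> to the one in the direction \<open>(1, 0)\<close>.
\<close>

locale jacobi_family = jacobi +
  fixes U :: "(real \<times> real) set" and g A B :: "real \<times> real \<Rightarrow> real mat"
  assumes U: "open U" and g: "smooth_mat m m U g" and A: "smooth_mat m d U A" and B: "smooth_mat d d U B"
begin

definition S where "S x = bform L (g x) (dmat g (0, 1) x)"
definition T where "T x = bform L (g x) (dmat A (0, 1) x)"
definition D where "D x = dform L (A x) (dmat A (0, 1) x) (dmat B (0, 1) x)"
definition S' where "S' x = bform L (g x) (dmat g (1, 0) x)"
definition T' where "T' x = bform L (g x) (dmat A (1, 0) x)"
definition D' where "D' x = dform L (A x) (dmat A (1, 0) x) (dmat B (1, 0) x)"

lemma smooth_blocks: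
  "smooth_mat m m U S" "smooth_mat m d U T" "smooth_mat d d U D"
  "smooth_mat m m U S'" "smooth_mat m d U T'" "smooth_mat d d U D'"
  unfolding S_def[abs_def] T_def[abs_def] D_def[abs_def] S'_def[abs_def] T'_def[abs_def] D'_def[abs_def]
  by (intro smooth_mat_bform[OF U L] smooth_mat_dform[OF U L] smooth_mat_dmat g A B)+

lemmas block_dims =
  smooth_blocks[THEN smooth_matD(1)] smooth_blocks[THEN smooth_matD(2)] smooth_blocks[THEN smooth_matD(3)]
  g[THEN smooth_matD(2)] g[THEN smooth_matD(3)] A[THEN smooth_matD(2)] A[THEN smooth_matD(3)]
  B[THEN smooth_matD(2)] B[THEN smooth_matD(3)]
  K[THEN carrier_matD(1)] K[THEN carrier_matD(2)] L[THEN carrier_matD(1)] L[THEN carrier_matD(2)]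

text \<open>\<open>Tr (X X) / 2\<close> in blocks. The transpose on \<open>D\<close> reflects that
  the Lagrangian contains \<open>Tr (B * B)\<close>, which is a squared norm only for symmetric
  \<open>B\<close>.\<close>

definition energy_density where "energy_density x = 1 / 2 * frob (S x) (S x) + frob (T x) (T x) + 1 / 2 * frob ((D x)\<^sup>T) (D x)"

text \<open>\<open>Tr (X H)\<close> in blocks for symmetric \<open>X\<close>, the boundary term of
  the integration by parts.\<close>

definition momentum_pairing where "momentum_pairing x = frob (S x) (S' x) + 2 * frob (T x) (T' x) + frob (D x) (D' x)"

text \<open>The trace of \<open>X' - [X\<^sup>2, N]\<close> against \<open>H\<close>. The commutator
  has upper right block \<open>- K (S T + T D)\<close> and lower right block zero; the two
  off-diagonal blocks are transposes of each other and give the factor 2.\<close>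

definition residual where
  "residual x = frob (dmat S (0, 1) x - ((S x * S x + T x * (T x)\<^sup>T) * K - K * (S x * S x + T x * (T x)\<^sup>T))) (S' x)
    + 2 * frob (dmat T (0, 1) x + K * (S x * T x + T x * D x)) (T' x)
    + frob (dmat D (0, 1) x) (D' x)"

text \<open>The mixed second derivatives cancel. There remain products of first derivatives such as
  \<open>bform L (dmat g (1, 0) x) (dmat g (0, 1) x)\<close>, which \<open>bform_via_group\<close>
  turns into the bracket of the logarithmic derivatives.\<close>

lemma curvature:
  assumes x: "x \<in> U" and gx: "g x * (K * (g x)\<^sup>T) = K"
  shows "dmat S (1, 0) x = dmat S' (0, 1) x + ((S x)\<^sup>T * K * S' x - (S' x)\<^sup>T * K * S x)" (is ?S)
    and "dmat T (1, 0) x = dmat T' (0, 1) x + ((S x)\<^sup>T * K * T' x - (S' x)\<^sup>T * K * T x)" (is ?T)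
    and "dmat D (1, 0) x = dmat D' (0, 1) x + ((T x)\<^sup>T * K * T' x - (T' x)\<^sup>T * K * T x)" (is ?D)
proof -
  note carr = smooth_matD(1)[OF g] smooth_matD(1)[OF A] dmat_carrier[OF g] dmat_carrier[OF A]
  have via: "bform L u w = - ((bform L (g x) u)\<^sup>T * K * bform L (g x) w)"
    if "u \<in> carrier_mat m c" "w \<in> carrier_mat m e" for u w c e
    using bform_via_group[OF carr(1) K L that gx LK L_antisym] .
  note db = dmat_bform[OF U L g smooth_mat_dmat[OF g] x] dmat_bform[OF U L g smooth_mat_dmat[OF A] x]
  have "bform L (dmat g (1, 0) x) (dmat g (0, 1) x) = - ((S' x)\<^sup>T * K * S x)"
    "bform L (dmat g (0, 1) x) (dmat g (1, 0) x) = - ((S x)\<^sup>T * K * S' x)"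
    unfolding S_def S'_def by (rule via carr)+
  then show ?S
    unfolding S_def[abs_def] S'_def[abs_def] db dmat_mixed_commute[OF U g x]
    by (intro eq_matI) (simp_all add: block_dims bform_def)
  have "bform L (dmat g (1, 0) x) (dmat A (0, 1) x) = - ((S' x)\<^sup>T * K * T x)"
    "bform L (dmat g (0, 1) x) (dmat A (1, 0) x) = - ((S x)\<^sup>T * K * T' x)"
    unfolding S_def S'_def T_def T'_def by (rule via carr)+
  then show ?T
    unfolding S_def[abs_def] S'_def[abs_def] T_def[abs_def] T'_def[abs_def] db dmat_mixed_commute[OF U A x]
    by (intro eq_matI) (simp_all add: block_dims bform_def)
  have "bform L (dmat A (1, 0) x) (dmat A (0, 1) x) = - ((T' x)\<^sup>T * K * T x)"
    "bform L (dmat A (0, 1) x) (dmat A (1, 0) x) = - ((T x)\<^sup>T * K * T' x)"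
    unfolding T_def T'_def by (rule via carr)+
  note bf = this
  define M where "M = (T x)\<^sup>T * K * T' x"
  define M' where "M' = (T' x)\<^sup>T * K * T x"
  have dM: "dim_row M = d" "dim_col M = d" "dim_row M' = d" "dim_col M' = d"
    by (simp_all add: M_def M'_def block_dims)
  \<comment> \<open>Hence the symmetric part of \<open>M\<close> is half of \<open>M - M'\<close>,
    and the two symmetric parts below differ by exactly \<open>M - M'\<close>.\<close>
  have "M\<^sup>T = - M'"
    by (simp add: M_def M'_def block_dims mat_expand K_antisym)
  then have M: "M $$ (j, i) = - M' $$ (i, j)" if "i < d" "j < d" for i j
    using that dM by (metis index_transpose_mat(1) index_uminus_mat(1))
  show ?D
    unfolding D_def[abs_def] D'_def[abs_def] dmat_dform[OF U L A smooth_mat_dmat[OF A] smooth_mat_dmat[OF B] x]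
      dmat_mixed_commute[OF U A x] dmat_mixed_commute[OF U B x] bf M_def[symmetric] M'_def[symmetric]
  proof (rule eq_matI)
    let ?R = "bform L (A x) (dmat (dmat A (1, 0)) (0, 1) x)"
    let ?C = "dmat (dmat B (1, 0)) (0, 1) x"
    have dR: "dim_row ?R = d" "dim_col ?R = d" by (simp_all add: bform_def block_dims)
    fix i j
    assume "i < dim_row (2 \<cdot>\<^sub>m ?C + sym_part (- M + ?R) + (M - M'))"
      and "j < dim_col (2 \<cdot>\<^sub>m ?C + sym_part (- M + ?R) + (M - M'))"
    then have ij: "i < d" "j < d" by (simp_all add: dM)
    show "(2 \<cdot>\<^sub>m ?C + sym_part (- M' + ?R)) $$ (i, j) =
      (2 \<cdot>\<^sub>m ?C + sym_part (- M + ?R) + (M - M')) $$ (i, j)"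
      using ij M[OF ij] M[OF ij(2,1)] by (simp add: sym_part_def dM dR block_dims field_simps)
  qed (simp_all add: dM block_dims bform_def)
qed

lemma smooth_energy_density: "smooth_on U energy_density"
  and smooth_momentum_pairing: "smooth_on U momentum_pairing"
  and smooth_residual: "smooth_on U residual"
proof -
  note sm = smooth_blocks
  note fr = smooth_on_frob[OF U]
  show "smooth_on U energy_density"
    unfolding energy_density_def[abs_def]
    by (intro smooth_on_add smooth_on_mult U smooth_on_const fr[OF sm(1) sm(1)] fr[OF sm(2) sm(2)]
      fr[OF smooth_mat_transpose[OF sm(3)] sm(3)])
  show "smooth_on U momentum_pairing"
    unfolding momentum_pairing_def[abs_def]
    by (intro smooth_on_add smooth_on_mult U smooth_on_const fr[OF sm(1) sm(4)] fr[OF sm(2) sm(5)]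
      fr[OF sm(3) sm(6)])
  note mult = smooth_mat_mult[OF U]
  note K' = smooth_mat_const[OF K, of U]
  have Q: "smooth_mat m m U (\<lambda>x. S x * S x + T x * (T x)\<^sup>T)"
    by (intro smooth_mat_add U mult[OF sm(1) sm(1)] mult[OF sm(2) smooth_mat_transpose[OF sm(2)]])
  have W: "smooth_mat m d U (\<lambda>x. S x * T x + T x * D x)"
    by (intro smooth_mat_add U mult[OF sm(1) sm(2)] mult[OF sm(2) sm(3)])
  have 1: "smooth_mat m m U (\<lambda>x. dmat S (0, 1) x - ((S x * S x + T x * (T x)\<^sup>T) * K - K * (S x * S x + T x * (T x)\<^sup>T)))"
    by (intro smooth_mat_minus U smooth_mat_dmat sm mult[OF Q K'] mult[OF K' Q])
  have 2: "smooth_mat m d U (\<lambda>x. dmat T (0, 1) x + K * (S x * T x + T x * D x))"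
    by (intro smooth_mat_add U smooth_mat_dmat sm mult[OF K' W])
  show "smooth_on U residual"
    unfolding residual_def[abs_def]
    by (intro smooth_on_add smooth_on_mult U smooth_on_const fr[OF 1 sm(4)] fr[OF 2 sm(5)]
      fr[OF smooth_mat_dmat[OF sm(3)] sm(6)])
qed

text \<open>By symmetry the \<open>s\<close>-derivative of \<open>Tr (X X) / 2\<close> is
  \<open>Tr (X X\<^sub>s)\<close>. Inserting \<open>curvature\<close> gives the
  \<open>t\<close>-derivative of \<open>Tr (X H)\<close>, minus \<open>Tr (X\<^sub>t H)\<close>,
  plus \<open>X\<close> paired with the bracket; \<open>frob_bracket\<close> moves the latter onto
  \<open>H\<close>.\<close>

lemma derivative_energy_density:
  assumes x: "x \<in> U" and gx: "g x * (K * (g x)\<^sup>T) = K"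
    and sym: "(S x)\<^sup>T = S x" "(S' x)\<^sup>T = S' x" "(D x)\<^sup>T = D x"
  shows "frechet_derivative energy_density (at x) (1, 0) = frechet_derivative momentum_pairing (at x) (0, 1) - residual x"
proof -
  have hd: "((\<lambda>y. frob (F y) (G y)) has_derivative (\<lambda>v. frob (dmat F v x) (G x) + frob (F x) (dmat G v x))) (at x)"
    if "smooth_mat p q U F" "smooth_mat p q U G" for p q F G
    using smooth_on_imp_has_derivative[OF smooth_on_frob[OF U that] x] 
    unfolding frechet_derivative_frob[OF that x, abs_def] .
  note sm = smooth_blocks
  have "(energy_density has_derivative (\<lambda>v. 1 / 2 * (frob (dmat S v x) (S x) + frob (S x) (dmat S v x))
     + (frob (dmat T v x) (T x) + frob (T x) (dmat T v x))
     + 1 / 2 * (frob (dmat (\<lambda>y. (D y)\<^sup>T) v x) (D x) + frob ((D x)\<^sup>T) (dmat D v x)))) (at x)"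
    unfolding energy_density_def[abs_def]
    by (intro has_derivative_add has_derivative_mult_right hd[OF sm(1) sm(1)] hd[OF sm(2) sm(2)]
      hd[OF smooth_mat_transpose[OF sm(3)] sm(3)])
  from frechet_derivative_eqI[OF this]
  have 1: "frechet_derivative energy_density (at x) (1, 0) = frob (S x) (dmat S (1, 0) x) + 2 * frob (T x) (dmat T (1, 0) x)
      + frob (D x) (dmat D (1, 0) x)"
    using frob_transpose[of "dmat D (1, 0) x" "D x"] frob_commute[of "dmat D (1, 0) x" "D x"]
      frob_commute[of "dmat S (1, 0) x" "S x"] frob_commute[of "dmat T (1, 0) x" "T x"] sym(3)
    by (simp add: dmat_transpose[OF sm(3) x] block_dims)
  have "(momentum_pairing has_derivative (\<lambda>v. frob (dmat S v x) (S' x) + frob (S x) (dmat S' v x)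
     + 2 * (frob (dmat T v x) (T' x) + frob (T x) (dmat T' v x))
     + (frob (dmat D v x) (D' x) + frob (D x) (dmat D' v x)))) (at x)"
    unfolding momentum_pairing_def[abs_def]
    by (intro has_derivative_add has_derivative_mult_right hd[OF sm(1) sm(4)] hd[OF sm(2) sm(5)]
      hd[OF sm(3) sm(6)])
  from frechet_derivative_eqI[OF this]
  have 2: "frechet_derivative momentum_pairing (at x) (0, 1) = frob (dmat S (0, 1) x) (S' x) + frob (S x) (dmat S' (0, 1) x)
     + 2 * (frob (dmat T (0, 1) x) (T' x) + frob (T x) (dmat T' (0, 1) x))
     + (frob (dmat D (0, 1) x) (D' x) + frob (D x) (dmat D' (0, 1) x))" .
  note c = smooth_blocks[THEN smooth_matD(1)]
  have 3: "frob (S x) (S x * K * S' x - S' x * K * S x) + 2 * frob (T x) (S x * K * T' x - S' x * K * T x)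
      + frob (D x) ((T x)\<^sup>T * K * T' x - (T' x)\<^sup>T * K * T x)
    = frob ((S x * S x + T x * (T x)\<^sup>T) * K - K * (S x * S x + T x * (T x)\<^sup>T)) (S' x)
      + 2 * frob (- (K * (S x * T x + T x * D x))) (T' x)"
    by (rule frob_bracket[OF K c(1) c(4) c(2) c(5) c(3) K_antisym sym])
  show ?thesis
    using 3 unfolding 1 2 residual_def curvature[OF x gx] sym
    by (simp add: frob_simps block_dims)
qed

text \<open>Only the derivative at \<open>s = 0\<close> is computed, so the pointwise identity is
  needed on that slice alone. It is demanded at interior times only, since an end time has no
  two-sided time segment inside the strip.\<close>

lemma first_variation:
  assumes e: "\<epsilon> > 0" and ab: "a < b" and sub: "{-\<epsilon><..<\<epsilon>} \<times> {a..b} \<subseteq> U"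
    and gx: "\<And>t. t \<in> {a<..<b} \<Longrightarrow> g (0, t) * (K * (g (0, t))\<^sup>T) = K"
    and sym: "\<And>t. t \<in> {a<..<b} \<Longrightarrow> (S (0, t))\<^sup>T = S (0, t)"
      "\<And>t. t \<in> {a<..<b} \<Longrightarrow> (S' (0, t))\<^sup>T = S' (0, t)"
      "\<And>t. t \<in> {a<..<b} \<Longrightarrow> (D (0, t))\<^sup>T = D (0, t)"
    and ends: "momentum_pairing (0, a) = 0" "momentum_pairing (0, b) = 0"
  shows "((\<lambda>s. integral {a..b} (\<lambda>t. energy_density (s, t))) has_real_derivative
    - integral {a..b} (\<lambda>t. residual (0, t))) (at 0)"
proof -
  have in_U: "(0, t) \<in> U" if "t \<in> {a..b}" for t
    using sub e that by auto
  have cont: "continuous_on {a..b} (\<lambda>t. F (0, t))" if "smooth_on U F" for F :: "real \<times> real \<Rightarrow> real"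
    using in_U
    by (intro continuous_on_compose2[OF smooth_on_imp_continuous_on[OF that]] continuous_intros) auto
  have "((\<lambda>t. frechet_derivative momentum_pairing (at (0, t)) (0, 1)) has_integral momentum_pairing (0, b) - momentum_pairing (0, a)) {a..b}"
  proof (rule fundamental_theorem_of_calculus)
    fix t assume "t \<in> {a..b}"
    then show "((\<lambda>t. momentum_pairing (0, t)) has_vector_derivative frechet_derivative momentum_pairing (at (0, t)) (0, 1)) (at t within {a..b})"
      using partial_snd[OF smooth_momentum_pairing in_U]
      by (meson has_real_derivative_iff_has_vector_derivative has_vector_derivative_at_within)
  qed (use ab in simp)
  moreover have "((\<lambda>t. residual (0, t)) has_integral integral {a..b} (\<lambda>t. residual (0, t))) {a..b}"
    by (intro integrable_integral integrable_continuous_interval cont smooth_residual)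
  ultimately have "((\<lambda>t. frechet_derivative momentum_pairing (at (0, t)) (0, 1) - residual (0, t)) has_integral
      momentum_pairing (0, b) - momentum_pairing (0, a) - integral {a..b} (\<lambda>t. residual (0, t))) {a..b}"
    by (rule has_integral_diff)
  then have "((\<lambda>t. frechet_derivative energy_density (at (0, t)) (1, 0)) has_integral
      momentum_pairing (0, b) - momentum_pairing (0, a) - integral {a..b} (\<lambda>t. residual (0, t))) {a..b}"
    \<comment> \<open>The pointwise identity is known on the open interval; its two ends are
      negligible.\<close>
    by (rule has_integral_spike_finite[of "{a, b}", rotated 2])
      (use in_U gx sym in \<open>auto intro!: derivative_energy_density\<close>)
  then have "integral {a..b} (\<lambda>t. frechet_derivative energy_density (at (0, t)) (1, 0)) =
      - integral {a..b} (\<lambda>t. residual (0, t))"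
    using ends by (simp add: integral_unique)
  with leibniz_rule_smooth[OF smooth_energy_density sub, of 0] show ?thesis
    using e by simp
qed

end

section \<open>The Jacobi group and its metric\<close>

lemma mat_deriv_affine:
  assumes "M0 \<in> carrier_mat r c" "M1 \<in> carrier_mat r c"
  shows "mat_deriv (\<lambda>s. M0 + s \<cdot>\<^sub>m M1) t = M1"
proof (rule eq_matI)
  fix i j assume "i < dim_row M1" "j < dim_col M1"
  then have ij: "i < r" "j < c" using assms by auto
  have "((\<lambda>s. M0 $$ (i, j) + s * M1 $$ (i, j)) has_real_derivative M1 $$ (i, j)) (at t)"
    by (auto intro!: derivative_eq_intros)
  then show "mat_deriv (\<lambda>s. M0 + s \<cdot>\<^sub>m M1) t $$ (i, j) = M1 $$ (i, j)"
    using ij assms by (simp add: mat_deriv_def DERIV_imp_deriv)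
qed (use assms in \<open>simp_all add: mat_deriv_def\<close>)

lemma sym_part_carrier: "M \<in> carrier_mat r r \<Longrightarrow> sym_part M \<in> carrier_mat r r"
  by (auto simp: sym_part_def)

lemma sym_part_add:
  "dim_row M = dim_row N \<Longrightarrow> dim_col M = dim_col N \<Longrightarrow> dim_row N = dim_col N \<Longrightarrow>
    sym_part (M + N) = sym_part M + sym_part N"
  by (rule eq_matI) (auto simp: sym_part_def field_simps)

lemma sym_part_smult: "dim_row M = dim_col M \<Longrightarrow> sym_part (k \<cdot>\<^sub>m M) = k \<cdot>\<^sub>m sym_part M"
  by (rule eq_matI) (auto simp: sym_part_def field_simps)

lemma sym_part_antisym: "M\<^sup>T = - M \<Longrightarrow> sym_part M = 0\<^sub>m (dim_row M) (dim_col M)"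
  by (rule eq_matI) (auto simp: sym_part_def)

lemma Sym_iff: "M \<in> Sym r \<longleftrightarrow> M \<in> carrier_mat r r \<and> M\<^sup>T = M"
  by (auto simp: Sym_def)

lemma sym_part_zero [simp]: "sym_part (0\<^sub>m r r) = 0\<^sub>m r r"
  by (rule eq_matI) (auto simp: sym_part_def)

lemma Sym_add: "M \<in> Sym r \<Longrightarrow> N \<in> Sym r \<Longrightarrow> M + N \<in> Sym r"
  by (auto simp: Sym_iff mat_expand)

lemma Sym_smult: "M \<in> Sym r \<Longrightarrow> k \<cdot>\<^sub>m M \<in> Sym r"
  by (auto simp: Sym_iff mat_expand)

lemma Sym_sym_part: "M \<in> carrier_mat r r \<Longrightarrow> sym_part M \<in> Sym r"
  by (simp add: Sym_iff sym_part_carrier transpose_sym_part)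

lemma mat_uminus_add_dim:
  fixes M N :: "real mat"
  shows "dim_row M = dim_row N \<Longrightarrow> dim_col M = dim_col N \<Longrightarrow> - (M + N) = - M + - N"
  by (rule eq_matI) auto

context jacobi
begin

abbreviation "G \<equiv> Jac m (- L) d"

lemma Sp_iff: "g \<in> Sp m (- L) \<longleftrightarrow> g \<in> carrier_mat m m \<and> g\<^sup>T * (L * g) = L"
proof -
  have "g\<^sup>T * (- L) * g = - (g\<^sup>T * (L * g))" if "g \<in> carrier_mat m m"
    using that L by (simp add: mat_expand)
  then show ?thesis
    by (auto simp: Sp_def dest: arg_cong[of _ _ uminus])
qed

text \<open>The inverse of a symplectic matrix, solved from \<open>g\<^sup>T * (L * g) = L\<close>
  by multiplying with \<open>K\<close>.\<close>

definition sp_inv :: "real mat \<Rightarrow> real mat" where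
  "sp_inv g = K * (g\<^sup>T * L)"

text \<open>A left inverse of a square matrix is also a right inverse. Multiplying
  \<open>g * sp_inv g = 1\<close> by \<open>K\<close> on the right then yields
  \<open>g K g\<^sup>T = K\<close>, the form of symplecticity that \<open>bform_via_group\<close>
  uses.\<close>

lemma sp_inv:
  assumes "g \<in> Sp m (- L)"
  shows "sp_inv g \<in> carrier_mat m m" "sp_inv g * g = 1\<^sub>m m" "g * sp_inv g = 1\<^sub>m m"
    "g * (K * g\<^sup>T) = K" "sp_inv g \<in> Sp m (- L)"
proof -
  have g: "g \<in> carrier_mat m m" and gLg: "g\<^sup>T * (L * g) = L"
    using assms by (auto simp: Sp_iff)
  note d = g[THEN carrier_matD(1)] g[THEN carrier_matD(2)] K[THEN carrier_matD(1)] K[THEN carrier_matD(2)]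
    L[THEN carrier_matD(1)] L[THEN carrier_matD(2)]
  show 1: "sp_inv g \<in> carrier_mat m m" using K g L by (auto simp: sp_inv_def)
  show 2: "sp_inv g * g = 1\<^sub>m m"
    by (simp add: sp_inv_def mat_expand d gLg KL)
  show 3: "g * sp_inv g = 1\<^sub>m m"
    by (rule mat_mult_left_right_inverse[OF 1 g 2])
  have "g * (K * g\<^sup>T) = g * (K * g\<^sup>T) * (L * K)" using g K by (simp add: LK d)
  also have "\<dots> = g * sp_inv g * K" by (simp add: sp_inv_def mat_expand d)
  finally show "g * (K * g\<^sup>T) = K" using 3 K by simp
  have "(sp_inv g)\<^sup>T * (g\<^sup>T * (L * g)) * sp_inv g = (g * sp_inv g)\<^sup>T * L * (g * sp_inv g)"
    using 1 by (simp add: mat_expand d)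
  then have "(sp_inv g)\<^sup>T * L * sp_inv g = L" unfolding gLg 3 using L by simp
  then show "sp_inv g \<in> Sp m (- L)" using 1 L by (simp add: Sp_iff mat_expand d)
qed

lemma carrier_G: "carrier G = Sp m (- L) \<times> carrier_mat m d \<times> Sym d"
  by (simp add: Jac_def)

lemma mult_G: "x \<otimes>\<^bsub>G\<^esub> y = jac_mult (- L) x y"
  by (simp add: Jac_def)

lemma one_G: "\<one>\<^bsub>G\<^esub> = (1\<^sub>m m, 0\<^sub>m m d, 0\<^sub>m d d)"
  by (simp add: Jac_def)

lemma Sp_mult: "g \<in> Sp m (- L) \<Longrightarrow> g' \<in> Sp m (- L) \<Longrightarrow> g * g' \<in> Sp m (- L)"
proof -
  assume "g \<in> Sp m (- L)" "g' \<in> Sp m (- L)"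
  then have c: "g \<in> carrier_mat m m" "g' \<in> carrier_mat m m" and
    e: "g\<^sup>T * (L * g) = L" "g'\<^sup>T * (L * g') = L" by (auto simp: Sp_iff)
  note d = c[THEN carrier_matD(1)] c[THEN carrier_matD(2)] L[THEN carrier_matD(1)] L[THEN carrier_matD(2)]
  have "(g * g')\<^sup>T * (L * (g * g')) = g'\<^sup>T * ((g\<^sup>T * (L * g)) * g')"
    by (simp add: d mat_expand)
  then show ?thesis using c e by (simp add: Sp_iff)
qed

lemma one_Sp: "1\<^sub>m m \<in> Sp m (- L)"
  using L by (simp add: Sp_iff)

text \<open>\<open>A\<^sup>T L A\<close> is antisymmetric, so its symmetric part vanishes and the
  last component of the inverse is just \<open>- B\<close>.\<close>

lemma inv_triple:
  assumes p: "(g, A, B) \<in> carrier G"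
  shows "(sp_inv g, - (sp_inv g * A), - B) \<in> carrier G"
    "(sp_inv g, - (sp_inv g * A), - B) \<otimes>\<^bsub>G\<^esub> (g, A, B) = \<one>\<^bsub>G\<^esub>"
proof -
  have g: "g \<in> Sp m (- L)" and A: "A \<in> carrier_mat m d" and B: "B \<in> Sym d"
    using p by (auto simp: carrier_G)
  note h = sp_inv[OF g]
  note d = h(1)[THEN carrier_matD(1)] h(1)[THEN carrier_matD(2)] A[THEN carrier_matD(1)] A[THEN carrier_matD(2)]
    L[THEN carrier_matD(1)] L[THEN carrier_matD(2)]
  show "(sp_inv g, - (sp_inv g * A), - B) \<in> carrier G"
    using h(1,5) A B by (auto simp: carrier_G Sym_iff transpose_uminus)
  have hLh: "(sp_inv g)\<^sup>T * (L * sp_inv g) = L" using h(5) by (simp add: Sp_iff)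
  have "(- (sp_inv g * A))\<^sup>T * (- L) * sp_inv g * A = A\<^sup>T * (((sp_inv g)\<^sup>T * (L * sp_inv g)) * A)"
    by (simp add: mat_expand d)
  also have "\<dots> = A\<^sup>T * (L * A)" unfolding hLh ..
  finally have e: "(- (sp_inv g * A))\<^sup>T * (- L) * sp_inv g * A = A\<^sup>T * (L * A)" .
  have "sym_part (A\<^sup>T * (L * A)) = 0\<^sub>m d d"
    by (subst sym_part_antisym) (simp_all add: d mat_expand L_antisym)
  then have s: "sym_part ((- (sp_inv g * A))\<^sup>T * (- L) * sp_inv g * A) = 0\<^sub>m d d" unfolding e .
  have Bc: "B \<in> carrier_mat d d" using B by (simp add: Sym_iff)
  have "- (sp_inv g * A) + sp_inv g * A = 0\<^sub>m m d" "- B + B = 0\<^sub>m d d"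
    using Bc h(1) A by (auto intro!: eq_matI)
  then show "(sp_inv g, - (sp_inv g * A), - B) \<otimes>\<^bsub>G\<^esub> (g, A, B) = \<one>\<^bsub>G\<^esub>"
    by (simp add: mult_G one_G h(2) s del: uminus_mult_left_mat uminus_mult_right_mat) 
qed

lemma group_G: "group G"
proof (rule groupI)
  fix x y assume "x \<in> carrier G" "y \<in> carrier G"
  then obtain g A B g' A' B' where x: "x = (g, A, B)" "g \<in> Sp m (- L)" "A \<in> carrier_mat m d" "B \<in> Sym d"
    and y: "y = (g', A', B')" "g' \<in> Sp m (- L)" "A' \<in> carrier_mat m d" "B' \<in> Sym d"
    by (auto simp: carrier_G)
  moreover have "A\<^sup>T * (- L) * g * A' \<in> carrier_mat d d" "g * A' \<in> carrier_mat m d"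
    using x y L by (auto simp: Sp_iff)
  ultimately show "x \<otimes>\<^bsub>G\<^esub> y \<in> carrier G"
    by (simp add: carrier_G mult_G Sp_mult Sym_add Sym_smult Sym_sym_part)
next
  show "\<one>\<^bsub>G\<^esub> \<in> carrier G"
    by (simp add: one_G carrier_G one_Sp Sym_iff)
next
  fix x y z assume xyz: "x \<in> carrier G" "y \<in> carrier G" "z \<in> carrier G"
  obtain g A B g' A' B' g'' A'' B'' where
    x: "x = (g, A, B)" and y: "y = (g', A', B')" and z: "z = (g'', A'', B'')"
    by (cases x, cases y, cases z) auto
  have c: "g \<in> carrier_mat m m" "g' \<in> carrier_mat m m" "g'' \<in> carrier_mat m m"
    "A \<in> carrier_mat m d" "A' \<in> carrier_mat m d" "A'' \<in> carrier_mat m d"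
    "B \<in> carrier_mat d d" "B' \<in> carrier_mat d d" "B'' \<in> carrier_mat d d"
    and e: "g\<^sup>T * (L * g) = L"
    using xyz unfolding x y z by (auto simp: carrier_G Sp_iff Sym_iff)
  note dims = c[THEN carrier_matD(1)] c[THEN carrier_matD(2)] L[THEN carrier_matD(1)] L[THEN carrier_matD(2)]
  \<comment> \<open>The cocycle identity behind associativity: the summand \<open>g * A'\<close> of
    a product meets another factor \<open>g\<close> across the form \<open>L\<close>, and the two
    cancel.\<close>
  have e': "g\<^sup>T * (L * (g * M)) = L * M" if "dim_row M = m" for M
  proof -
    have "g\<^sup>T * (L * (g * M)) = (g\<^sup>T * (L * g)) * M" using that by (simp add: dims mat_expand)
    then show ?thesis unfolding e .
  qed
  show "x \<otimes>\<^bsub>G\<^esub> y \<otimes>\<^bsub>G\<^esub> z = x \<otimes>\<^bsub>G\<^esub> (y \<otimes>\<^bsub>G\<^esub> z)"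
  proof -
    have "A + g * A' + g * (g' * A'') = A + (g * A' + g * (g' * A''))"
      using c by (intro assoc_add_mat[of _ m d]) auto
    moreover have "(B + B' + 1 / 2 \<cdot>\<^sub>m sym_part (- (A\<^sup>T * (L * (g * A'))))) + B'' +
        1 / 2 \<cdot>\<^sub>m sym_part (- (A\<^sup>T * (L * (g * (g' * A'')))) + - (A'\<^sup>T * (L * (g' * A'')))) =
      B + (B' + B'' + 1 / 2 \<cdot>\<^sub>m sym_part (- (A'\<^sup>T * (L * (g' * A''))))) +
        1 / 2 \<cdot>\<^sub>m sym_part (- (A\<^sup>T * (L * (g * A'))) + - (A\<^sup>T * (L * (g * (g' * A'')))))"
      using dims by (intro eq_matI) (simp_all add: sym_part_add add_divide_distrib del: index_mult_mat(1))
    ultimately show ?thesis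
      using L by (simp add: x y z mult_G dims mat_expand e' mat_uminus_add_dim)
  qed
next
  fix x assume "x \<in> carrier G"
  then show "\<one>\<^bsub>G\<^esub> \<otimes>\<^bsub>G\<^esub> x = x"
    using L by (cases x) (auto simp: one_G mult_G carrier_G Sp_iff Sym_iff sym_part_antisym mat_expand
      simp del: uminus_mult_left_mat uminus_mult_right_mat)
next
  fix x assume "x \<in> carrier G"
  then show "\<exists>y\<in>carrier G. y \<otimes>\<^bsub>G\<^esub> x = \<one>\<^bsub>G\<^esub>"
    by (cases x) (metis inv_triple prod.exhaust)
qed

end

section \<open>The metric at the identity and left translation of tangent vectors\<close>

lemma mat_inv_eqI:
  assumes "M \<in> carrier_mat r r" "N \<in> carrier_mat r r" "M * N = 1\<^sub>m r" "N * M = 1\<^sub>m r"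
  shows "mat_inv M = N"
proof -
  \<comment> \<open>\<open>mat_inverse\<close> can return \<open>None\<close> only for a matrix that
    is not a unit of the matrix ring.\<close>
  have "M \<in> Units (ring_mat TYPE(real) r ())"
    using assms by (auto simp: Units_def ring_mat_def)
  then obtain P where P: "mat_inverse M = Some P"
    using mat_inverse(1)[OF assms(1)] by fastforce
  from mat_inverse(2)[OF assms(1) this]
  have PM: "P * M = 1\<^sub>m r" and Pc: "P \<in> carrier_mat r r" by auto
  have "P * M * N = P * (M * N)" by (rule assoc_mult_mat[OF Pc assms(1,2)])
  then have "P = N" unfolding PM assms(3) using Pc assms(2) by simp
  then show ?thesis using P by (simp add: mat_inv_def)
qed

context jacobi
begin

lemma inv_G:
  assumes "(g, A, B) \<in> carrier G"
  shows "inv\<^bsub>G\<^esub> (g, A, B) = (sp_inv g, - (sp_inv g * A), - B)"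
  using group.inv_equality[OF group_G inv_triple(2)[OF assms] assms inv_triple(1)[OF assms]] .

text \<open>Multiplication by a fixed element on the left is affine in the right factor, also
  outside the group, so the derivative along the line \<open>p + s u\<close> is the coefficient of
  \<open>s\<close>. In the third component the signs of \<open>- L\<close> and of the inverse
  cancel, which leaves half of \<open>dform\<close>.\<close>

lemma to_identity_G:
  assumes p: "(g, A, B) \<in> carrier G"
    and u: "u1 \<in> carrier_mat m m" "u2 \<in> carrier_mat m d" "u3 \<in> carrier_mat d d"
  shows "to_identity G (g, A, B) (u1, u2, u3) =
    (sp_inv g * u1, sp_inv g * u2, (1 / 2) \<cdot>\<^sub>m dform L A u2 u3)"
proof -
  have g: "g \<in> Sp m (- L)" and c: "g \<in> carrier_mat m m" "A \<in> carrier_mat m d" "B \<in> carrier_mat d d"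
    using p by (auto simp: carrier_G Sp_iff Sym_iff)
  note h = sp_inv[OF g]
  note dims = c[THEN carrier_matD(1)] c[THEN carrier_matD(2)] u[THEN carrier_matD(1)] u[THEN carrier_matD(2)]
    L[THEN carrier_matD(1)] L[THEN carrier_matD(2)] h(1)[THEN carrier_matD(1)] h(1)[THEN carrier_matD(2)]
  have hLh: "(sp_inv g)\<^sup>T * (L * sp_inv g) = L" using h(5) by (simp add: Sp_iff)
  have e: "(- (sp_inv g * A))\<^sup>T * (- L) * sp_inv g * M = A\<^sup>T * (L * M)" if "dim_row M = m" for M
  proof -
    have "(- (sp_inv g * A))\<^sup>T * (- L) * sp_inv g * M = A\<^sup>T * (((sp_inv g)\<^sup>T * (L * sp_inv g)) * M)"
      using that by (simp add: mat_expand dims)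
    then show ?thesis unfolding hLh .
  qed
  define M3 where "M3 = - B + B + (1 / 2) \<cdot>\<^sub>m sym_part (A\<^sup>T * (L * A))"
  define N3 where "N3 = u3 + (1 / 2) \<cdot>\<^sub>m sym_part (A\<^sup>T * (L * u2))"
  have E: "inv\<^bsub>G\<^esub> (g, A, B) \<otimes>\<^bsub>G\<^esub> tri_add (g, A, B) (tri_smult s (u1, u2, u3)) =
    (sp_inv g * g + s \<cdot>\<^sub>m (sp_inv g * u1),
     (- (sp_inv g * A) + sp_inv g * A) + s \<cdot>\<^sub>m (sp_inv g * u2),
     M3 + s \<cdot>\<^sub>m N3)" for s
  proof -
    have 1: "sp_inv g * (g + s \<cdot>\<^sub>m u1) = sp_inv g * g + s \<cdot>\<^sub>m (sp_inv g * u1)"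
      by (simp add: dims mat_expand)
    have 2: "- (sp_inv g * A) + sp_inv g * (A + s \<cdot>\<^sub>m u2) = (- (sp_inv g * A) + sp_inv g * A) + s \<cdot>\<^sub>m (sp_inv g * u2)"
      by (intro eq_matI) (simp_all add: dims mat_expand del: index_mult_mat(1))
    have "sym_part (A\<^sup>T * (L * (A + s \<cdot>\<^sub>m u2))) =
      sym_part (A\<^sup>T * (L * A)) + s \<cdot>\<^sub>m sym_part (A\<^sup>T * (L * u2))"
      by (simp add: dims mat_expand sym_part_add sym_part_smult)
    then have 3: "- B + (B + s \<cdot>\<^sub>m u3) + (1 / 2) \<cdot>\<^sub>m sym_part (A\<^sup>T * (L * (A + s \<cdot>\<^sub>m u2))) = M3 + s \<cdot>\<^sub>m N3"
      unfolding M3_def N3_def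
      by (intro eq_matI) (simp_all add: dims field_simps del: index_mult_mat(1))
    have 4: "dim_row (A + s \<cdot>\<^sub>m u2) = m" by (simp add: dims)
    show ?thesis
      by (simp only: inv_G[OF p] mult_G tri_add.simps tri_smult.simps jac_mult.simps e[OF 4] 1 2 3)
  qed
  have M3: "M3 \<in> carrier_mat d d" and N3: "N3 \<in> carrier_mat d d"
    unfolding M3_def N3_def by (auto simp: dims)
  have D1: "mat_deriv (\<lambda>s. sp_inv g * g + s \<cdot>\<^sub>m (sp_inv g * u1)) 0 = sp_inv g * u1"
    by (rule mat_deriv_affine[where r = m and c = m]) (use h c u in auto)
  have D2: "mat_deriv (\<lambda>s. (- (sp_inv g * A) + sp_inv g * A) + s \<cdot>\<^sub>m (sp_inv g * u2)) 0 = sp_inv g * u2"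
    by (rule mat_deriv_affine[where r = m and c = d]) (use h c u in auto)
  have "N3 = (1 / 2) \<cdot>\<^sub>m dform L A u2 u3"
    unfolding N3_def dform_def
    by (intro eq_matI) (simp_all add: dims mat_expand field_simps del: index_mult_mat(1))
  then show ?thesis
    unfolding to_identity_def velocity_def E fst_conv snd_conv D1 D2 mat_deriv_affine[OF M3 N3] by simp
qed

lemma L_sp_inv:
  assumes "g \<in> carrier_mat m m" "u \<in> carrier_mat m c"
  shows "L * (sp_inv g * u) = bform L g u"
proof -
  have "L * (sp_inv g * u) = (L * K) * (g\<^sup>T * (L * u))"
    using assms K L by (simp add: sp_inv_def mat_expand)
  also have "\<dots> = bform L g u" unfolding LK bform_def using assms L by (simp add: mat_expand)
  finally show ?thesis .
qed

lemma mat_inv_K: "mat_inv K = L"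
  by (rule mat_inv_eqI[OF K L KL LK])

text \<open>By antisymmetry \<open>- (L * L) = L\<^sup>T * L\<close>, so the first two traces are
  squared Frobenius norms.\<close>

lemma lagrangian_K:
  assumes "S \<in> carrier_mat m m" "A \<in> carrier_mat m d" "B \<in> carrier_mat d d"
  shows "lagrangian K (S, A, B) =
    1 / 2 * frob (L * S) (L * S) + frob (L * A) (L * A) + 2 * frob (B\<^sup>T) B"
proof -
  have *: "mat_trace (M\<^sup>T * (- (L * L)) * M) = frob (L * M) (L * M)" if "M \<in> carrier_mat m c" for M c
  proof -
    have "M\<^sup>T * (- (L * L)) * M = (L * M)\<^sup>T * (L * M)"
      using that L by (simp add: mat_expand L_antisym)
    then show ?thesis using that L mat_trace_mult[of "(L * M)\<^sup>T" "L * M"] by simp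
  qed
  show ?thesis
    using assms *[OF assms(1)] *[OF assms(2)] mat_trace_mult[of B B]
    by (simp add: mat_inv_K Let_def del: uminus_mult_left_mat uminus_mult_right_mat)
qed

lemma lagrangian_form_K:
  assumes "S \<in> carrier_mat m m" "A \<in> carrier_mat m d" "B \<in> carrier_mat d d"
    "S' \<in> carrier_mat m m" "A' \<in> carrier_mat m d" "B' \<in> carrier_mat d d"
  shows "lagrangian_form K (S, A, B) (S', A', B') =
    frob (L * S) (L * S') + 2 * frob (L * A) (L * A') + 4 * frob (B\<^sup>T) B'"
proof -
  note dims = assms[THEN carrier_matD(1)] assms[THEN carrier_matD(2)]
    L[THEN carrier_matD(1)] L[THEN carrier_matD(2)]
  have s: "S + S' \<in> carrier_mat m m" "A + A' \<in> carrier_mat m d" "B + B' \<in> carrier_mat d d"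
    using assms by auto
  have 1: "frob (B'\<^sup>T) B = frob (B\<^sup>T) B'"
    using frob_transpose[of "B'\<^sup>T" B] frob_commute[of B' "B\<^sup>T"] by (simp add: dims)
  have 2: "frob (L * S') (L * S) = frob (L * S) (L * S')" "frob (L * A') (L * A) = frob (L * A) (L * A')"
    by (rule frob_commute; simp add: dims)+
  have 3: "frob (L * (S + S')) (L * (S + S')) = frob (L * S) (L * S) + 2 * frob (L * S) (L * S') + frob (L * S') (L * S')"
    by (simp add: mat_expand dims frob_simps 2)
  have 4: "frob (L * (A + A')) (L * (A + A')) = frob (L * A) (L * A) + 2 * frob (L * A) (L * A') + frob (L * A') (L * A')"
    by (simp add: mat_expand dims frob_simps 2)
  have 5: "frob ((B + B')\<^sup>T) (B + B') = frob (B\<^sup>T) B + 2 * frob (B\<^sup>T) B' + frob (B'\<^sup>T) B'"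
    by (simp add: mat_expand dims frob_simps 1)
  show ?thesis
    unfolding lagrangian_form_def tri_add.simps lagrangian_K[OF s] lagrangian_K[OF assms(1-3)]
      lagrangian_K[OF assms(4-6)] 3 4 5
    by (simp add: field_simps)
qed

lemma lagrangian_eq_form:
  assumes "S \<in> carrier_mat m m" "A \<in> carrier_mat m d" "B \<in> carrier_mat d d"
  shows "lagrangian K (S, A, B) = 1 / 2 * lagrangian_form K (S, A, B) (S, A, B)"
  unfolding lagrangian_K[OF assms] lagrangian_form_K[OF assms assms] by simp

lemma jac_algebraD:
  assumes "(S, A, B) \<in> jac_algebra m (- L) d"
  shows "S \<in> carrier_mat m m" "A \<in> carrier_mat m d" "B \<in> carrier_mat d d" "B\<^sup>T = B"
  using assms by (auto simp: jac_algebra_def sp_algebra_def Sym_iff)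

lemma L_mult_eq_0:
  assumes "M \<in> carrier_mat m c" "L * M = 0\<^sub>m m c"
  shows "M = 0\<^sub>m m c"
proof -
  have "M = (K * L) * M" using assms by (simp add: KL)
  also have "\<dots> = K * (L * M)" using assms K L by (simp add: mat_expand)
  finally show ?thesis using K by (simp add: assms(2))
qed

text \<open>Definiteness rests on two facts: \<open>L\<close> is injective, and \<open>B\<close> is
  symmetric on the Lie algebra, so that \<open>Tr (B * B)\<close> is a sum of squares.\<close>

lemma inner_product_on_jac_algebra:
  "inner_product_on m d (jac_algebra m (- L) d) (lagrangian_form K)"
proof -
  let ?V = "jac_algebra m (- L) d"
  note LD = L[THEN carrier_matD(1)] L[THEN carrier_matD(2)]
  have symm: "lagrangian_form K u v = lagrangian_form K v u" if "u \<in> ?V" "v \<in> ?V" for u v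
  proof -
    obtain S A B S' A' B' where uv: "u = (S, A, B)" "v = (S', A', B')" by (cases u, cases v)
    note c = jac_algebraD[OF that(1)[unfolded uv]] jac_algebraD[OF that(2)[unfolded uv]]
    show ?thesis
      using frob_commute[of "L * S'" "L * S"] frob_commute[of "L * A'" "L * A"] frob_commute[of B B'] c
      by (simp add: uv lagrangian_form_K)
  qed
  have add: "lagrangian_form K (tri_add u v) w = lagrangian_form K u w + lagrangian_form K v w"
    if "u \<in> ?V" "v \<in> ?V" "w \<in> ?V" for u v w
  proof -
    obtain S A B S' A' B' S'' A'' B''
      where uvw: "u = (S, A, B)" "v = (S', A', B')" "w = (S'', A'', B'')" by (cases u, cases v, cases w)
    note c = jac_algebraD[OF that(1)[unfolded uvw]] jac_algebraD[OF that(2)[unfolded uvw]]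
      jac_algebraD[OF that(3)[unfolded uvw]]
    note dims = c(1-3,5-7)[THEN carrier_matD(1)] c(1-3,5-7)[THEN carrier_matD(2)] LD
    have s: "S + S' \<in> carrier_mat m m" "A + A' \<in> carrier_mat m d" "B + B' \<in> carrier_mat d d"
      by (auto simp: dims)
    show ?thesis
      unfolding uvw tri_add.simps lagrangian_form_K[OF s c(9-11)] lagrangian_form_K[OF c(1-3) c(9-11)]
        lagrangian_form_K[OF c(5-7) c(9-11)]
      by (simp add: frob_simps mat_expand dims)
  qed
  have smult: "lagrangian_form K (tri_smult r u) v = r * lagrangian_form K u v"
    if "u \<in> ?V" "v \<in> ?V" for r u v
  proof -
    obtain S A B S' A' B' where uv: "u = (S, A, B)" "v = (S', A', B')" by (cases u, cases v)
    note c = jac_algebraD[OF that(1)[unfolded uv]] jac_algebraD[OF that(2)[unfolded uv]]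
    show ?thesis
      using c LD by (simp add: uv lagrangian_form_K frob_simps mat_expand algebra_simps)
  qed
  have pos: "lagrangian_form K u u > 0" if "u \<in> ?V" "u \<noteq> tri_zero m d" for u
  proof -
    obtain S A B where u: "u = (S, A, B)" by (cases u)
    note c = jac_algebraD[OF that(1)[unfolded u]]
    have e: "lagrangian_form K u u = frob (L * S) (L * S) + 2 * frob (L * A) (L * A) + 4 * frob B B"
      using c by (simp add: u lagrangian_form_K)
    have "lagrangian_form K u u \<noteq> 0"
    proof
      assume "lagrangian_form K u u = 0"
      then have "frob (L * S) (L * S) = 0" "frob (L * A) (L * A) = 0" "frob B B = 0"
        using e frob_self_nonneg[of "L * S"] frob_self_nonneg[of "L * A"] frob_self_nonneg[of B] by linarith+
      then have "S = 0\<^sub>m m m" "A = 0\<^sub>m m d" "B = 0\<^sub>m d d"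
        using c LD L_mult_eq_0 by (auto simp: frob_self_eq_0)
      then show False using that(2) by (simp add: u tri_zero_def)
    qed
    then show ?thesis
      using e frob_self_nonneg[of "L * S"] frob_self_nonneg[of "L * A"] frob_self_nonneg[of B] by linarith
  qed
  show ?thesis
    unfolding inner_product_on_def using symm add smult pos by blast
qed

end

section \<open>The normal form of an antisymmetric matrix\<close>

text \<open>The reflection \<open>1 - k w w\<^sup>T\<close> with \<open>w = v - e_p\<close>
  exchanges the unit vectors \<open>e_p\<close> and \<open>v\<close>.\<close>

lemma householder:
  fixes v :: "nat \<Rightarrow> real"
  assumes p: "p < n" and v: "(\<Sum>i<n. v i ^ 2) = 1"
  obtains H where "H \<in> carrier_mat n n" "H\<^sup>T * H = 1\<^sub>m n" "\<And>i. i < n \<Longrightarrow> H $$ (i, p) = v i"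
proof -
  define w where "w i = v i - (if i = p then 1 else 0)" for i
  define W where "W = (\<Sum>i<n. w i ^ 2)"
  \<comment> \<open>If \<open>v\<close> is already \<open>e_p\<close>, then \<open>W = 0\<close>,
    division by zero makes \<open>k = 0\<close>, and \<open>H\<close> is the identity.\<close>
  define k where "k = 2 / W"
  define H where "H = mat n n (\<lambda>(i, j). (if i = j then 1 else 0) - k * w i * w j)"
  have W: "W = - 2 * w p"
  proof -
    have "w i ^ 2 = v i ^ 2 - (if i = p then 2 * v i else 0) + (if i = p then 1 else 0)" for i
      by (simp add: w_def power2_diff)
    then have "W = 1 - 2 * v p + 1"
      using p v by (simp add: W_def sum.distrib sum_subtractf)
    then show ?thesis by (simp add: w_def)
  qed
  \<comment> \<open>Also true for \<open>W = 0\<close>, where both sides vanish, so orthogonality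
    needs no case distinction.\<close>
  have kk: "k * k * W = 2 * k" by (simp add: k_def)
  have col: "H $$ (i, p) = v i" if "i < n" for i
  proof (cases "W = 0")
    case True
    then have "w i = 0" using that by (simp add: W_def sum_nonneg_eq_0_iff)
    then show ?thesis using True that p by (simp add: H_def k_def w_def split: if_splits)
  next
    case False
    then have "k * w p = -1" using W by (simp add: k_def field_simps)
    then have "k * w i * w p = - w i" by (metis mult.assoc mult.commute mult_minus1)
    then show ?thesis using that p by (simp add: H_def w_def)
  qed
  have "H\<^sup>T * H = 1\<^sub>m n"
  proof (rule eq_matI)
    fix i j assume "i < dim_row (1\<^sub>m n)" "j < dim_col (1\<^sub>m n)"
    then have ij: "i < n" "j < n" by simp_all
    have "(H\<^sup>T * H) $$ (i, j) =
      (\<Sum>l<n. ((if l = i then 1 else 0) - k * w l * w i) * ((if l = j then 1 else 0) - k * w l * w j))"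
      using ij by (simp del: index_mult_mat(1) add: index_mult_mat_sum H_def)
    also have "\<dots> = (\<Sum>l<n. (if l = i then (if l = j then 1 else 0) - k * w l * w j else 0)
        - (if l = j then k * w l * w i else 0) + k * k * w i * w j * w l ^ 2)"
      by (intro sum.cong refl) (simp add: algebra_simps power2_eq_square)
    also have "\<dots> = (if i = j then 1 else 0) - k * w i * w j - k * w j * w i + k * k * w i * w j * W"
      using ij by (simp add: sum.distrib sum_subtractf sum_distrib_left W_def)
    also have "\<dots> = (if i = j then 1 else 0) + (k * k * W - 2 * k) * w i * w j"
      by (simp add: algebra_simps)
    also have "\<dots> = 1\<^sub>m n $$ (i, j)" using ij kk by simp
    finally show "(H\<^sup>T * H) $$ (i, j) = 1\<^sub>m n $$ (i, j)" .
  qed (simp_all add: H_def)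
  then show ?thesis using that[of H] col by (simp add: H_def)
qed

lemma orthogonal_commute: "Q \<in> carrier_mat n n \<Longrightarrow> Q\<^sup>T * Q = 1\<^sub>m n \<Longrightarrow> Q * Q\<^sup>T = 1\<^sub>m n" for Q :: "real mat"
  by (rule mat_mult_left_right_inverse[of "Q\<^sup>T" n Q]) auto

abbreviation pad_zero :: "nat \<Rightarrow> nat \<Rightarrow> real mat \<Rightarrow> real mat" where
  "pad_zero r c M \<equiv> four_block_mat M (0\<^sub>m r c) (0\<^sub>m c r) (0\<^sub>m c c)"

text \<open>Rotating a unit kernel vector into the last coordinate makes the last column zero, and
  antisymmetry makes the last row zero as well. The induction then continues with the remaining
  antisymmetric block until the determinant is nonzero.\<close>

lemma antisym_orthogonal_normal_form:
  fixes N :: "real mat"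
  assumes "N \<in> carrier_mat n n" "N\<^sup>T = - N"
  shows "\<exists>r c Q M. n = r + c \<and> Q \<in> carrier_mat n n \<and> Q\<^sup>T * Q = 1\<^sub>m n \<and>
    M \<in> carrier_mat r r \<and> M\<^sup>T = - M \<and> det M \<noteq> 0 \<and> N = Q * pad_zero r c M * Q\<^sup>T"
  using assms
proof (induction n arbitrary: N)
  case 0
  show ?case
    by (rule exI[of _ 0], rule exI[of _ 0], rule exI[of _ "1\<^sub>m 0"], rule exI[of _ "1\<^sub>m 0"])
      (use 0 in \<open>auto intro!: eq_matI simp: four_block_mat_def\<close>)
next
  case (Suc n)
  show ?case
  proof (cases "det N = 0")
    case False
    have "N = 1\<^sub>m (Suc n) * pad_zero (Suc n) 0 N * (1\<^sub>m (Suc n))\<^sup>T"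
    proof -
      have "pad_zero (Suc n) 0 N = N"
        using Suc.prems(1) by (intro eq_matI) auto
      then show ?thesis using Suc.prems(1) by simp
    qed
    then show ?thesis
      using False Suc.prems
      by (intro exI[of _ "Suc n"] exI[of _ 0] exI[of _ "1\<^sub>m (Suc n)"] exI[of _ N]) auto
  next
    case True
    then obtain u where u: "u \<in> carrier_vec (Suc n)" "u \<noteq> 0\<^sub>v (Suc n)" "N *\<^sub>v u = 0\<^sub>v (Suc n)"
      using det_0_iff_vec_prod_zero[OF Suc.prems(1)] by auto
    define q where "q = (\<Sum>i<Suc n. (u $ i) ^ 2)"
    have "q \<noteq> 0"
    proof
      assume "q = 0"
      then have "u $ i = 0" if "i < Suc n" for i
        using that unfolding q_def by (subst (asm) sum_nonneg_eq_0_iff) auto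
      then have "u = 0\<^sub>v (Suc n)" using u(1) by (intro eq_vecI) auto
      then show False using u(2) by simp
    qed
    then have q: "q > 0" unfolding q_def by (metis order_le_less sum_nonneg zero_le_power2)
    define v where "v i = u $ i / sqrt q" for i
    have "(\<Sum>i<Suc n. v i ^ 2) = 1"
    proof -
      have "(\<Sum>i<Suc n. v i ^ 2) = (\<Sum>i<Suc n. (u $ i) ^ 2) / q"
        unfolding sum_divide_distrib v_def using q by (simp add: power_divide)
      then show ?thesis using q by (simp add: q_def)
    qed
    from householder[OF lessI this] obtain H where
      H: "H \<in> carrier_mat (Suc n) (Suc n)" "H\<^sup>T * H = 1\<^sub>m (Suc n)" "\<And>i. i < Suc n \<Longrightarrow> H $$ (i, n) = v i"
      by blast
    note HD = H(1)[THEN carrier_matD(1)] H(1)[THEN carrier_matD(2)]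
      Suc.prems(1)[THEN carrier_matD(1)] Suc.prems(1)[THEN carrier_matD(2)]
    have HH: "H * H\<^sup>T = 1\<^sub>m (Suc n)" by (rule orthogonal_commute[OF H(1,2)])
    have NH: "(N * H) $$ (i, n) = 0" if "i < Suc n" for i
    proof -
      have "(N * H) $$ (i, n) = (\<Sum>k<Suc n. N $$ (i, k) * u $ k) / sqrt q"
        using that HD H(3)
        by (simp del: index_mult_mat(1) sum.lessThan_Suc add: index_mult_mat_sum v_def sum_divide_distrib)
      also have "(\<Sum>k<Suc n. N $$ (i, k) * u $ k) = (N *\<^sub>v u) $ i"
        using that HD u(1) by (simp add: scalar_prod_def lessThan_atLeast0)
      finally show ?thesis using u(3) that by simp
    qed
    define M where "M = H\<^sup>T * (N * H)"
    have M: "M \<in> carrier_mat (Suc n) (Suc n)" "M\<^sup>T = - M"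
      using Suc.prems HD by (auto simp: M_def mat_expand)
    have Mcol: "M $$ (i, n) = 0" if "i < Suc n" for i
      using that HD NH by (simp del: index_mult_mat(1) sum.lessThan_Suc add: index_mult_mat_sum M_def)
    have Mrow: "M $$ (n, i) = 0" if "i < Suc n" for i
    proof -
      have "M $$ (n, i) = M\<^sup>T $$ (i, n)" using that M(1) by simp
      then show ?thesis unfolding M(2) using that M(1) Mcol by simp
    qed
    define N' where "N' = mat n n (\<lambda>(i, j). M $$ (i, j))"
    have N': "N' \<in> carrier_mat n n" "N'\<^sup>T = - N'"
    proof -
      show "N' \<in> carrier_mat n n" by (simp add: N'_def)
      have anti: "M $$ (j, i) = - M $$ (i, j)" if "i < n" "j < n" for i j
      proof -
        have "M $$ (j, i) = M\<^sup>T $$ (i, j)" using that M(1) by simp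
        then show ?thesis unfolding M(2) using that M(1) by simp
      qed
      show "N'\<^sup>T = - N'"
      proof (rule eq_matI)
        fix i j assume "i < dim_row (- N')" "j < dim_col (- N')"
        then have "i < n" "j < n" by (simp_all add: N'_def)
        then show "N'\<^sup>T $$ (i, j) = (- N') $$ (i, j)" using anti[of i j] by (simp add: N'_def)
      qed (simp_all add: N'_def)
    qed
    have MN': "M = pad_zero n 1 N'"
      using M(1) Mcol Mrow by (intro eq_matI) (auto simp: N'_def not_less less_Suc_eq)
    obtain r c Q' M' where IH: "n = r + c" "Q' \<in> carrier_mat n n" "Q'\<^sup>T * Q' = 1\<^sub>m n"
      "M' \<in> carrier_mat r r" "M'\<^sup>T = - M'" "det M' \<noteq> 0" "N' = Q' * pad_zero r c M' * Q'\<^sup>T"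
      using Suc.IH[OF N'] by blast
    \<comment> \<open>The orthogonal matrix of the induction hypothesis, extended by 1 on the kernel
      vector that was split off.\<close>
    define P where "P = four_block_mat Q' (0\<^sub>m n 1) (0\<^sub>m 1 n) (1\<^sub>m 1)"
    have P: "P \<in> carrier_mat (Suc n) (Suc n)" using IH(2) by (auto simp: P_def)
    have PT: "P\<^sup>T = four_block_mat (Q'\<^sup>T) (0\<^sub>m n 1) (0\<^sub>m 1 n) (1\<^sub>m 1)"
      unfolding P_def using IH(2) by (subst transpose_four_block_mat) auto
    have PP: "P\<^sup>T * P = 1\<^sub>m (Suc n)"
      unfolding PT unfolding P_def using IH(2,3)
      by (subst mult_four_block_mat) (auto intro!: eq_matI)
    define F where "F = pad_zero r c M'"
    have F: "F \<in> carrier_mat n n" using IH(1,4) by (auto simp: F_def)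
    have pad: "pad_zero n 1 F = pad_zero r (Suc c) M'"
      using IH(1,4) by (intro eq_matI) (auto simp: F_def)
    have "P * pad_zero n 1 F * P\<^sup>T = pad_zero n 1 (Q' * F * Q'\<^sup>T)"
    proof -
      have "P * pad_zero n 1 F = pad_zero n 1 (Q' * F)"
        unfolding P_def using IH(2) F by (subst mult_four_block_mat) (auto intro!: eq_matI)
      moreover have "pad_zero n 1 (Q' * F) * P\<^sup>T = pad_zero n 1 (Q' * F * Q'\<^sup>T)"
        unfolding PT using IH(2) F by (subst mult_four_block_mat) (auto intro!: eq_matI)
      ultimately show ?thesis by simp
    qed
    then have MP: "M = P * pad_zero r (Suc c) M' * P\<^sup>T"
      using MN' IH(7) pad by (simp add: F_def)
    have "N = (H * H\<^sup>T) * N * (H * H\<^sup>T)" unfolding HH using Suc.prems(1) by simp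
    also have "\<dots> = H * M * H\<^sup>T" by (simp add: M_def mat_expand HD)
    also have "\<dots> = (H * P) * pad_zero r (Suc c) M' * (H * P)\<^sup>T"
      unfolding MP using P IH(1,4) by (simp add: mat_expand HD)
    finally have "N = (H * P) * pad_zero r (Suc c) M' * (H * P)\<^sup>T" .
    moreover have "(H * P)\<^sup>T * (H * P) = P\<^sup>T * ((H\<^sup>T * H) * P)"
      using P by (simp add: mat_expand HD)
    then have "(H * P)\<^sup>T * (H * P) = 1\<^sub>m (Suc n)" unfolding H(2) using P PP by simp
    ultimately show ?thesis
      using H(1) P IH(1,4-6)
      by (intro exI[of _ r] exI[of _ "Suc c"] exI[of _ "H * P"] exI[of _ M']) auto
  qed
qed

text \<open>The zero matrix is in row echelon form, with pivot function constantly \<open>c\<close>.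
  It has no nonzero rows, so the kernel basis read off the echelon form has \<open>c\<close>
  elements.\<close>

lemma kernel_dim_zero_mat: "kernel.dim c (0\<^sub>m c c :: real mat) = c"
proof -
  have Z: "(0\<^sub>m c c :: real mat) \<in> carrier_mat c c" by simp
  have "pivot_fun (0\<^sub>m c c :: real mat) (\<lambda>_. c) c"
    by (rule pivot_funI[of _ c]) auto
  then have "row_echelon_form (0\<^sub>m c c :: real mat)" unfolding row_echelon_form_def by auto
  note bv = find_base_vectors[OF this Z]
  interpret kernel c c "0\<^sub>m c c :: real mat" by unfold_locales (rule Z)
  have e: "{i. i < c \<and> row (0\<^sub>m c c :: real mat) i \<noteq> 0\<^sub>v c} = {}" by auto
  have "dim = card (set (find_base_vectors (0\<^sub>m c c :: real mat)))"
    by (rule Ker.dim_basis[OF finite_set bv(3)])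
  also have "\<dots> = c" using bv(4) unfolding e by simp
  finally show ?thesis .
qed

lemma kernel_dim_det_nonzero:
  fixes A :: "real mat"
  assumes A: "A \<in> carrier_mat r r" and "det A \<noteq> 0"
  shows "kernel.dim r A = 0"
proof -
  from det_non_zero_imp_unit[OF assms, unfolded Units_def, of "()"]
  obtain B where B: "B \<in> carrier_mat r r" "B * A = 1\<^sub>m r" "A * B = 1\<^sub>m r"
    by (auto simp: ring_mat_def)
  from mat_kernel_mult_eq[OF A B(1) A B(3)] have "mat_kernel A = mat_kernel (1\<^sub>m r)"
    unfolding B(2) by simp
  then show ?thesis using kernel_one_mat(1) by metis
qed

text \<open>Similar matrices have kernels of equal dimension, and the padded matrix has kernel
  dimension \<open>c\<close> because \<open>M\<close> is invertible; hence \<open>c = d\<close>.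
  That \<open>M\<close> has even size is not derived from antisymmetry but read off
  \<open>n = 2 * k + d\<close>.\<close>

lemma normal_form_exists:
  fixes N :: "real mat"
  assumes N: "N \<in> carrier_mat n n" "N\<^sup>T = - N" and n: "n = 2 * k + d" and ker: "kernel_dim N = d"
  shows "\<exists>Q Nb. normal_form k d N Q Nb"
proof -
  obtain r c Q M where *: "n = r + c" "Q \<in> carrier_mat n n" "Q\<^sup>T * Q = 1\<^sub>m n"
    "M \<in> carrier_mat r r" "M\<^sup>T = - M" "det M \<noteq> 0" "N = Q * pad_zero r c M * Q\<^sup>T"
    using antisym_orthogonal_normal_form[OF N] by blast
  let ?F = "pad_zero r c M"
  have F: "?F \<in> carrier_mat n n" using * by auto
  have "similar_mat_wit N ?F Q (Q\<^sup>T)"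
    using * N F orthogonal_commute[OF *(2,3)] by (intro similar_mat_witI[of _ _ n]) auto
  from similar_mat_wit_kernel_dim[OF N(1) this]
  have "kernel.dim n N = kernel.dim n ?F" .
  also have "\<dots> = kernel.dim r M + kernel.dim c (0\<^sub>m c c :: real mat)"
    unfolding *(1) by (rule kernel_four_block_0_mat[OF refl *(4)]) simp
  finally have "kernel.dim n N = c"
    using kernel_dim_det_nonzero[OF *(4,6)] kernel_dim_zero_mat by simp
  then have "c = d" using ker N(1) by (simp add: kernel_dim_def)
  then have "r = 2 * k" using n *(1) by simp
  from det_non_zero_imp_unit[OF *(4,6), unfolded Units_def, of "()"]
  have "invertible_mat M"
    using *(4) by (auto simp: ring_mat_def invertible_mat_def inverts_mat_def)
  then have "normal_form k d N Q M"
    using *(2-5,7) n unfolding normal_form_def \<open>c = d\<close> \<open>r = 2 * k\<close> by simp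
  then show ?thesis by blast
qed

section \<open>Geodesics\<close>

lemma has_real_derivative_along:
  assumes F: "smooth_on U f" and x: "x \<in> U"
  shows "((\<lambda>\<sigma>. f (x + \<sigma> *\<^sub>R v)) has_real_derivative frechet_derivative f (at x) v) (at 0)"
proof -
  have d: "(f has_derivative frechet_derivative f (at x)) (at (x + 0 *\<^sub>R v))"
    using smooth_on_imp_has_derivative[OF F x] by simp
  have "((\<lambda>\<sigma>. x + \<sigma> *\<^sub>R v) has_derivative (\<lambda>h. h *\<^sub>R v)) (at 0)"
    by (auto intro!: derivative_eq_intros)
  from has_derivative_compose[OF this d]
  have *: "((\<lambda>\<sigma>. f (x + \<sigma> *\<^sub>R v)) has_derivative (\<lambda>h. frechet_derivative f (at x) (h *\<^sub>R v))) (at 0)" .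
  have "(\<lambda>h. frechet_derivative f (at x) (h *\<^sub>R v)) = (*) (frechet_derivative f (at x) v)"
    using linear_cmul[OF has_derivative_linear[OF d]] by (auto simp: mult.commute)
  then show ?thesis unfolding has_field_derivative_def by (rule has_derivative_eq_rhs[OF *])
qed

text \<open>A directional derivative sees only the segment in its direction. This makes group
  identities usable at points whose neighbourhoods contain uncontrolled values. The two domains may
  differ, so a slice of a family can be compared with a curve.\<close>

lemma dmat_eq_along:
  fixes v w :: "'a::real_normed_vector" and v' :: "'b::real_normed_vector"
  assumes F: "smooth_mat r c U F" "x \<in> U" and H: "smooth_mat r c V H" "y \<in> V"
    and e: "\<epsilon> > 0" and eq: "\<And>\<sigma>. \<bar>\<sigma>\<bar> < \<epsilon> \<Longrightarrow> F (x + \<sigma> *\<^sub>R v) = H (y + \<sigma> *\<^sub>R v')"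
  shows "dmat F v x = dmat H v' y"
proof (rule eq_matI)
  fix i j assume "i < dim_row (dmat H v' y)" "j < dim_col (dmat H v' y)"
  then have ij: "i < r" "j < c" by (simp_all add: smooth_matD[OF H(1)])
  have "((\<lambda>\<sigma>. H (y + \<sigma> *\<^sub>R v') $$ (i, j)) has_real_derivative dmat H v' y $$ (i, j)) (at 0)"
    using has_real_derivative_along[OF smooth_matD(4)[OF H(1) ij] H(2)] ij
    by (simp add: index_dmat smooth_matD[OF H(1)])
  then have "((\<lambda>\<sigma>. F (x + \<sigma> *\<^sub>R v) $$ (i, j)) has_real_derivative dmat H v' y $$ (i, j)) (at 0)"
    by (rule has_field_derivative_transform_within_open[of _ _ _ "{-\<epsilon><..<\<epsilon>}"]) (use e eq in auto)
  moreover have "((\<lambda>\<sigma>. F (x + \<sigma> *\<^sub>R v) $$ (i, j)) has_real_derivative dmat F v x $$ (i, j)) (at 0)"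
    using has_real_derivative_along[OF smooth_matD(4)[OF F(1) ij] F(2)] ij
    by (simp add: index_dmat smooth_matD[OF F(1)])
  ultimately show "dmat F v x $$ (i, j) = dmat H v' y $$ (i, j)" by (rule DERIV_unique[symmetric])
qed (simp_all add: smooth_matD[OF F(1)] smooth_matD[OF H(1)])

text \<open>\<open>smooth_triple_on\<close> says nothing about sizes, and off the domain or the
  strip they are arbitrary; cutting to size makes \<open>smooth_mat\<close> available.\<close>

definition trunc :: "nat \<Rightarrow> nat \<Rightarrow> real mat \<Rightarrow> real mat" where
  "trunc r c M = mat r c (\<lambda>(i, j). M $$ (i, j))"

lemma trunc_id: "M \<in> carrier_mat r c \<Longrightarrow> trunc r c M = M"
  by (rule eq_matI) (auto simp: trunc_def)

lemma smooth_triple_trunc: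
  assumes "smooth_triple_on m d U F"
  shows "smooth_mat m m U (\<lambda>x. trunc m m (fst (F x)))"
    "smooth_mat m d U (\<lambda>x. trunc m d (fst (snd (F x))))"
    "smooth_mat d d U (\<lambda>x. trunc d d (snd (snd (F x))))"
  using assms by (simp_all add: smooth_mat_def smooth_triple_on_def trunc_def)

text \<open>The entries inside the frame agree at all times, and \<open>mat_deriv\<close> reads the
  size at \<open>t\<close> only.\<close>

lemma mat_deriv_trunc:
  "M t \<in> carrier_mat r c \<Longrightarrow> mat_deriv (\<lambda>\<tau>. trunc r c (M \<tau>)) t = mat_deriv M t"
  by (rule eq_matI) (auto simp: mat_deriv_def trunc_def)

context jacobi
begin

text \<open>Differentiating \<open>g\<^sup>T L g = L\<close> along the segment gives two summands
  with sum zero, and by antisymmetry of \<open>L\<close> the first is minus the transpose of the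
  second.\<close>

lemma bform_symmetric:
  fixes g :: "'a::real_normed_vector \<Rightarrow> real mat"
  assumes U: "open U" and g: "smooth_mat m m U g" and x: "x \<in> U" and e: "\<epsilon> > 0"
    and Sp: "\<And>\<sigma>. \<bar>\<sigma>\<bar> < \<epsilon> \<Longrightarrow> g (x + \<sigma> *\<^sub>R v) \<in> Sp m (- L)"
  shows "(bform L (g x) (dmat g v x))\<^sup>T = bform L (g x) (dmat g v x)"
proof -
  note sb = smooth_mat_bform[OF U L g g]
  note dims = smooth_matD[OF g] L[THEN carrier_matD(1)] L[THEN carrier_matD(2)]
  have "dmat (\<lambda>y. bform L (g y) (g y)) v x = dmat (\<lambda>y. L) v x"
    using Sp by (intro dmat_eq_along[OF sb x smooth_mat_const[OF L] x e])
      (auto simp: Sp_iff bform_def mat_expand dims)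
  then have "bform L (dmat g v x) (g x) + bform L (g x) (dmat g v x) = 0\<^sub>m m m"
    using dmat_bform[OF U L g g x] by (simp add: dmat_const dims)
  then have "(bform L (dmat g v x) (g x) + bform L (g x) (dmat g v x)) $$ (i, j) = 0" if "i < m" "j < m" for i j
    using that by simp
  then have *: "bform L (g x) (dmat g v x) $$ (i, j) = - bform L (dmat g v x) (g x) $$ (i, j)" if "i < m" "j < m" for i j
    using that by (simp add: bform_def dims add_eq_0_iff)
  have "(bform L (g x) (dmat g v x))\<^sup>T = - bform L (dmat g v x) (g x)"
    by (simp add: bform_def mat_expand dims L_antisym)
  also have "\<dots> = bform L (g x) (dmat g v x)"
    using * by (intro eq_matI) (simp_all add: bform_def dims del: index_mult_mat(1))
  finally show ?thesis .
qed

text \<open>The \<open>sym_part\<close> summand is symmetric by construction, so only the derivative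
  of \<open>B\<close> has to be examined.\<close>

lemma dform_symmetric:
  fixes A B :: "'a::real_normed_vector \<Rightarrow> real mat"
  assumes A: "smooth_mat m d U A" and B: "smooth_mat d d U B" and x: "x \<in> U" and e: "\<epsilon> > 0"
    and Sym: "\<And>\<sigma>. \<bar>\<sigma>\<bar> < \<epsilon> \<Longrightarrow> B (x + \<sigma> *\<^sub>R v) \<in> Sym d"
  shows "(dform L (A x) (dmat A v x) (dmat B v x))\<^sup>T = dform L (A x) (dmat A v x) (dmat B v x)"
proof -
  have "dmat (\<lambda>y. (B y)\<^sup>T) v x = dmat B v x"
    using Sym by (intro dmat_eq_along[OF smooth_mat_transpose[OF B] x B x e]) (auto simp: Sym_iff)
  then have "(dmat B v x)\<^sup>T = dmat B v x" by (simp add: dmat_transpose[OF B x])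
  then show ?thesis
    by (simp add: dform_def mat_expand transpose_sym_part smooth_matD[OF A] smooth_matD[OF B])
qed

text \<open>The factor 1/2 in the third component of \<open>to_identity_G\<close> turns
  \<open>2 Tr (B * B)\<close> into \<open>Tr (D * D) / 2\<close>, which matches
  \<open>energy_density\<close>.\<close>

lemma metric_eq:
  assumes p: "(g, A, B) \<in> carrier G"
    and u: "u1 \<in> carrier_mat m m" "u2 \<in> carrier_mat m d" "u3 \<in> carrier_mat d d"
  shows "(1 / 2) * left_invariant_metric G (lagrangian_form K) (g, A, B) (u1, u2, u3) (u1, u2, u3) =
    1 / 2 * frob (bform L g u1) (bform L g u1) + frob (bform L g u2) (bform L g u2)
      + 1 / 2 * frob ((dform L A u2 u3)\<^sup>T) (dform L A u2 u3)"
proof -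
  have g: "g \<in> Sp m (- L)" and c: "g \<in> carrier_mat m m" "A \<in> carrier_mat m d"
    using p by (auto simp: carrier_G Sp_iff)
  have D: "dform L A u2 u3 \<in> carrier_mat d d"
    using c u by (auto simp: dform_def)
  have X: "sp_inv g * u1 \<in> carrier_mat m m" "sp_inv g * u2 \<in> carrier_mat m d"
      "(1 / 2) \<cdot>\<^sub>m dform L A u2 u3 \<in> carrier_mat d d"
    using sp_inv(1)[OF g] u D by auto
  show ?thesis
    unfolding left_invariant_metric_def to_identity_G[OF p u] lagrangian_eq_form[OF X, symmetric]
      lagrangian_K[OF X] L_sp_inv[OF c(1) u(1)] L_sp_inv[OF c(1) u(2)]
    using D by (simp add: mat_transpose_smult frob_simps)
qed

end

section \<open>A curve in the group and its variations\<close>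

locale jacobi_curve = jacobi +
  fixes I :: "real set" and \<gamma> :: "real \<Rightarrow> triple"
  assumes I: "open I" and smooth: "smooth_triple_on m d I \<gamma>" and in_G: "\<And>t. t \<in> I \<Longrightarrow> \<gamma> t \<in> carrier G"
begin

definition g where "g t = trunc m m (fst (\<gamma> t))"
definition A where "A t = trunc m d (fst (snd (\<gamma> t)))"
definition B where "B t = trunc d d (snd (snd (\<gamma> t)))"

definition S where "S t = bform L (g t) (dmat g 1 t)"
definition T where "T t = bform L (g t) (dmat A 1 t)"
definition D where "D t = dform L (A t) (dmat A 1 t) (dmat B 1 t)"

text \<open>The blocks of \<open>X' - [X\<^sup>2, N]\<close>; the lower left one is the transpose of \<open>RT\<close>.\<close>

definition RS where "RS t = dmat S 1 t - ((S t * S t + T t * (T t)\<^sup>T) * K - K * (S t * S t + T t * (T t)\<^sup>T))"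
definition RT where "RT t = dmat T 1 t + K * (S t * T t + T t * D t)"
definition RD where "RD t = dmat D 1 t"

lemma smooth_gAB: "smooth_mat m m I g" "smooth_mat m d I A" "smooth_mat d d I B"
  unfolding g_def[abs_def] A_def[abs_def] B_def[abs_def] by (rule smooth_triple_trunc[OF smooth])+

lemma gamma_eq: "t \<in> I \<Longrightarrow> \<gamma> t = (g t, A t, B t)"
  using in_G[of t] by (cases "\<gamma> t") (auto simp: carrier_G Sp_iff Sym_iff g_def A_def B_def trunc_id)

lemma gAB_in_G:
  "t \<in> I \<Longrightarrow> (g t, A t, B t) \<in> carrier G" "t \<in> I \<Longrightarrow> g t \<in> Sp m (- L)" "t \<in> I \<Longrightarrow> B t \<in> Sym d"
  using in_G[of t] gamma_eq[of t] by (auto simp: carrier_G)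

lemma smooth_STD: "smooth_mat m m I S" "smooth_mat m d I T" "smooth_mat d d I D"
  unfolding S_def[abs_def] T_def[abs_def] D_def[abs_def]
  by (intro smooth_mat_bform[OF I L] smooth_mat_dform[OF I L] smooth_mat_dmat smooth_gAB)+

lemma smooth_R: "smooth_mat m m I RS" "smooth_mat m d I RT" "smooth_mat d d I RD"
proof -
  note mult = smooth_mat_mult[OF I]
  note sm = smooth_STD
  note K' = smooth_mat_const[OF K, of I]
  have Q: "smooth_mat m m I (\<lambda>x. S x * S x + T x * (T x)\<^sup>T)"
    by (intro smooth_mat_add I mult[OF sm(1) sm(1)] mult[OF sm(2) smooth_mat_transpose[OF sm(2)]])
  have W: "smooth_mat m d I (\<lambda>x. S x * T x + T x * D x)"
    by (intro smooth_mat_add I mult[OF sm(1) sm(2)] mult[OF sm(2) sm(3)])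
  show "smooth_mat m m I RS" unfolding RS_def[abs_def]
    by (intro smooth_mat_minus I smooth_mat_dmat sm mult[OF Q K'] mult[OF K' Q])
  show "smooth_mat m d I RT" unfolding RT_def[abs_def]
    by (intro smooth_mat_add I smooth_mat_dmat sm mult[OF K' W])
  show "smooth_mat d d I RD" unfolding RD_def[abs_def]
    by (intro smooth_mat_dmat sm)
qed

lemma symmetric_nbhd:
  assumes "t \<in> I"
  obtains \<epsilon> where "\<epsilon> > 0" "\<And>\<sigma>. \<bar>\<sigma>\<bar> < \<epsilon> \<Longrightarrow> t + \<sigma> *\<^sub>R 1 \<in> I"
proof -
  obtain \<epsilon> where "\<epsilon> > 0" "ball t \<epsilon> \<subseteq> I" using I assms open_contains_ball by metis
  then show ?thesis by (intro that[of \<epsilon>]) (auto simp: dist_real_def)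
qed

lemma S_symmetric: "t \<in> I \<Longrightarrow> (S t)\<^sup>T = S t"
  unfolding S_def by (rule symmetric_nbhd, assumption) (rule bform_symmetric[OF I smooth_gAB(1)], auto intro: gAB_in_G)

lemma D_symmetric: "t \<in> I \<Longrightarrow> (D t)\<^sup>T = D t"
  unfolding D_def by (rule symmetric_nbhd, assumption) (rule dform_symmetric[OF smooth_gAB(2,3)], auto intro: gAB_in_G)

text \<open>The commutator of a symmetric and an antisymmetric matrix is symmetric. This is needed
  because test matrices \<open>v v\<^sup>T\<close> detect only symmetric parts.\<close>

lemma RS_symmetric: "t \<in> I \<Longrightarrow> (RS t)\<^sup>T = RS t"
proof -
  assume t: "t \<in> I"
  have 1: "(dmat S 1 t)\<^sup>T = dmat S 1 t"
    using dmat_cong[OF I t _ smooth_STD(1) t, of "\<lambda>t. (S t)\<^sup>T" 1] dmat_transpose[OF smooth_STD(1) t] S_symmetric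
    by simp
  define Q where "Q = S t * S t + T t * (T t)\<^sup>T"
  note dims = smooth_matD(2,3)[OF smooth_STD(1)] smooth_matD(2,3)[OF smooth_STD(2)]
    K[THEN carrier_matD(1)] K[THEN carrier_matD(2)]
  have Q: "dim_row Q = m" "dim_col Q = m" "Q\<^sup>T = Q"
    unfolding Q_def using S_symmetric[OF t] by (simp_all add: dims mat_expand)
  have "(Q * K - K * Q)\<^sup>T = Q * K - K * Q"
    using Q by (simp add: dims mat_expand K_antisym)
      (intro eq_matI, simp_all add: dims del: index_mult_mat(1))
  then show ?thesis
    unfolding RS_def Q_def[symmetric] using Q 1 by (simp add: dims mat_transpose_minus_dim)
qed

lemma RD_symmetric: "t \<in> I \<Longrightarrow> (RD t)\<^sup>T = RD t"
  using dmat_cong[OF I _ _ smooth_STD(3), of t "\<lambda>t. (D t)\<^sup>T" 1] dmat_transpose[OF smooth_STD(3), of t] D_symmetric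
  by (simp add: RD_def)

abbreviation "met \<equiv> left_invariant_metric G (lagrangian_form K)"

text \<open>The components of the variation field, the \<open>s\<close>-derivative of the variation
  at \<open>s = 0\<close>.\<close>

definition vg where "vg \<Gamma> t = dmat (\<lambda>x. trunc m m (fst (\<Gamma> (fst x) (snd x)))) (1, 0) (0, t)"
definition vA where "vA \<Gamma> t = dmat (\<lambda>x. trunc m d (fst (snd (\<Gamma> (fst x) (snd x))))) (1, 0) (0, t)"
definition vB where "vB \<Gamma> t = dmat (\<lambda>x. trunc d d (snd (snd (\<Gamma> (fst x) (snd x))))) (1, 0) (0, t)"

definition R where
  "R \<Gamma> t = frob (RS t) (bform L (g t) (vg \<Gamma> t)) + 2 * frob (RT t) (bform L (g t) (vA \<Gamma> t))
    + frob (RD t) (dform L (A t) (vA \<Gamma> t) (vB \<Gamma> t))"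

text \<open>An instance of \<open>first_variation\<close> for the truncated extension of the
  variation: on the strip it coincides with group elements, and at \<open>s = 0\<close> with the
  curve.\<close>

lemma energy_derivative:
  assumes ab: "a < b" "{a..b} \<subseteq> I" and var: "proper_variation m d (carrier G) \<gamma> a b \<epsilon> \<Gamma>"
  shows "((\<lambda>s. energy met a b (\<Gamma> s)) has_real_derivative - integral {a..b} (R \<Gamma>)) (at 0)"
proof -
  obtain U where e: "\<epsilon> > 0" and U: "open U" "{-\<epsilon><..<\<epsilon>} \<times> {a..b} \<subseteq> U"
    and sm: "smooth_triple_on m d U (\<lambda>(s, t). \<Gamma> s t)"
    and GG: "\<And>s t. s \<in> {-\<epsilon><..<\<epsilon>} \<Longrightarrow> t \<in> {a..b} \<Longrightarrow> \<Gamma> s t \<in> carrier G"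
    and ends: "\<And>s. s \<in> {-\<epsilon><..<\<epsilon>} \<Longrightarrow> \<Gamma> s a = \<gamma> a" "\<And>s. s \<in> {-\<epsilon><..<\<epsilon>} \<Longrightarrow> \<Gamma> s b = \<gamma> b"
    and G0: "\<And>t. t \<in> {a..b} \<Longrightarrow> \<Gamma> 0 t = \<gamma> t"
    using var unfolding proper_variation_def by blast
  define gF where "gF = (\<lambda>x. trunc m m (fst (\<Gamma> (fst x) (snd x))))"
  define AF where "AF = (\<lambda>x. trunc m d (fst (snd (\<Gamma> (fst x) (snd x)))))"
  define BF where "BF = (\<lambda>x. trunc d d (snd (snd (\<Gamma> (fst x) (snd x)))))"
  have smF: "smooth_mat m m U gF" "smooth_mat m d U AF" "smooth_mat d d U BF"
    using smooth_triple_trunc[OF sm] by (simp_all add: gF_def AF_def BF_def case_prod_unfold)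
  interpret F: jacobi_family m d K L U gF AF BF
    by unfold_locales (rule U smF)+
  have in_U: "(s, t) \<in> U" if "s \<in> {-\<epsilon><..<\<epsilon>}" "t \<in> {a..b}" for s t using U(2) that by auto
  have in_U0: "(0, t) \<in> U" if "t \<in> {a..b}" for t using in_U that e by auto
  have GF: "\<Gamma> s t = (gF (s, t), AF (s, t), BF (s, t))" if "s \<in> {-\<epsilon><..<\<epsilon>}" "t \<in> {a..b}" for s t
    using GG[OF that] by (cases "\<Gamma> s t") (auto simp: carrier_G Sp_iff Sym_iff gF_def AF_def BF_def trunc_id)
  have FG: "(gF (s, t), AF (s, t), BF (s, t)) \<in> carrier G" if "s \<in> {-\<epsilon><..<\<epsilon>}" "t \<in> {a..b}" for s t
    using GG[OF that] GF[OF that] by simp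
  then have Sp: "gF (s, t) \<in> Sp m (- L)" and Sy: "BF (s, t) \<in> Sym d" if "s \<in> {-\<epsilon><..<\<epsilon>}" "t \<in> {a..b}" for s t
    using that by (auto simp: carrier_G)
  have abs_in: "\<sigma> \<in> {-\<epsilon><..<\<epsilon>}" if "\<bar>\<sigma>\<bar> < \<epsilon>" for \<sigma> using that by auto
  have base: "gF (0, t) = g t" "AF (0, t) = A t" "BF (0, t) = B t" if "t \<in> {a..b}" for t
    using GF[of 0 t] e that G0[OF that] gamma_eq[of t] ab by auto
  have energy: "energy met a b (\<Gamma> s) = integral {a..b} (\<lambda>t. F.energy_density (s, t))" if s: "s \<in> {-\<epsilon><..<\<epsilon>}" for s
    unfolding energy_def
  proof (rule integral_cong)
    fix t assume t: "t \<in> {a..b}"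
    \<comment> \<open>Valid at the end times too: both sides differentiate the same extension, and
      group membership is used at the point \<open>(s, t)\<close> only.\<close>
    have "velocity (\<Gamma> s) t = (dmat gF (0, 1) (s, t), dmat AF (0, 1) (s, t), dmat BF (0, 1) (s, t))"
    proof -
      have c: "fst (\<Gamma> s t) \<in> carrier_mat m m" "fst (snd (\<Gamma> s t)) \<in> carrier_mat m d" "snd (snd (\<Gamma> s t)) \<in> carrier_mat d d"
        using GG[OF s t] by (auto simp: carrier_G Sp_iff Sym_iff)
      show ?thesis
        unfolding velocity_def dmat_slice_snd[OF smF(1) in_U[OF s t], symmetric]
          dmat_slice_snd[OF smF(2) in_U[OF s t], symmetric] dmat_slice_snd[OF smF(3) in_U[OF s t], symmetric]
        unfolding gF_def AF_def BF_def fst_conv snd_conv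
        using mat_deriv_trunc[of "\<lambda>\<tau>. fst (\<Gamma> s \<tau>)", OF c(1)] mat_deriv_trunc[of "\<lambda>\<tau>. fst (snd (\<Gamma> s \<tau>))", OF c(2)]
          mat_deriv_trunc[of "\<lambda>\<tau>. snd (snd (\<Gamma> s \<tau>))", OF c(3)]
        by simp
    qed
    then show "1 / 2 * met (\<Gamma> s t) (velocity (\<Gamma> s) t) (velocity (\<Gamma> s) t) = F.energy_density (s, t)"
      unfolding F.energy_density_def F.S_def F.T_def F.D_def GF[OF s t]
      using metric_eq[OF FG[OF s t] dmat_carrier[OF smF(1)] dmat_carrier[OF smF(2)] dmat_carrier[OF smF(3)]]
      by simp
  qed
  \<comment> \<open>An interior time leaves room for a two-sided time segment on which the family at
    \<open>s = 0\<close> is the curve.\<close>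
  have time: "dmat H (0, 1) (0, t) = dmat h 1 t"
    if "smooth_mat r c U H" "smooth_mat r c I h" "\<And>t. t \<in> {a<..<b} \<Longrightarrow> H (0, t) = h t" "t \<in> {a<..<b}"
    for r c H h t
  proof (rule dmat_eq_along[OF that(1) in_U0 that(2)])
    show "min (t - a) (b - t) > 0" using that(4) by simp
    show "H ((0, t) + \<sigma> *\<^sub>R (0, 1)) = h (t + \<sigma> *\<^sub>R 1)" if "\<bar>\<sigma>\<bar> < min (t - a) (b - t)" for \<sigma>
      using \<open>\<And>t. t \<in> {a<..<b} \<Longrightarrow> H (0, t) = h t\<close>[of "t + \<sigma>"] that by (auto simp: abs_less_iff)
  qed (use that(4) ab in auto)
  have STD: "F.S (0, t) = S t" "F.T (0, t) = T t" "F.D (0, t) = D t" if "t \<in> {a<..<b}" for t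
    using time[OF smF(1) smooth_gAB(1) _ that] time[OF smF(2) smooth_gAB(2) _ that] time[OF smF(3) smooth_gAB(3) _ that]
      base that by (simp_all add: F.S_def F.T_def F.D_def S_def T_def D_def)
  have residual: "F.residual (0, t) = R \<Gamma> t" if t: "t \<in> {a<..<b}" for t
  proof -
    have "dmat F.S (0, 1) (0, t) = dmat S 1 t" "dmat F.T (0, 1) (0, t) = dmat T 1 t" "dmat F.D (0, 1) (0, t) = dmat D 1 t"
      using time[OF F.smooth_blocks(1) smooth_STD(1) STD(1) t] time[OF F.smooth_blocks(2) smooth_STD(2) STD(2) t]
        time[OF F.smooth_blocks(3) smooth_STD(3) STD(3) t] by blast+
    then show ?thesis
      using t by (simp add: F.residual_def R_def RS_def RT_def RD_def STD F.S'_def F.T'_def F.D'_def base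
        vg_def vA_def vB_def gF_def[symmetric] AF_def[symmetric] BF_def[symmetric])
  qed
  have "((\<lambda>s. integral {a..b} (\<lambda>t. F.energy_density (s, t))) has_real_derivative
    - integral {a..b} (\<lambda>t. F.residual (0, t))) (at 0)"
  proof (rule F.first_variation[OF e ab(1) U(2)])
    fix t assume t: "t \<in> {a<..<b}"
    then have tI: "t \<in> I" "t \<in> {a..b}" using ab by auto
    show "gF (0, t) * (K * (gF (0, t))\<^sup>T) = K"
      unfolding base(1)[OF tI(2)] by (rule sp_inv(4)[OF gAB_in_G(2)[OF tI(1)]])
    \<comment> \<open>In the time direction symmetry is inherited from the curve; in the parameter
      direction the segment at fixed \<open>t\<close> stays inside the strip.\<close>
    show "(F.S (0, t))\<^sup>T = F.S (0, t)" "(F.D (0, t))\<^sup>T = F.D (0, t)"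
      using STD[OF t] S_symmetric[OF tI(1)] D_symmetric[OF tI(1)] by simp_all
    show "(F.S' (0, t))\<^sup>T = F.S' (0, t)"
      unfolding F.S'_def by (rule bform_symmetric[OF U(1) smF(1) in_U0[OF tI(2)] e]) (use Sp[OF abs_in tI(2)] in simp)
  next
    \<comment> \<open>Fixed endpoints make the family constant in \<open>s\<close> there, so every
      block of \<open>H\<close> vanishes.\<close>
    have "F.momentum_pairing (0, t) = 0" if t: "t \<in> {a..b}" and fixed: "\<And>s. s \<in> {-\<epsilon><..<\<epsilon>} \<Longrightarrow> \<Gamma> s t = \<gamma> t" for t
    proof -
      have z: "dmat H (1, 0) (0, t) = 0\<^sub>m r c"
        if H: "smooth_mat r c U H" "\<And>s. s \<in> {-\<epsilon><..<\<epsilon>} \<Longrightarrow> H (s, t) = H (0, t)" for r c H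
      proof -
        have c: "smooth_mat r c U (\<lambda>x. H (0, t))"
          by (rule smooth_mat_const[OF smooth_matD(1)[OF H(1)]])
        have "dmat H (1, 0) (0, t) = dmat (\<lambda>x. H (0, t)) (1, 0) (0::real, t)"
          by (rule dmat_eq_along[OF H(1) in_U0[OF t] c in_U0[OF t] e]) (simp, rule H(2)[OF abs_in])
        then show ?thesis by (simp add: dmat_const smooth_matD[OF H(1)])
      qed
      have "gF (s, t) = gF (0, t)" "AF (s, t) = AF (0, t)" "BF (s, t) = BF (0, t)" if "s \<in> {-\<epsilon><..<\<epsilon>}" for s
        using fixed[OF that] fixed[of 0] e by (simp_all add: gF_def AF_def BF_def)
      then have z3: "dmat gF (1, 0) (0, t) = 0\<^sub>m m m" "dmat AF (1, 0) (0, t) = 0\<^sub>m m d" "dmat BF (1, 0) (0, t) = 0\<^sub>m d d"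
        using z[OF smF(1)] z[OF smF(2)] z[OF smF(3)] by blast+
      have "bform L (gF (0, t)) (0\<^sub>m m m) = 0\<^sub>m m m" "bform L (gF (0, t)) (0\<^sub>m m d) = 0\<^sub>m m d"
        "dform L (AF (0, t)) (0\<^sub>m m d) (0\<^sub>m d d) = 0\<^sub>m d d"
        using L smooth_matD[OF smF(1)] smooth_matD[OF smF(2)]
        by (simp_all add: bform_def dform_def mat_expand F.block_dims)
      then have "F.S' (0, t) = 0\<^sub>m m m" "F.T' (0, t) = 0\<^sub>m m d" "F.D' (0, t) = 0\<^sub>m d d"
        unfolding F.S'_def F.T'_def F.D'_def z3 by simp_all
      then show ?thesis unfolding F.momentum_pairing_def by (simp add: frob_zero_right F.block_dims)
    qed
    then show "F.momentum_pairing (0, a) = 0" "F.momentum_pairing (0, b) = 0" using ends ab by auto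
  qed
  moreover have "integral {a..b} (\<lambda>t. F.residual (0, t)) = integral {a..b} (R \<Gamma>)"
    by (rule integral_spike[of "{a, b}"]) (use residual in auto)
  ultimately have "((\<lambda>s. integral {a..b} (\<lambda>t. F.energy_density (s, t))) has_real_derivative - integral {a..b} (R \<Gamma>)) (at 0)"
    by simp
  then show ?thesis
    by (rule has_field_derivative_transform_within_open[of _ _ _ "{-\<epsilon><..<\<epsilon>}"]) (use e energy in auto)
qed

end

section \<open>Test variations\<close>

lemma dmat_affine_family:
  fixes F W :: "real \<Rightarrow> real mat"
  assumes sm: "smooth_mat r c U (\<lambda>x. F (snd x) + (fst x * \<phi> (snd x)) \<cdot>\<^sub>m W (snd x))"
    and x: "(0::real, t) \<in> U" and c: "F t \<in> carrier_mat r c" "W t \<in> carrier_mat r c"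
  shows "dmat (\<lambda>x. F (snd x) + (fst x * \<phi> (snd x)) \<cdot>\<^sub>m W (snd x)) (1, 0) (0::real, t) = \<phi> t \<cdot>\<^sub>m W t"
proof -
  have W: "\<phi> t \<cdot>\<^sub>m W t \<in> carrier_mat r c" using c by simp
  have H: "smooth_mat r c UNIV (\<lambda>\<sigma>::real. F t + \<sigma> \<cdot>\<^sub>m (\<phi> t \<cdot>\<^sub>m W t))"
    by (intro smooth_mat_add smooth_mat_smult_fun smooth_mat_const open_UNIV c W
      smooth_on_bounded_linear[OF bounded_linear_ident])
  have "dmat (\<lambda>x. F (snd x) + (fst x * \<phi> (snd x)) \<cdot>\<^sub>m W (snd x)) (1, 0) (0::real, t) =
    dmat (\<lambda>\<sigma>. F t + \<sigma> \<cdot>\<^sub>m (\<phi> t \<cdot>\<^sub>m W t)) 1 (0::real)"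
  proof (rule dmat_eq_along[OF sm x H, where \<epsilon> = 1])
    show "F (snd ((0, t) + \<sigma> *\<^sub>R (1, 0))) +
        (fst ((0, t) + \<sigma> *\<^sub>R (1, 0)) * \<phi> (snd ((0, t) + \<sigma> *\<^sub>R (1, 0)))) \<cdot>\<^sub>m W (snd ((0, t) + \<sigma> *\<^sub>R (1, 0))) =
      F t + (0 + \<sigma> *\<^sub>R 1) \<cdot>\<^sub>m (\<phi> t \<cdot>\<^sub>m W t)" for \<sigma> :: real
      using c by (intro eq_matI) auto
  qed simp_all
  also have "dmat (\<lambda>\<sigma>. F t + \<sigma> \<cdot>\<^sub>m (\<phi> t \<cdot>\<^sub>m W t)) 1 (0::real) = \<phi> t \<cdot>\<^sub>m W t"
    using mat_deriv_eq_dmat[OF H UNIV_I, of 0] mat_deriv_affine[OF c(1) W, of 0] by simp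
  finally show ?thesis .
qed

context jacobi
begin

text \<open>\<open>V K V\<close> is \<open>v v\<^sup>T\<close> times the scalar
  \<open>v\<^sup>T K v\<close>, and this scalar equals its own negative because \<open>K\<close> is
  antisymmetric.\<close>

lemma rank_one_isotropic:
  fixes v :: "nat \<Rightarrow> real"
  defines "V \<equiv> mat m m (\<lambda>(i, j). v i * v j)"
  shows "V \<in> carrier_mat m m" "V\<^sup>T = V" "V * (K * V) = 0\<^sub>m m m"
proof -
  show V: "V \<in> carrier_mat m m" by (simp add: V_def)
  show "V\<^sup>T = V" by (rule eq_matI) (auto simp: V_def)
  note dims = V[THEN carrier_matD(1)] V[THEN carrier_matD(2)] K[THEN carrier_matD(1)] K[THEN carrier_matD(2)]
  define q where "q = (\<Sum>k<m. \<Sum>l<m. v k * K $$ (k, l) * v l)"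
  have Kanti: "K $$ (l, k) = - K $$ (k, l)" if "k < m" "l < m" for k l
  proof -
    have "K $$ (l, k) = K\<^sup>T $$ (k, l)" using that dims by simp
    then show ?thesis unfolding K_antisym using that dims by simp
  qed
  have "q = (\<Sum>l<m. \<Sum>k<m. v k * K $$ (k, l) * v l)" unfolding q_def by (rule sum.swap)
  also have "\<dots> = (\<Sum>l<m. \<Sum>k<m. - (v l * K $$ (l, k) * v k))"
  proof (intro sum.cong refl)
    fix l k assume "l \<in> {..<m}" "k \<in> {..<m}"
    then show "v k * K $$ (k, l) * v l = - (v l * K $$ (l, k) * v k)" using Kanti[of k l] by simp
  qed
  also have "\<dots> = - q" by (simp add: q_def sum_negf)
  finally have q: "q = 0" by simp
  show "V * (K * V) = 0\<^sub>m m m"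
  proof (rule eq_matI)
    fix i j assume "i < dim_row (0\<^sub>m m m)" "j < dim_col (0\<^sub>m m m)"
    then have ij: "i < m" "j < m" by simp_all
    have "(V * (K * V)) $$ (i, j) = (\<Sum>k<m. v i * v k * (\<Sum>l<m. K $$ (k, l) * (v l * v j)))"
      using ij by (simp del: index_mult_mat(1) add: index_mult_mat_sum dims) (simp add: V_def)
    also have "\<dots> = v i * v j * q"
      unfolding q_def sum_distrib_left by (intro sum.cong refl) (simp add: mult_ac)
    finally show "(V * (K * V)) $$ (i, j) = 0\<^sub>m m m $$ (i, j)" using q ij by simp
  qed (simp_all add: dims)
qed

text \<open>In the expansion of the symplectic condition the terms linear in \<open>u\<close> are
  \<open>V\<close> and \<open>- V\<close>, and the quadratic term is a multiple of
  \<open>V K V\<close>.\<close>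

lemma transvection_Sp:
  assumes V: "V \<in> carrier_mat m m" "V\<^sup>T = V" "V * (K * V) = 0\<^sub>m m m"
  shows "1\<^sub>m m + u \<cdot>\<^sub>m (K * V) \<in> Sp m (- L)"
proof -
  note dims = V(1)[THEN carrier_matD(1)] V(1)[THEN carrier_matD(2)]
    K[THEN carrier_matD(1)] K[THEN carrier_matD(2)] L[THEN carrier_matD(1)] L[THEN carrier_matD(2)]
  have 1: "L * (K * V) = V"
    using V by (simp add: LK dims mat_mult_assoc_dim[symmetric])
  have 2: "V * (K * L) = V" unfolding KL using V by simp
  have 3: "V * (K * (L * (K * V))) = 0\<^sub>m m m" unfolding 1 by (rule V(3))
  have "(1\<^sub>m m + u \<cdot>\<^sub>m (K * V))\<^sup>T * (L * (1\<^sub>m m + u \<cdot>\<^sub>m (K * V))) = L"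
    by (simp add: mat_expand dims K_antisym V(2) 1 2 V(3))
      (intro eq_matI, simp_all add: dims del: index_mult_mat(1))
  then show ?thesis using V K by (simp add: Sp_iff)
qed

end

context jacobi_curve
begin

lemma geodesic_if_residuals_zero:
  assumes "\<And>t. t \<in> I \<Longrightarrow> RS t = 0\<^sub>m m m \<and> RT t = 0\<^sub>m m d \<and> RD t = 0\<^sub>m d d"
  shows "geodesic_on m d (carrier G) met I \<gamma>"
  unfolding geodesic_on_def
proof (intro conjI allI impI ballI)
  fix a b \<epsilon> \<Gamma>
  assume *: "a < b \<and> {a..b} \<subseteq> I \<and> proper_variation m d (carrier G) \<gamma> a b \<epsilon> \<Gamma>"
  have "integral {a..b} (R \<Gamma>) = integral {a..b} (\<lambda>_. 0)"
    by (rule integral_cong) (use * assms in \<open>auto simp: R_def frob_zero_left\<close>)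
  then show "((\<lambda>s. energy met a b (\<Gamma> s)) has_real_derivative 0) (at 0)"
    using energy_derivative[of a b \<epsilon> \<Gamma>] * by simp
qed (use smooth in_G in auto)

context
  fixes V1 V2 V3 :: "real mat" and a b :: real
  assumes V: "V1 \<in> carrier_mat m m" "V2 \<in> carrier_mat m d" "V3 \<in> carrier_mat d d"
    and V1: "V1\<^sup>T = V1" "V1 * (K * V1) = 0\<^sub>m m m" and V3: "V3\<^sup>T = V3"
    and ab: "a < b" "{a..b} \<subseteq> I"
begin

text \<open>Zero at both ends, so the endpoints stay fixed, and positive between them.\<close>

definition \<phi> where "\<phi> t = (t - a) * (b - t)"
text \<open>\<open>W1\<close>, \<open>W2\<close>, \<open>W3\<close> form the tangent vector at the
  curve whose translate to the identity has the blocks \<open>V1\<close>, \<open>V2\<close>,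
  \<open>V3\<close> in \<open>X\<close>; \<open>W3\<close> solves
  \<open>dform L A W2 W3 = V3\<close>.\<close>

definition W1 where "W1 t = g t * (K * V1)"
definition W2 where "W2 t = g t * (K * V2)"
definition W3 where "W3 t = (1 / 2) \<cdot>\<^sub>m (V3 - sym_part (bform L (A t) (W2 t)))"

text \<open>
  The variation is \<open>\<gamma>(t)\<close> times \<open>(1 + u K V1, u K V2, u/2 V3)\<close> with \<open>u = s \<phi>(t)\<close>. The
  condition \<open>V1 K V1 = 0\<close> makes the first component symplectic, so that no exponential is needed.
\<close>

definition \<Gamma>\<^sub>V :: "real \<Rightarrow> real \<Rightarrow> triple" where
  "\<Gamma>\<^sub>V s t = (g t + (s * \<phi> t) \<cdot>\<^sub>m W1 t, A t + (s * \<phi> t) \<cdot>\<^sub>m W2 t, B t + (s * \<phi> t) \<cdot>\<^sub>m W3 t)"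

lemma smooth_W: "smooth_mat m m I W1" "smooth_mat m d I W2" "smooth_mat d d I W3"
proof -
  have KV: "K * V1 \<in> carrier_mat m m" "K * V2 \<in> carrier_mat m d" using K V by auto
  show "smooth_mat m m I W1"
    unfolding W1_def[abs_def] by (rule smooth_mat_mult[OF I smooth_gAB(1) smooth_mat_const[OF KV(1)]])
  show W2: "smooth_mat m d I W2"
    unfolding W2_def[abs_def] by (rule smooth_mat_mult[OF I smooth_gAB(1) smooth_mat_const[OF KV(2)]])
  show "smooth_mat d d I W3"
    unfolding W3_def[abs_def]
    by (intro smooth_mat_smult smooth_mat_minus smooth_mat_sym_part smooth_mat_const
      smooth_mat_bform[OF I L smooth_gAB(2) W2] I V)
qed

lemma smooth_parameter: "smooth_on (UNIV \<times> I) (\<lambda>x::real \<times> real. fst x * \<phi> (snd x))"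
proof -
  have o: "open (UNIV \<times> I :: (real \<times> real) set)" using I by (simp add: open_Times)
  \<comment> \<open>Rewritten with sums and products only, for which smoothness rules are at
    hand.\<close>
  have e: "(\<lambda>x::real \<times> real. fst x * \<phi> (snd x)) = (\<lambda>x. fst x * ((snd x + - a) * (b + (-1) * snd x)))"
    by (auto simp: \<phi>_def)
  show ?thesis
    unfolding e by (intro smooth_on_mult smooth_on_add o smooth_on_const smooth_on_bounded_linear
      bounded_linear_fst bounded_linear_snd)
qed

lemma smooth_family:
  assumes "smooth_mat r c I F" "smooth_mat r c I W"
  shows "smooth_mat r c (UNIV \<times> I) (\<lambda>x::real \<times> real. F (snd x) + (fst x * \<phi> (snd x)) \<cdot>\<^sub>m W (snd x))"
proof -
  have o: "open (UNIV \<times> I :: (real \<times> real) set)" using I by (simp add: open_Times)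
  show ?thesis
    by (intro smooth_mat_add smooth_mat_smult_fun o smooth_parameter smooth_mat_compose_snd I assms)
qed

lemma \<Gamma>\<^sub>V_in_G:
  assumes t: "t \<in> I"
  shows "\<Gamma>\<^sub>V s t \<in> carrier G"
proof -
  define u where "u = s * \<phi> t"
  have c: "g t \<in> carrier_mat m m" "A t \<in> carrier_mat m d" "B t \<in> carrier_mat d d"
    using smooth_gAB[THEN smooth_matD(1)] by blast+
  note dims = c[THEN carrier_matD(1)] c[THEN carrier_matD(2)] V[THEN carrier_matD(1)] V[THEN carrier_matD(2)]
    K[THEN carrier_matD(1)] K[THEN carrier_matD(2)] L[THEN carrier_matD(1)] L[THEN carrier_matD(2)]
  let ?e = "(1\<^sub>m m + u \<cdot>\<^sub>m (K * V1), u \<cdot>\<^sub>m (K * V2), (u / 2) \<cdot>\<^sub>m V3)"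
  have "?e \<in> carrier G"
    using transvection_Sp[OF V(1) V1, of u] V V3 K by (auto simp: carrier_G Sym_iff mat_transpose_smult)
  then have "(g t, A t, B t) \<otimes>\<^bsub>G\<^esub> ?e \<in> carrier G"
    using group.is_monoid[OF group_G] gAB_in_G(1)[OF t] by (simp add: monoid.m_closed)
  moreover have "(g t, A t, B t) \<otimes>\<^bsub>G\<^esub> ?e = \<Gamma>\<^sub>V s t"
  proof -
    have 1: "g t * (1\<^sub>m m + u \<cdot>\<^sub>m (K * V1)) = g t + u \<cdot>\<^sub>m W1 t"
      using c by (simp add: W1_def mat_expand dims)
    have 2: "A t + g t * (u \<cdot>\<^sub>m (K * V2)) = A t + u \<cdot>\<^sub>m W2 t"
      by (simp add: W2_def mat_expand dims)
    have e: "(A t)\<^sup>T * (- L) * g t * (u \<cdot>\<^sub>m (K * V2)) = (- u) \<cdot>\<^sub>m bform L (A t) (W2 t)"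
      by (simp add: bform_def W2_def mat_expand dims) (intro eq_matI, simp_all add: dims del: index_mult_mat(1))
    \<comment> \<open>\<open>W3\<close> is exactly the coefficient of \<open>u\<close> in the last
      component of the product, including the cocycle term.\<close>
    have 3: "B t + (u / 2) \<cdot>\<^sub>m V3 + (1 / 2) \<cdot>\<^sub>m sym_part ((- u) \<cdot>\<^sub>m bform L (A t) (W2 t)) = B t + u \<cdot>\<^sub>m W3 t"
      unfolding W3_def
      by (intro eq_matI) (simp_all add: sym_part_smult bform_def W2_def dims field_simps del: index_mult_mat(1))
    show ?thesis
      unfolding mult_G jac_mult.simps e 1 2 3 \<Gamma>\<^sub>V_def u_def[symmetric] ..
  qed
  ultimately show ?thesis by simp
qed

lemma smooth_\<Gamma>\<^sub>V: "smooth_triple_on m d (UNIV \<times> I) (\<lambda>(s, t). \<Gamma>\<^sub>V s t)"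
  using smooth_matD(4)[OF smooth_family[OF smooth_gAB(1) smooth_W(1)]]
    smooth_matD(4)[OF smooth_family[OF smooth_gAB(2) smooth_W(2)]]
    smooth_matD(4)[OF smooth_family[OF smooth_gAB(3) smooth_W(3)]]
  by (simp add: smooth_triple_on_def \<Gamma>\<^sub>V_def case_prod_unfold)

lemma \<Gamma>\<^sub>V_base: "t \<in> I \<Longrightarrow> s * \<phi> t = 0 \<Longrightarrow> \<Gamma>\<^sub>V s t = \<gamma> t"
proof -
  assume t: "t \<in> I" "s * \<phi> t = 0"
  have "M + 0 \<cdot>\<^sub>m W = M" if "M \<in> carrier_mat r c" "W \<in> carrier_mat r c" for M W :: "real mat" and r c
    using that by (intro eq_matI) auto
  from this[OF smooth_matD(1)[OF smooth_gAB(1)] smooth_matD(1)[OF smooth_W(1)]]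
    this[OF smooth_matD(1)[OF smooth_gAB(2)] smooth_matD(1)[OF smooth_W(2)]]
    this[OF smooth_matD(1)[OF smooth_gAB(3)] smooth_matD(1)[OF smooth_W(3)]]
  show ?thesis
    by (simp only: \<Gamma>\<^sub>V_def t(2) gamma_eq[OF t(1)])
qed

text \<open>The family is affine in \<open>s\<close> and lies in the group for every real
  \<open>s\<close>, so the width 1 is an arbitrary choice.\<close>

lemma proper_variation_\<Gamma>\<^sub>V: "proper_variation m d (carrier G) \<gamma> a b 1 \<Gamma>\<^sub>V"
  unfolding proper_variation_def
proof (intro conjI ballI)
  have "open (UNIV \<times> I :: (real \<times> real) set)" using I by (simp add: open_Times)
  then show "\<exists>U. open U \<and> {- 1<..<1} \<times> {a..b} \<subseteq> U \<and> smooth_triple_on m d U (\<lambda>(s, t). \<Gamma>\<^sub>V s t)"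
    using smooth_\<Gamma>\<^sub>V ab by (intro exI[of _ "UNIV \<times> I"]) auto
  have "a \<in> I" "b \<in> I" using ab by auto
  then show "\<Gamma>\<^sub>V s a = \<gamma> a" "\<Gamma>\<^sub>V s b = \<gamma> b" for s
    by (auto intro!: \<Gamma>\<^sub>V_base simp: \<phi>_def)
qed (use \<Gamma>\<^sub>V_in_G \<Gamma>\<^sub>V_base ab in auto)

text \<open>\<open>bform\<close> strips the factors \<open>g\<close> and \<open>K\<close> from
  \<open>W1\<close> and \<open>W2\<close>, by \<open>g\<^sup>T L g = L\<close> and
  \<open>L K = 1\<close>.\<close>

lemma R_\<Gamma>\<^sub>V:
  assumes t: "t \<in> I"
  shows "R \<Gamma>\<^sub>V t = \<phi> t * (frob (RS t) V1 + 2 * frob (RT t) V2 + frob (RD t) V3)"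
proof -
  have x: "(0::real, t) \<in> UNIV \<times> I" using t by simp
  note c = smooth_gAB[THEN smooth_matD(1)] smooth_W[THEN smooth_matD(1)]
  note f = smooth_family[OF smooth_gAB(1) smooth_W(1)] smooth_family[OF smooth_gAB(2) smooth_W(2)]
    smooth_family[OF smooth_gAB(3) smooth_W(3)]
  have v: "vg \<Gamma>\<^sub>V t = \<phi> t \<cdot>\<^sub>m W1 t" "vA \<Gamma>\<^sub>V t = \<phi> t \<cdot>\<^sub>m W2 t" "vB \<Gamma>\<^sub>V t = \<phi> t \<cdot>\<^sub>m W3 t"
    unfolding vg_def vA_def vB_def \<Gamma>\<^sub>V_def fst_conv snd_conv
      trunc_id[OF smooth_matD(1)[OF f(1)]] trunc_id[OF smooth_matD(1)[OF f(2)]] trunc_id[OF smooth_matD(1)[OF f(3)]]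
    by (rule dmat_affine_family[OF f(1) x c(1) c(4)] dmat_affine_family[OF f(2) x c(2) c(5)]
      dmat_affine_family[OF f(3) x c(3) c(6)])+
  note dims = smooth_gAB[THEN smooth_matD(2)] smooth_gAB[THEN smooth_matD(3)]
    smooth_W[THEN smooth_matD(2)] smooth_W[THEN smooth_matD(3)] V[THEN carrier_matD(1)] V[THEN carrier_matD(2)]
    K[THEN carrier_matD(1)] K[THEN carrier_matD(2)] L[THEN carrier_matD(1)] L[THEN carrier_matD(2)]
    smooth_R[THEN smooth_matD(2)] smooth_R[THEN smooth_matD(3)]
  have gLg: "(g t)\<^sup>T * (L * g t) = L" using gAB_in_G(2)[OF t] by (simp add: Sp_iff)
  have *: "bform L (g t) (\<phi> t \<cdot>\<^sub>m (g t * (K * M))) = \<phi> t \<cdot>\<^sub>m M" if "M \<in> carrier_mat m c" for M c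
  proof -
    have "bform L (g t) (\<phi> t \<cdot>\<^sub>m (g t * (K * M))) = \<phi> t \<cdot>\<^sub>m (((g t)\<^sup>T * (L * g t)) * (K * M))"
      using that by (simp add: bform_def mat_expand dims)
    also have "\<dots> = \<phi> t \<cdot>\<^sub>m ((L * K) * M)" unfolding gLg using that by (simp add: mat_expand dims)
    finally show ?thesis unfolding LK using that by simp
  qed
  have D: "dform L (A t) (\<phi> t \<cdot>\<^sub>m W2 t) (\<phi> t \<cdot>\<^sub>m W3 t) = \<phi> t \<cdot>\<^sub>m V3"
  proof -
    have "(A t)\<^sup>T * L * (\<phi> t \<cdot>\<^sub>m W2 t) = \<phi> t \<cdot>\<^sub>m bform L (A t) (W2 t)"
      by (simp add: bform_def mat_expand dims)
    then show ?thesis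
      unfolding dform_def W3_def
      by (intro eq_matI) (simp_all add: sym_part_smult bform_def dims field_simps del: index_mult_mat(1))
  qed
  show ?thesis
    unfolding R_def v D unfolding W1_def W2_def *[OF V(1)] *[OF V(2)]
    by (simp add: frob_simps dims algebra_simps)
qed

end

text \<open>The fundamental lemma of the calculus of variations. If \<open>r\<close> were nonzero at
  \<open>t0\<close>, it would keep its sign on a small interval, and the first variation for the
  weight \<open>\<phi>\<close> would be the integral of a continuous function of one sign that does
  not vanish at \<open>t0\<close>.\<close>

lemma residuals_orthogonal:
  assumes geo: "geodesic_on m d (carrier G) met I \<gamma>" and t0: "t0 \<in> I"
    and V: "V1 \<in> carrier_mat m m" "V2 \<in> carrier_mat m d" "V3 \<in> carrier_mat d d"
    and V1: "V1\<^sup>T = V1" "V1 * (K * V1) = 0\<^sub>m m m" and V3: "V3\<^sup>T = V3"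
  shows "frob (RS t0) V1 + 2 * frob (RT t0) V2 + frob (RD t0) V3 = 0"
proof (rule ccontr)
  define r where "r t = frob (RS t) V1 + 2 * frob (RT t) V2 + frob (RD t) V3" for t
  assume "\<not> ?thesis"
  then have r0: "r t0 \<noteq> 0" by (simp add: r_def)
  have cont: "continuous_on I r"
    unfolding r_def
    by (intro smooth_on_imp_continuous_on smooth_on_add smooth_on_mult I smooth_on_const
      smooth_on_frob[OF I smooth_R(1) smooth_mat_const[OF V(1)]] smooth_on_frob[OF I smooth_R(2) smooth_mat_const[OF V(2)]]
      smooth_on_frob[OF I smooth_R(3) smooth_mat_const[OF V(3)]])
  \<comment> \<open>The constant factor \<open>r t0\<close> makes the function positive near
    \<open>t0\<close> whatever the sign of \<open>r\<close>.\<close>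
  then have "continuous_on I (\<lambda>t. r t0 * r t)" by (intro continuous_intros)
  then have "open ((\<lambda>t. r t0 * r t) -` {0<..} \<inter> I)"
    using continuous_on_open_vimage[OF I] open_greaterThan by metis
  moreover have "t0 \<in> (\<lambda>t. r t0 * r t) -` {0<..} \<inter> I"
    using r0 t0 by (auto simp: zero_less_mult_iff)
  ultimately obtain \<delta> where \<delta>: "\<delta> > 0" "cball t0 \<delta> \<subseteq> (\<lambda>t. r t0 * r t) -` {0<..} \<inter> I"
    using open_contains_cball by blast
  define a where "a = t0 - \<delta>"
  define b where "b = t0 + \<delta>"
  have ab: "a < b" "{a..b} \<subseteq> I" and pos: "\<And>t. t \<in> {a..b} \<Longrightarrow> r t0 * r t > 0"
    using \<delta> by (auto simp: a_def b_def cball_eq_atLeastAtMost subset_iff)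
  let ?\<phi> = "\<lambda>t. (t - a) * (b - t)"
  let ?\<Gamma> = "\<Gamma>\<^sub>V V1 V2 V3 a b"
  have "((\<lambda>s. energy met a b (?\<Gamma> s)) has_real_derivative 0) (at 0)"
    using geo ab proper_variation_\<Gamma>\<^sub>V[OF V V1 V3 ab] unfolding geodesic_on_def by blast
  with energy_derivative[OF ab proper_variation_\<Gamma>\<^sub>V[OF V V1 V3 ab]]
  have "- integral {a..b} (R ?\<Gamma>) = 0" using DERIV_unique by blast
  then have "integral {a..b} (R ?\<Gamma>) = 0" by simp
  moreover have "R ?\<Gamma> t = ?\<phi> t * r t" if "t \<in> {a..b}" for t
    using R_\<Gamma>\<^sub>V[OF V V1 V3 ab] that ab by (auto simp: r_def \<phi>_def[OF V V1 V3 ab])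
  then have "integral {a..b} (R ?\<Gamma>) = integral {a..b} (\<lambda>t. ?\<phi> t * r t)"
    by (rule integral_cong)
  ultimately have z: "integral {a..b} (\<lambda>t. ?\<phi> t * r t) = 0" by simp
  have c: "continuous_on {a..b} (\<lambda>t. ?\<phi> t * r t)"
    by (intro continuous_intros continuous_on_subset[OF cont ab(2)])
  have "((\<lambda>t. ?\<phi> t * r t) has_integral 0) {a..b}"
    using integrable_integral[OF integrable_continuous_interval[OF c]] z by simp
  from has_integral_mult_right[OF this, of "r t0"]
  have i: "((\<lambda>t. r t0 * (?\<phi> t * r t)) has_integral 0) (cbox a b)" by simp
  have "r t0 * (?\<phi> t0 * r t0) = 0"
  proof (rule has_integral_0_cbox_imp_0[OF _ _ i])
    show "continuous_on (cbox a b) (\<lambda>t. r t0 * (?\<phi> t * r t))"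
      using c by (auto intro: continuous_intros)
    show "0 \<le> r t0 * (?\<phi> t * r t)" if "t \<in> box a b" for t
    proof -
      have "r t0 * (?\<phi> t * r t) = ?\<phi> t * (r t0 * r t)" by (simp only: mult.left_commute)
      moreover have "?\<phi> t \<ge> 0" "r t0 * r t \<ge> 0" using pos[of t] that by auto
      ultimately show ?thesis by (metis mult_nonneg_nonneg)
    qed
  qed (use \<delta>(1) in \<open>auto simp: a_def b_def\<close>)
  \<comment> \<open>At the midpoint \<open>t0\<close> the weight is the square of
    \<open>\<delta>\<close>, hence nonzero.\<close>
  then show False using r0 \<delta>(1) by (simp add: a_def b_def)
qed

end

text \<open>Basis vectors give the diagonal entries, and the sum of two basis vectors gives twice an
  off-diagonal entry.\<close>

lemma symmetric_zero_by_polarization: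
  assumes M: "M \<in> carrier_mat r r" "M\<^sup>T = M"
    and z: "\<And>v. frob M (mat r r (\<lambda>(i, j). v i * v j)) = 0"
  shows "M = 0\<^sub>m r r"
proof (rule eq_matI)
  fix p q assume "p < dim_row (0\<^sub>m r r)" "q < dim_col (0\<^sub>m r r)"
  then have pq: "p < r" "q < r" by simp_all
  have sym: "M $$ (q, p) = M $$ (p, q)"
  proof -
    have "M $$ (q, p) = M\<^sup>T $$ (p, q)" using M(1) pq by simp
    then show ?thesis unfolding M(2) .
  qed
  have z': "(\<Sum>i<r. \<Sum>j<r. M $$ (i, j) * (v i * v j)) = 0" for v :: "nat \<Rightarrow> real"
    using z[of v] M(1) by (simp add: frob_def)
  define e where "e a i = (if i = a then 1 else 0 :: real)" for a i :: nat
  have entry: "(\<Sum>i<r. \<Sum>j<r. M $$ (i, j) * (e a i * e b j)) = M $$ (a, b)" if "a < r" "b < r" for a b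
  proof -
    have "(\<Sum>i<r. \<Sum>j<r. M $$ (i, j) * (e a i * e b j)) = (\<Sum>i<r. \<Sum>j<r. if j = b then (if i = a then M $$ (i, j) else 0) else 0)"
      by (intro sum.cong refl) (simp add: e_def)
    then show ?thesis using that by simp
  qed
  have diag: "M $$ (a, a) = 0" if "a < r" for a
    using z'[of "e a"] entry[OF that that] by simp
  have "(\<Sum>i<r. \<Sum>j<r. M $$ (i, j) * ((e p i + e q i) * (e p j + e q j))) =
      M $$ (p, p) + M $$ (p, q) + M $$ (q, p) + M $$ (q, q)"
  proof -
    have "(\<Sum>i<r. \<Sum>j<r. M $$ (i, j) * ((e p i + e q i) * (e p j + e q j))) =
      (\<Sum>i<r. \<Sum>j<r. M $$ (i, j) * (e p i * e p j)) + (\<Sum>i<r. \<Sum>j<r. M $$ (i, j) * (e p i * e q j)) +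
      (\<Sum>i<r. \<Sum>j<r. M $$ (i, j) * (e q i * e p j)) + (\<Sum>i<r. \<Sum>j<r. M $$ (i, j) * (e q i * e q j))"
      by (simp add: distrib_left distrib_right sum.distrib)
    then show ?thesis by (simp only: entry pq)
  qed
  then have "2 * M $$ (p, q) = 0"
    using z'[of "\<lambda>i. e p i + e q i"] diag pq sym by simp
  then show "M $$ (p, q) = 0\<^sub>m r r $$ (p, q)" using pq by simp
qed (use M in simp_all)

context jacobi_curve
begin

text \<open>The blocks are tested one at a time. \<open>RT\<close> and \<open>RD\<close> may be
  paired with themselves; \<open>RS\<close> need not satisfy \<open>V K V = 0\<close>, so it is
  tested with rank one matrices.\<close>

lemma residuals_zero_if_geodesic:
  assumes geo: "geodesic_on m d (carrier G) met I \<gamma>" and t: "t \<in> I"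
  shows "RS t = 0\<^sub>m m m" "RT t = 0\<^sub>m m d" "RD t = 0\<^sub>m d d"
proof -
  note c = smooth_R[THEN smooth_matD(1)]
  note dims = smooth_R[THEN smooth_matD(2)] smooth_R[THEN smooth_matD(3)]
  note orth = residuals_orthogonal[OF geo t]
  have Z: "0\<^sub>m m m \<in> carrier_mat m m" "0\<^sub>m m d \<in> carrier_mat m d" "0\<^sub>m d d \<in> carrier_mat d d"
    "(0\<^sub>m m m)\<^sup>T = (0\<^sub>m m m :: real mat)" "(0\<^sub>m d d)\<^sup>T = (0\<^sub>m d d :: real mat)" "0\<^sub>m m m * (K * 0\<^sub>m m m) = 0\<^sub>m m m"
    using K by auto
  show "RS t = 0\<^sub>m m m"
  proof (rule symmetric_zero_by_polarization[OF c(1) RS_symmetric[OF t]])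
    show "frob (RS t) (mat m m (\<lambda>(i, j). v i * v j)) = 0" for v
      using orth[OF rank_one_isotropic(1) Z(2,3) rank_one_isotropic(2,3) Z(5), of v]
      by (simp add: frob_zero_right dims)
  qed
  have "frob (RT t) (RT t) = 0"
    using orth[OF Z(1) c(2) Z(3) Z(4) Z(6) Z(5), of t] by (simp add: frob_zero_right dims)
  then show "RT t = 0\<^sub>m m d" by (simp add: frob_self_eq_0 dims)
  have "frob (RD t) (RD t) = 0"
    using orth[OF Z(1,2) c(3) Z(4) Z(6) RD_symmetric[OF t]] by (simp add: frob_zero_right dims)
  then show "RD t = 0\<^sub>m d d" by (simp add: frob_self_eq_0 dims)
qed

lemma geodesic_iff:
  "geodesic_on m d (carrier G) met I \<gamma> \<longleftrightarrow>
    (\<forall>t\<in>I. RS t = 0\<^sub>m m m \<and> RT t = 0\<^sub>m m d \<and> RD t = 0\<^sub>m d d)"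
  using geodesic_if_residuals_zero residuals_zero_if_geodesic by blast

end

section \<open>The Bloch--Iserles system\<close>

lemma four_block_mat_inject:
  assumes c: "A \<in> carrier_mat r1 c1" "B \<in> carrier_mat r1 c2" "C \<in> carrier_mat r2 c1" "D \<in> carrier_mat r2 c2"
      "A' \<in> carrier_mat r1 c1" "B' \<in> carrier_mat r1 c2" "C' \<in> carrier_mat r2 c1" "D' \<in> carrier_mat r2 c2"
    and eq: "four_block_mat A B C D = four_block_mat A' B' C' D'"
  shows "A = A'" "B = B'" "C = C'" "D = D'"
proof -
  have e: "four_block_mat A B C D $$ (i, j) = four_block_mat A' B' C' D' $$ (i, j)" for i j using eq by simp
  note dims = c[THEN carrier_matD(1)] c[THEN carrier_matD(2)]
  show "A = A'"
  proof (rule eq_matI)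
    show "A $$ (i, j) = A' $$ (i, j)" if "i < dim_row A'" "j < dim_col A'" for i j
      using e[of i j] that by (simp add: dims)
  qed (simp_all add: dims)
  show "B = B'"
  proof (rule eq_matI)
    show "B $$ (i, j) = B' $$ (i, j)" if "i < dim_row B'" "j < dim_col B'" for i j
      using e[of i "j + c1"] that by (simp add: dims)
  qed (simp_all add: dims)
  show "C = C'"
  proof (rule eq_matI)
    show "C $$ (i, j) = C' $$ (i, j)" if "i < dim_row C'" "j < dim_col C'" for i j
      using e[of "i + r1" j] that by (simp add: dims)
  qed (simp_all add: dims)
  show "D = D'"
  proof (rule eq_matI)
    show "D $$ (i, j) = D' $$ (i, j)" if "i < dim_row D'" "j < dim_col D'" for i j
      using e[of "i + r1" "j + c1"] that by (simp add: dims)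
  qed (simp_all add: dims)
qed

lemma smooth_mat_four_block:
  assumes "smooth_mat r1 c1 U A" "smooth_mat r1 c2 U B" "smooth_mat r2 c1 U C" "smooth_mat r2 c2 U D"
  shows "smooth_mat (r1 + r2) (c1 + c2) U (\<lambda>x. four_block_mat (A x) (B x) (C x) (D x))"
  unfolding smooth_mat_def
proof (intro conjI allI impI)
  note dims = assms[THEN smooth_matD(2)] assms[THEN smooth_matD(3)]
  show "four_block_mat (A x) (B x) (C x) (D x) \<in> carrier_mat (r1 + r2) (c1 + c2)" for x
    by (auto simp: dims)
  show "smooth_on U (\<lambda>x. four_block_mat (A x) (B x) (C x) (D x) $$ (i, j))"
    if "i < r1 + r2" "j < c1 + c2" for i j
    using that smooth_matD(4)[OF assms(1), of i j] smooth_matD(4)[OF assms(2), of i "j - c1"]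
      smooth_matD(4)[OF assms(3), of "i - r1" j] smooth_matD(4)[OF assms(4), of "i - r1" "j - c1"]
    by (cases "i < r1"; cases "j < c1") (simp_all add: dims)
qed

lemma dmat_four_block:
  assumes "smooth_mat r1 c1 U A" "smooth_mat r1 c2 U B" "smooth_mat r2 c1 U C" "smooth_mat r2 c2 U D"
  shows "dmat (\<lambda>x. four_block_mat (A x) (B x) (C x) (D x)) v x =
    four_block_mat (dmat A v x) (dmat B v x) (dmat C v x) (dmat D v x)"
proof (rule eq_matI)
  note dims = assms[THEN smooth_matD(2)] assms[THEN smooth_matD(3)]
  fix i j assume "i < dim_row (four_block_mat (dmat A v x) (dmat B v x) (dmat C v x) (dmat D v x))"
    "j < dim_col (four_block_mat (dmat A v x) (dmat B v x) (dmat C v x) (dmat D v x))"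
  then show "dmat (\<lambda>x. four_block_mat (A x) (B x) (C x) (D x)) v x $$ (i, j) =
    four_block_mat (dmat A v x) (dmat B v x) (dmat C v x) (dmat D v x) $$ (i, j)"
    by (simp add: index_dmat dims)
qed simp_all

lemma mat_minus_eq_zero_iff:
  fixes M N :: "real mat"
  assumes "M \<in> carrier_mat r c" "N \<in> carrier_mat r c"
  shows "M - N = 0\<^sub>m r c \<longleftrightarrow> M = N"
proof
  assume e: "M - N = 0\<^sub>m r c"
  show "M = N"
  proof (rule eq_matI)
    show "M $$ (i, j) = N $$ (i, j)" if "i < dim_row N" "j < dim_col N" for i j
      using arg_cong[OF e, of "\<lambda>M. M $$ (i, j)"] that assms by simp
  qed (use assms in auto)
qed (use assms in auto)

context jacobi_curve
begin

lemma velocity_gamma: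
  assumes t: "t \<in> I"
  shows "velocity \<gamma> t = (dmat g 1 t, dmat A 1 t, dmat B 1 t)"
proof -
  have c: "fst (\<gamma> t) \<in> carrier_mat m m" "fst (snd (\<gamma> t)) \<in> carrier_mat m d" "snd (snd (\<gamma> t)) \<in> carrier_mat d d"
    using in_G[OF t] by (auto simp: carrier_G Sp_iff Sym_iff)
  show ?thesis
    unfolding velocity_def mat_deriv_eq_dmat[OF smooth_gAB(1) t, symmetric]
      mat_deriv_eq_dmat[OF smooth_gAB(2) t, symmetric] mat_deriv_eq_dmat[OF smooth_gAB(3) t, symmetric]
    unfolding g_def[abs_def] A_def[abs_def] B_def[abs_def]
    using mat_deriv_trunc[of "\<lambda>\<tau>. fst (\<gamma> \<tau>)", OF c(1)] mat_deriv_trunc[of "\<lambda>\<tau>. fst (snd (\<gamma> \<tau>))", OF c(2)]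
      mat_deriv_trunc[of "\<lambda>\<tau>. snd (snd (\<gamma> \<tau>))", OF c(3)]
    by simp
qed

definition X where "X t = four_block_mat (S t) (T t) ((T t)\<^sup>T) (D t)"

text \<open>The factor 2 in the lower right block cancels the 1/2 of \<open>to_identity_G\<close>,
  which leaves \<open>D\<close>.\<close>

lemma bi_matrix_left_log_deriv:
  assumes t: "t \<in> I"
  shows "bi_matrix Q K (left_log_deriv G \<gamma> t) = Q * X t * Q\<^sup>T"
proof -
  have c: "g t \<in> carrier_mat m m" by (rule smooth_matD(1)[OF smooth_gAB(1)])
  note dc = smooth_gAB[THEN dmat_carrier]
  have "2 \<cdot>\<^sub>m ((1 / 2) \<cdot>\<^sub>m M) = M" for M :: "real mat" by (rule eq_matI) auto
  then show ?thesis
    unfolding left_log_deriv_def gamma_eq[OF t] velocity_gamma[OF t] to_identity_G[OF gAB_in_G(1)[OF t] dc]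
      bi_matrix.simps mat_inv_K L_sp_inv[OF c dc(1)] L_sp_inv[OF c dc(2)] X_def S_def T_def D_def
    by simp
qed

lemma smooth_X: "smooth_mat (m + d) (m + d) I X"
  unfolding X_def[abs_def]
  by (rule smooth_mat_four_block[OF smooth_STD(1,2) smooth_mat_transpose[OF smooth_STD(2)] smooth_STD(3)])

lemma X_symmetric:
  assumes t: "t \<in> I"
  shows "(X t)\<^sup>T = X t"
  unfolding X_def
  using transpose_four_block_mat[of "S t" m m "T t" d "(T t)\<^sup>T" d "D t"] S_symmetric[OF t] D_symmetric[OF t]
    smooth_STD[THEN smooth_matD(1)] by simp

text \<open>Comparison by blocks. The lower left equation is the transpose of the upper right one,
  since \<open>(- (K * W))\<^sup>T = W\<^sup>T * K\<close>.\<close>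

lemma X_equation_iff:
  assumes t: "t \<in> I"
  shows "dmat X 1 t = X t * X t * pad_zero m d K - pad_zero m d K * (X t * X t) \<longleftrightarrow>
    RS t = 0\<^sub>m m m \<and> RT t = 0\<^sub>m m d \<and> RD t = 0\<^sub>m d d"
proof -
  note c = smooth_STD[THEN smooth_matD(1), of t]
  note dims = smooth_STD[THEN smooth_matD(2)] smooth_STD[THEN smooth_matD(3)]
    K[THEN carrier_matD(1)] K[THEN carrier_matD(2)]
  define P where "P = S t * S t + T t * (T t)\<^sup>T"
  define W where "W = S t * T t + T t * D t"
  have P: "P \<in> carrier_mat m m" and W: "W \<in> carrier_mat m d"
    by (rule carrier_matI; simp add: P_def W_def dims)+
  have WT: "W\<^sup>T = (T t)\<^sup>T * S t + D t * (T t)\<^sup>T"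
    using S_symmetric[OF t] D_symmetric[OF t] by (simp add: W_def mat_expand dims)
  have KW: "K * W \<in> carrier_mat m d" "W\<^sup>T * K \<in> carrier_mat d m" "- (K * W) \<in> carrier_mat m d"
    and PK: "P * K \<in> carrier_mat m m" "K * P \<in> carrier_mat m m" "P * K - K * P \<in> carrier_mat m m"
    using P W K by auto
  define E where "E = (T t)\<^sup>T * T t + D t * D t"
  have E: "E \<in> carrier_mat d d" by (rule carrier_matI; simp add: E_def dims)
  have TT: "(T t)\<^sup>T \<in> carrier_mat d m" and WTc: "W\<^sup>T \<in> carrier_mat d m"
    using c(2) W by simp_all
  have XX: "X t * X t = four_block_mat P W (W\<^sup>T) E"
    unfolding X_def mult_four_block_mat[OF c(1,2) TT c(3) c(1,2) TT c(3)] WT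
    unfolding P_def W_def E_def ..
  note dims' = P[THEN carrier_matD(1)] P[THEN carrier_matD(2)] W[THEN carrier_matD(1)] W[THEN carrier_matD(2)]
    E[THEN carrier_matD(1)] E[THEN carrier_matD(2)] dims
  have "X t * X t * pad_zero m d K = four_block_mat (P * K) (0\<^sub>m m d) (W\<^sup>T * K) (0\<^sub>m d d)"
    unfolding XX mult_four_block_mat[OF P W WTc E K zero_carrier_mat zero_carrier_mat zero_carrier_mat]
    using PK KW by (simp add: mat_mult_right_zero_dim dims')
  moreover have "pad_zero m d K * (X t * X t) = four_block_mat (K * P) (K * W) (0\<^sub>m d m) (0\<^sub>m d d)"
    unfolding XX mult_four_block_mat[OF K zero_carrier_mat zero_carrier_mat zero_carrier_mat P W WTc E]
    using PK KW by (simp add: mat_mult_left_zero_dim dims')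
  ultimately have "X t * X t * pad_zero m d K - pad_zero m d K * (X t * X t) =
      four_block_mat (P * K) (0\<^sub>m m d) (W\<^sup>T * K) (0\<^sub>m d d) - four_block_mat (K * P) (K * W) (0\<^sub>m d m) (0\<^sub>m d d)"
    by simp
  also have "\<dots> = four_block_mat (P * K - K * P) (- (K * W)) (W\<^sup>T * K) (0\<^sub>m d d)"
    by (intro eq_matI) (simp_all add: dims' del: index_mult_mat(1))
  finally have rhs: "X t * X t * pad_zero m d K - pad_zero m d K * (X t * X t) =
      four_block_mat (P * K - K * P) (- (K * W)) (W\<^sup>T * K) (0\<^sub>m d d)" .
  note dc = smooth_STD[THEN dmat_carrier, of 1 t]
  have lhs: "dmat X 1 t = four_block_mat (dmat S 1 t) (dmat T 1 t) ((dmat T 1 t)\<^sup>T) (dmat D 1 t)"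
    unfolding X_def[abs_def]
      dmat_four_block[OF smooth_STD(1,2) smooth_mat_transpose[OF smooth_STD(2)] smooth_STD(3)]
      dmat_transpose[OF smooth_STD(2) t] ..
  have RS: "RS t = 0\<^sub>m m m \<longleftrightarrow> dmat S 1 t = P * K - K * P"
    unfolding RS_def P_def[symmetric] by (rule mat_minus_eq_zero_iff[OF dc(1) PK(3)])
  have "RT t = dmat T 1 t - (- (K * W))"
    unfolding RT_def W_def[symmetric] using dc(2) KW(1) by (intro eq_matI) auto
  then have RT: "RT t = 0\<^sub>m m d \<longleftrightarrow> dmat T 1 t = - (K * W)"
    using mat_minus_eq_zero_iff[OF dc(2) KW(3)] by simp
  have KWT: "(- (K * W))\<^sup>T = W\<^sup>T * K"
    using W by (simp add: mat_expand dims K_antisym)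
  show ?thesis
  proof
    assume "dmat X 1 t = X t * X t * pad_zero m d K - pad_zero m d K * (X t * X t)"
    then have eq: "four_block_mat (dmat S 1 t) (dmat T 1 t) ((dmat T 1 t)\<^sup>T) (dmat D 1 t) =
      four_block_mat (P * K - K * P) (- (K * W)) (W\<^sup>T * K) (0\<^sub>m d d)" unfolding lhs rhs .
    have TT: "(dmat T 1 t)\<^sup>T \<in> carrier_mat d m" using dc(2) by simp
    show "RS t = 0\<^sub>m m m \<and> RT t = 0\<^sub>m m d \<and> RD t = 0\<^sub>m d d"
      using four_block_mat_inject[OF dc(1,2) TT dc(3) PK(3) KW(3) KW(2) zero_carrier_mat eq] RS RT
      by (simp add: RD_def)
  next
    assume "RS t = 0\<^sub>m m m \<and> RT t = 0\<^sub>m m d \<and> RD t = 0\<^sub>m d d"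
    then show "dmat X 1 t = X t * X t * pad_zero m d K - pad_zero m d K * (X t * X t)"
      unfolding lhs rhs RS RT using KWT by (simp add: RD_def)
  qed
qed

text \<open>Conjugation by a constant orthogonal \<open>Q\<close> commutes with products and with
  the time derivative, so the equation can be read in the basis where \<open>N\<close> is in block
  form.\<close>

lemma bloch_iserles_iff:
  assumes n: "n = m + d" and Q: "Q \<in> carrier_mat n n" "Q\<^sup>T * Q = 1\<^sub>m n"
    and N: "N = Q * pad_zero m d K * Q\<^sup>T"
  shows "bloch_iserles_on n N I (\<lambda>t. bi_matrix Q K (left_log_deriv G \<gamma> t)) \<longleftrightarrow>
    (\<forall>t\<in>I. RS t = 0\<^sub>m m m \<and> RT t = 0\<^sub>m m d \<and> RD t = 0\<^sub>m d d)"
proof -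
  define Y where "Y t = Q * X t * Q\<^sup>T" for t
  have QT: "Q\<^sup>T \<in> carrier_mat n n" using Q by simp
  have X: "X t \<in> carrier_mat n n" for t using smooth_matD(1)[OF smooth_X] n by simp
  have sX: "smooth_mat n n I X" using smooth_X n by simp
  have sY: "smooth_mat n n I Y"
    unfolding Y_def[abs_def]
    by (rule smooth_mat_mult[OF I smooth_mat_mult[OF I smooth_mat_const[OF Q(1)] sX] smooth_mat_const[OF QT]])
  define F where "F = pad_zero m d K"
  have F: "F \<in> carrier_mat n n" using K n by (auto simp: F_def)
  note dims = Q(1)[THEN carrier_matD(1)] Q(1)[THEN carrier_matD(2)] F[THEN carrier_matD(1)] F[THEN carrier_matD(2)]
    X[THEN carrier_matD(1)] X[THEN carrier_matD(2)]
  have QQ: "Q\<^sup>T * (Q * M) = M" if "M \<in> carrier_mat n c" for M c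
  proof -
    have "Q\<^sup>T * (Q * M) = (Q\<^sup>T * Q) * M" using that by (simp add: mat_expand dims)
    then show ?thesis unfolding Q(2) using that by simp
  qed
  have conj: "Q * M * Q\<^sup>T = Q * M' * Q\<^sup>T \<longleftrightarrow> M = M'" if M: "M \<in> carrier_mat n n" "M' \<in> carrier_mat n n" for M M'
  proof
    assume "Q * M * Q\<^sup>T = Q * M' * Q\<^sup>T"
    then have "Q\<^sup>T * ((Q * M * Q\<^sup>T) * Q) = Q\<^sup>T * ((Q * M' * Q\<^sup>T) * Q)" by simp
    moreover have "Q\<^sup>T * ((Q * M * Q\<^sup>T) * Q) = M" if "M \<in> carrier_mat n n" for M
    proof -
      have "Q\<^sup>T * ((Q * M * Q\<^sup>T) * Q) = (Q\<^sup>T * Q) * M * (Q\<^sup>T * Q)"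
        using that by (simp add: mat_expand dims)
      then show ?thesis unfolding Q(2) using that by simp
    qed
    ultimately show "M = M'" using M by simp
  qed simp
  have dX: "dmat X 1 t \<in> carrier_mat n n" for t by (rule dmat_carrier[OF sX])
  have dY: "dmat Y 1 t = Q * dmat X 1 t * Q\<^sup>T" if t: "t \<in> I" for t
  proof -
    have "dmat (\<lambda>t. Q * X t) 1 t = Q * dmat X 1 t"
      using dmat_mult[OF smooth_mat_const[OF Q(1)] sX t] dX[of t] X[of t] Q(1)
      by (simp add: dmat_const dims mat_expand)
    then show ?thesis
      unfolding Y_def[abs_def]
      using dmat_mult[OF smooth_mat_mult[OF I smooth_mat_const[OF Q(1)] sX] smooth_mat_const[OF QT] t, of 1] dX[of t] Q(1)
      by (simp add: dmat_const dims mat_expand)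
  qed
  have comm: "commutator (Y t * Y t) N = Q * (X t * X t * F - F * (X t * X t)) * Q\<^sup>T" for t
  proof -
    have "commutator (Y t * Y t) N = Q * (X t * (Q\<^sup>T * (Q * (X t * (Q\<^sup>T * (Q * (F * Q\<^sup>T))))))) -
        Q * (F * (Q\<^sup>T * (Q * (X t * (Q\<^sup>T * (Q * (X t * Q\<^sup>T)))))))"
      unfolding commutator_def Y_def N F_def[symmetric] by (simp add: mat_expand dims)
    also have "\<dots> = Q * (X t * (X t * (F * Q\<^sup>T))) - Q * (F * (X t * (X t * Q\<^sup>T)))"
      using X[of t] F QT by (simp add: QQ[of _ n] mult_carrier_mat[where n = n])
    also have "\<dots> = Q * (X t * X t * F - F * (X t * X t)) * Q\<^sup>T"
      by (simp add: mat_expand dims)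
    finally show ?thesis .
  qed
  have "bloch_iserles_on n N I (\<lambda>t. bi_matrix Q K (left_log_deriv G \<gamma> t)) \<longleftrightarrow>
    (\<forall>t\<in>I. dmat Y 1 t = commutator (Y t * Y t) N)"
  proof -
    have eqY: "bi_matrix Q K (left_log_deriv G \<gamma> t) = Y t" if "t \<in> I" for t
      using bi_matrix_left_log_deriv[OF that] by (simp add: Y_def)
    have sym: "Y t \<in> Sym n" if "t \<in> I" for t
      using X_symmetric[OF that] X[of t] Q(1) by (simp add: Sym_iff Y_def mat_expand dims)
    have der: "((\<lambda>\<tau>. Y \<tau> $$ (i, j)) has_real_derivative dmat Y 1 t $$ (i, j)) (at t)"
      if "t \<in> I" "i < n" "j < n" for t i j
      using smooth_on_imp_has_real_derivative[OF smooth_matD(4)[OF sY that(2,3)] that(1)] that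
      by (simp add: index_dmat smooth_matD[OF sY])
    \<comment> \<open>The logarithmic derivative is identified with \<open>Y\<close> on
      \<open>I\<close> only; openness of \<open>I\<close> suffices to transfer the
      derivative.\<close>
    have iff: "((\<lambda>\<tau>. bi_matrix Q K (left_log_deriv G \<gamma> \<tau>) $$ (i, j)) has_real_derivative c) (at t) \<longleftrightarrow>
      dmat Y 1 t $$ (i, j) = c" if t: "t \<in> I" "i < n" "j < n" for t i j c
    proof
      assume "((\<lambda>\<tau>. bi_matrix Q K (left_log_deriv G \<gamma> \<tau>) $$ (i, j)) has_real_derivative c) (at t)"
      then have "((\<lambda>\<tau>. Y \<tau> $$ (i, j)) has_real_derivative c) (at t)"
        by (rule has_field_derivative_transform_within_open[OF _ I t(1)]) (simp add: eqY)
      then show "dmat Y 1 t $$ (i, j) = c" using der[OF t] DERIV_unique by blast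
    next
      assume "dmat Y 1 t $$ (i, j) = c"
      then have "((\<lambda>\<tau>. Y \<tau> $$ (i, j)) has_real_derivative c) (at t)" using der[OF t] by simp
      then show "((\<lambda>\<tau>. bi_matrix Q K (left_log_deriv G \<gamma> \<tau>) $$ (i, j)) has_real_derivative c) (at t)"
        by (rule has_field_derivative_transform_within_open[OF _ I t(1)]) (simp add: eqY)
    qed
    have ext: "dmat Y 1 t = commutator (Y t * Y t) N \<longleftrightarrow>
      (\<forall>i<n. \<forall>j<n. dmat Y 1 t $$ (i, j) = commutator (Y t * Y t) N $$ (i, j))" for t
    proof -
      have "commutator (Y t * Y t) N \<in> carrier_mat n n"
        unfolding comm by (rule carrier_matI) (simp_all add: dims)
      note c = this[THEN carrier_matD(1)] this[THEN carrier_matD(2)]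
        dmat_carrier[OF sY, of 1 t, THEN carrier_matD(1)] dmat_carrier[OF sY, of 1 t, THEN carrier_matD(2)]
      show ?thesis
      proof
        assume "\<forall>i<n. \<forall>j<n. dmat Y 1 t $$ (i, j) = commutator (Y t * Y t) N $$ (i, j)"
        then show "dmat Y 1 t = commutator (Y t * Y t) N"
          by (intro eq_matI) (simp_all only: c)
      qed simp
    qed
    show ?thesis
      unfolding bloch_iserles_on_def by (simp add: eqY sym iff ext cong: ball_cong)
  qed
  also have "\<dots> \<longleftrightarrow> (\<forall>t\<in>I. dmat X 1 t = X t * X t * F - F * (X t * X t))"
  proof -
    have "X t * X t * F - F * (X t * X t) \<in> carrier_mat n n" for t
      by (rule carrier_matI) (simp_all add: dims)
    then show ?thesis using conj[OF dX] by (simp add: dY comm cong: ball_cong)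
  qed
  also have "\<dots> \<longleftrightarrow> (\<forall>t\<in>I. RS t = 0\<^sub>m m m \<and> RT t = 0\<^sub>m m d \<and> RD t = 0\<^sub>m d d)"
    unfolding F_def using X_equation_iff by blast
  finally show ?thesis .
qed

end

text \<open>Antisymmetry passes to the inverse: transpose \<open>Nb * L = 1\<close> and cancel
  \<open>Nb\<close> with \<open>L\<close> on the right.\<close>

lemma jacobi_of_normal_form:
  assumes "normal_form k d N Q Nb"
  shows "jacobi (2 * k) Nb (mat_inv Nb)"
proof -
  let ?m = "2 * k"
  have K: "Nb \<in> carrier_mat ?m ?m" "Nb\<^sup>T = - Nb" "invertible_mat Nb"
    using assms by (auto simp: normal_form_def)
  then obtain L where L': "Nb * L = 1\<^sub>m ?m" "L * Nb = 1\<^sub>m (dim_row L)"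
    unfolding invertible_mat_def inverts_mat_def by auto
  \<comment> \<open>\<open>invertible_mat\<close> does not state the size of the inverse; it is read
    off the dimensions of the two products.\<close>
  have L: "L \<in> carrier_mat ?m ?m"
  proof (rule carrier_matI)
    show "dim_col L = ?m" using arg_cong[OF L'(1), of dim_col] by simp
    show "dim_row L = ?m" using arg_cong[OF L'(2), of dim_col] K(1) by simp
  qed
  have LK: "L * Nb = 1\<^sub>m ?m" using L'(2) L by simp
  note dims = L[THEN carrier_matD(1)] L[THEN carrier_matD(2)] K(1)[THEN carrier_matD(1)] K(1)[THEN carrier_matD(2)]
  have "(Nb * L)\<^sup>T = (1\<^sub>m ?m :: real mat)" unfolding L'(1) by simp
  then have "- (L\<^sup>T * Nb) = 1\<^sub>m ?m"
    by (simp add: mat_expand dims K(2))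
  then have "- (L\<^sup>T * Nb) * L = L" using L by simp
  then have "- (L\<^sup>T * (Nb * L)) = L" by (simp add: mat_expand dims)
  then have "- (L\<^sup>T) = L" unfolding L'(1) using L by simp
  then have "L\<^sup>T = - L" by (metis uminus_uminus_mat)
  then show ?thesis
    using mat_inv_eqI[OF K(1) L L'(1) LK] K L L'(1) LK by unfold_locales simp_all
qed

theorem theorem2p7:
  fixes N :: "real mat" and n k d :: nat
  assumes "N \<in> carrier_mat n n"
    and "transpose_mat N = - N"
    and "n = 2 * k + d"
    and "kernel_dim N = d"
  shows "(\<exists>Q Nb. normal_form k d N Q Nb) \<and>
    (\<forall>Q Nb. normal_form k d N Q Nb \<longrightarrow>
      (let J = - mat_inv Nb;
           G = Jac (2 * k) J d;
           ip = lagrangian_form Nb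
       in group G \<and>
          inner_product_on (2 * k) d (jac_algebra (2 * k) J d) ip \<and>
          (\<forall>\<xi>\<in>jac_algebra (2 * k) J d. lagrangian Nb \<xi> = (1 / 2) * ip \<xi> \<xi>) \<and>
          (\<forall>I \<gamma>. open I \<and> is_interval I \<and> smooth_triple_on (2 * k) d I \<gamma> \<and>
                 (\<forall>t\<in>I. \<gamma> t \<in> carrier G) \<longrightarrow>
             (geodesic_on (2 * k) d (carrier G) (left_invariant_metric G ip) I \<gamma> \<longleftrightarrow>
              bloch_iserles_on n N I (\<lambda>t. bi_matrix Q Nb (left_log_deriv G \<gamma> t))))))"
proof (intro conjI allI impI)
  show "\<exists>Q Nb. normal_form k d N Q Nb"
    by (rule normal_form_exists[OF assms])
next
  fix Q Nb assume nf: "normal_form k d N Q Nb"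
  interpret jacobi "2 * k" d Nb "mat_inv Nb" by (rule jacobi_of_normal_form[OF nf])
  have Q: "Q \<in> carrier_mat n n" "Q\<^sup>T * Q = 1\<^sub>m n" "N = Q * pad_zero (2 * k) d Nb * Q\<^sup>T"
    using nf assms(3) by (auto simp: normal_form_def)
  have "geodesic_on (2 * k) d (carrier G) (left_invariant_metric G (lagrangian_form Nb)) I \<gamma> \<longleftrightarrow>
      bloch_iserles_on n N I (\<lambda>t. bi_matrix Q Nb (left_log_deriv G \<gamma> t))"
    if "open I" "smooth_triple_on (2 * k) d I \<gamma>" "\<forall>t\<in>I. \<gamma> t \<in> carrier G" for I \<gamma>
  proof -
    interpret jacobi_curve "2 * k" d Nb "mat_inv Nb" I \<gamma>
      using that by unfold_locales auto
    \<comment> \<open>Both properties amount to the vanishing of \<open>RS\<close>,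
      \<open>RT\<close> and \<open>RD\<close> on \<open>I\<close>.\<close>
    show ?thesis
      unfolding geodesic_iff bloch_iserles_iff[OF assms(3) Q] ..
  qed
  moreover have "lagrangian Nb \<xi> = (1 / 2) * lagrangian_form Nb \<xi> \<xi>"
    if "\<xi> \<in> jac_algebra (2 * k) (- mat_inv Nb) d" for \<xi>
    using that lagrangian_eq_form jac_algebraD by (cases \<xi>) blast
  ultimately show "let J = - mat_inv Nb; G = Jac (2 * k) J d; ip = lagrangian_form Nb
       in group G \<and>
          inner_product_on (2 * k) d (jac_algebra (2 * k) J d) ip \<and>
          (\<forall>\<xi>\<in>jac_algebra (2 * k) J d. lagrangian Nb \<xi> = (1 / 2) * ip \<xi> \<xi>) \<and>
          (\<forall>I \<gamma>. open I \<and> is_interval I \<and> smooth_triple_on (2 * k) d I \<gamma> \<and>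
                 (\<forall>t\<in>I. \<gamma> t \<in> carrier G) \<longrightarrow>
             (geodesic_on (2 * k) d (carrier G) (left_invariant_metric G ip) I \<gamma> \<longleftrightarrow>
              bloch_iserles_on n N I (\<lambda>t. bi_matrix Q Nb (left_log_deriv G \<gamma> t))))"
    unfolding Let_def using group_G inner_product_on_jac_algebra by blast
qed

end
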